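(* For $\beta\in(0,\infty)$ let $(\Phi_\beta,\operatorname{H}^1)$ be the continuous semiflow on $\operatorname{H}^1=\operatorname{H}^1(0,\pi)$ generated by the nonlinear nonlocal problem $$u_t-u_{xx}=0 \text{ in }(0,\infty)\times(0,\pi),\quad u_x(t,0)=\tanh\bigl(\beta u(t,\pi)\bigr),\quad u_x(t,\pi)=0 \text{ for } t>0,\quad u(0,\cdot)=u_0 .$$ Let $\hat{\mathcal{A}}_\beta$ be its minimal closed global attractor and $\mathcal{A}_\beta$ its minimal closed global B-attractor. (1) For every $\beta\in(0,\beta_0)$, $\hat{\mathcal{A}}_\beta=\{0\}$, where $\beta_0\approx 5.6655$ is the constant defined in the context. (2) For every $\beta\in(0,\tfrac{4}{\pi})$, $\mathcal{A}_\beta=\hat{\mathcal{A}}_\beta=\{0\}$.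
   Context: Semiflow. $\operatorname{H}^1=\operatorname{H}^1(0,\pi)$, and $\operatorname{H}^{-1}=(\operatorname{H}^1)'$ is its dual, with $\operatorname{H}^1\subset\operatorname{H}^{-1}$ via the $\operatorname{L}^2(0,\pi)$ pairing. $A_N:\operatorname{H}^1\subset\operatorname{H}^{-1}\to\operatorname{H}^{-1}$ is the (weak Neumann Laplacian) operator $\langle A_Nu,v\rangle=\int_0^\pi u_xv_x\,dx$. $-A_N$ generates a strongly continuous analytic semigroup $e^{-tA_N}$ on $\operatorname{H}^{-1}$. $\delta_0\in\operatorname{H}^{-1}$ is given by $\langle\delta_0,v\rangle=v(0)$. For $\beta>0$ and $u_0\in\operatorname{H}^1$, the problem is understood in the weak sense $\dot u+A_Nu=-\tanh\bigl(\beta u(t)(\pi)\bigr)\delta_0$, $u(0)=u_0$, and $\Phi_\beta(\cdot,u_0)\in\operatorname{C}([0,\infty),\operatorname{H}^1)$ is its unique global solution, i.e. the solution of $$\Phi_\beta(t,u_0)=e^{-tA_N}u_0-\int_0^t\tanh\bigl(\beta\,\Phi_\beta(\tau,u_0)(\pi)\bigr)\,e^{-(t-\tau)A_N}\delta_0\,d\tau,\quad t\ge0.$$ Attractors. For $B\subset\operatorname{H}^1$ the omega-limit set is $\omega(B)=\bigcap_{s\ge0}\overline{\bigcup_{t\ge s}\Phi_\beta(t,B)}$ (closure in $\operatorname{H}^1$), and $\omega(u)=\omega(\{u\})$. The minimal closed global attractor is $\hat{\mathcal{A}}_\beta=\overline{\bigcup_{u\in\operatorname{H}^1}\omega(u)}$.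 The minimal closed global B-attractor is $\mathcal{A}_\beta=\bigcup_{B\in\mathcal{B}}\omega(B)$, where $\mathcal{B}$ is the set of all bounded subsets of $\operatorname{H}^1$. The constant $\beta_0$. Let $\omega_0=\min\{\omega>0 : \sqrt{i\omega}\,\sin(\sqrt{i\omega}\,\pi)\in(0,\infty)\}$ and $\beta_0=\sqrt{i\omega_0}\,\sin(\sqrt{i\omega_0}\,\pi)\approx5.6655$. *)

theory Defs
  imports "HOL-Analysis.Analysis"
begin

section \<open>The Sobolev space on the interval from 0 to pi\<close>

abbreviation leb_I :: "real measure" where
  "leb_I \<equiv> restrict_space lborel {0..pi}"

definition L2_fun :: "(real \<Rightarrow> real) \<Rightarrow> bool" where
  "L2_fun f \<longleftrightarrow> f \<in> borel_measurable leb_I \<and> integrable leb_I (\<lambda>x. (f x)\<^sup>2)"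

definition test_fun :: "(real \<Rightarrow> real) \<Rightarrow> bool" where
  "test_fun \<phi> \<longleftrightarrow> (\<forall>x. \<phi> differentiable (at x)) \<and> continuous_on UNIV (deriv \<phi>)
     \<and> closure {x. \<phi> x \<noteq> 0} \<subseteq> {0<..<pi}"

text \<open>Weak derivatives are tested against compactly supported functions of class \<open>C\<^sup>1\<close>, which
  gives the same weak derivatives as smooth test functions.\<close>

definition weak_deriv :: "(real \<Rightarrow> real) \<Rightarrow> (real \<Rightarrow> real) \<Rightarrow> bool" where
  "weak_deriv u g \<longleftrightarrow>
     (\<forall>\<phi>. test_fun \<phi> \<longrightarrow> (\<integral>x. u x * deriv \<phi> x \<partial>leb_I) = - (\<integral>x. g x * \<phi> x \<partial>leb_I))"

lemma finite_measure_leb_I: "finite_measure leb_I"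
  by (rule finite_measureI) (simp add: emeasure_restrict_space space_restrict_space)

lemma space_leb_I [simp]: "space leb_I = {0..pi}"
  by (simp add: space_restrict_space)

lemma L2_fun_measurable: "L2_fun f \<Longrightarrow> f \<in> borel_measurable leb_I"
  by (simp add: L2_fun_def)

lemma L2_fun_integrable_square: "L2_fun f \<Longrightarrow> integrable leb_I (\<lambda>x. f x * f x)"
  by (simp add: L2_fun_def power2_eq_square)

lemma L2_fun_integrable: "L2_fun f \<Longrightarrow> integrable leb_I f"
  using finite_measure.square_integrable_imp_integrable[OF finite_measure_leb_I]
  by (auto simp: L2_fun_def)

lemma L2_fun_mult_integrable:
  assumes "L2_fun f" "L2_fun g"
  shows "integrable leb_I (\<lambda>x. f x * g x)"
proof (rule Bochner_Integration.integrable_bound)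
  show "integrable leb_I (\<lambda>x. (f x)\<^sup>2 + (g x)\<^sup>2)"
    using assms by (auto simp: L2_fun_def)
  show "(\<lambda>x. f x * g x) \<in> borel_measurable leb_I"
    using assms by (auto simp: L2_fun_def)
  have "\<bar>a * b\<bar> \<le> a\<^sup>2 + b\<^sup>2" for a b :: real
  proof -
    have "0 \<le> (\<bar>a\<bar> - \<bar>b\<bar>)\<^sup>2" by simp
    then have "2 * (\<bar>a\<bar> * \<bar>b\<bar>) \<le> a\<^sup>2 + b\<^sup>2"
      by (simp add: power2_eq_square algebra_simps)
    then show ?thesis
      by (simp add: abs_mult) (smt (verit) mult_nonneg_nonneg abs_ge_zero)
  qed
  then show "AE x in leb_I. norm (f x * g x) \<le> norm ((f x)\<^sup>2 + (g x)\<^sup>2)"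
    by auto
qed

lemma L2_fun_add:
  assumes "L2_fun f" "L2_fun g"
  shows "L2_fun (\<lambda>x. f x + g x)"
proof -
  have "integrable leb_I (\<lambda>x. (f x)\<^sup>2 + (g x)\<^sup>2 + 2 * (f x * g x))"
    using assms L2_fun_mult_integrable[OF assms]
    by (intro Bochner_Integration.integrable_add integrable_mult_right) (auto simp: L2_fun_def)
  also have "(\<lambda>x. (f x)\<^sup>2 + (g x)\<^sup>2 + 2 * (f x * g x)) = (\<lambda>x. (f x + g x)\<^sup>2)"
    by (simp add: power2_eq_square algebra_simps)
  finally show ?thesis
    using assms by (auto simp: L2_fun_def)
qed

lemma L2_fun_scale: "L2_fun f \<Longrightarrow> L2_fun (\<lambda>x. c * f x)"
  by (auto simp: L2_fun_def power_mult_distrib)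

lemma L2_fun_zero: "L2_fun (\<lambda>x. 0)"
  by (simp add: L2_fun_def)

lemma continuous_integrable_leb_I:
  fixes f :: "real \<Rightarrow> real"
  assumes "continuous_on {0..pi} f"
  shows "integrable leb_I f"
  using borel_integrable_atLeastAtMost'[OF assms]
  by (simp add: set_integrable_def integrable_restrict_space)

lemma continuous_L2_fun:
  assumes "continuous_on {0..pi} f"
  shows "L2_fun f"
  using assms continuous_integrable_leb_I[OF assms]
  by (auto simp: L2_fun_def intro!: continuous_integrable_leb_I continuous_intros)

lemma integral_leb_I_eq:
  fixes f :: "real \<Rightarrow> real"
  assumes "integrable leb_I f"
  shows "f integrable_on {0..pi}" "(\<integral>x. f x \<partial>leb_I) = integral {0..pi} f"
proof -
  have "set_integrable lborel {0..pi} f"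
    using assms by (simp add: set_integrable_def integrable_restrict_space)
  from set_borel_integral_eq_integral[OF this]
  show "f integrable_on {0..pi}" "(\<integral>x. f x \<partial>leb_I) = integral {0..pi} f"
    by (simp_all add: integral_restrict_space set_lebesgue_integral_def)
qed

lemma integral_leb_I_indicator:
  fixes g :: "real \<Rightarrow> real"
  assumes "integrable leb_I g" "0 \<le> a" "b \<le> pi"
  shows "(\<integral>x. indicator {a..b} x * g x \<partial>leb_I) = integral {a..b} g"
proof -
  have si: "set_integrable lborel {0..pi} g"
    using assms by (simp add: set_integrable_def integrable_restrict_space)
  have si2: "set_integrable lborel {a..b} g"
    by (rule set_integrable_subset[OF si]) (use assms in auto)
  have "(\<integral>x. indicator {a..b} x * g x \<partial>leb_I) = (LINT x:{a..b}|lborel. g x)"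
    using assms by (auto simp: integral_restrict_space set_lebesgue_integral_def indicator_def
      intro!: Bochner_Integration.integral_cong)
  also have "\<dots> = integral {a..b} g"
    using set_borel_integral_eq_integral(2)[OF si2] .
  finally show ?thesis .
qed

definition sq_pos :: "real \<Rightarrow> real" where
  "sq_pos y = (max 0 y)\<^sup>2 / 2"

lemma sq_pos_deriv: "(sq_pos has_real_derivative max 0 y) (at y)"
proof -
  consider "y < 0" | "y = 0" | "y > 0" by linarith
  then show ?thesis
  proof cases
    case 1
    have "(sq_pos has_real_derivative 0) (at y)"
      by (rule has_field_derivative_transform_within_open[where f = "\<lambda>_. 0" and S = "{..<0}"])
         (use 1 in \<open>auto simp: sq_pos_def\<close>)
    then show ?thesis using 1 by (simp add: max_def)
  next
    case 2
    have "((\<lambda>h. max 0 h / 2) \<longlongrightarrow> max 0 0 / (2::real)) (at (0::real))"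
      by (intro tendsto_intros) auto
    then have "((\<lambda>h. (sq_pos (0 + h) - sq_pos 0) / h) \<longlongrightarrow> 0) (at 0)"
      by (rule Lim_transform_eventually[THEN back_subst[of "\<lambda>l. (_ \<longlongrightarrow> l) _"]])
         (auto simp: sq_pos_def eventually_at_filter power2_eq_square max_def)
    then show ?thesis using 2 by (simp add: DERIV_def)
  next
    case 3
    have "(sq_pos has_real_derivative y) (at y)"
      by (rule has_field_derivative_transform_within_open[where f = "\<lambda>y. y\<^sup>2 / 2" and S = "{0<..}"])
         (use 3 in \<open>auto simp: sq_pos_def intro!: derivative_eq_intros\<close>)
    then show ?thesis using 3 by (simp add: max_def)
  qed
qed

text \<open>The next lemmas show that a continuous function with a square integrable weak derivative
  is an indefinite integral of it (\<open>weak_deriv_ftc\<close>) and that the weak derivative is unique almost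
  everywhere (\<open>weak_deriv_unique\<close>); the norm and the boundedness of point evaluation rest on this.\<close>

definition tent :: "real \<Rightarrow> real" where
  "tent y = max 0 (y + 1) - 2 * max 0 y + max 0 (y - 1)"

definition step :: "real \<Rightarrow> real" where
  "step y = sq_pos (y + 1) - 2 * sq_pos y + sq_pos (y - 1)"

lemma tent_nonneg: "0 \<le> tent y" and tent_zero: "1 \<le> \<bar>y\<bar> \<Longrightarrow> tent y = 0"
  and continuous_tent: "continuous_on UNIV tent"
  by (auto simp: tent_def max_def)[2] (auto simp: tent_def[abs_def] intro!: continuous_intros)

lemma step_deriv [derivative_intros]:
  assumes "(f has_real_derivative f') (at y)"
  shows "((\<lambda>y. step (f y)) has_real_derivative tent (f y) * f') (at y)"
proof -
  have "(step has_real_derivative tent z) (at z)" for z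
    unfolding step_def[abs_def] tent_def
    by (rule derivative_eq_intros DERIV_chain2[OF sq_pos_deriv] | simp)+
  from DERIV_chain2[OF this assms] show ?thesis .
qed

lemma step_left: "y \<le> -1 \<Longrightarrow> step y = 0"
  and step_right: "1 \<le> y \<Longrightarrow> step y = 1"
  by (auto simp: step_def sq_pos_def max_def power2_eq_square field_simps)

lemma step_mono: "x \<le> y \<Longrightarrow> step x \<le> step y"
  by (rule DERIV_nonneg_imp_nondecreasing)
     (auto intro!: exI step_deriv[OF DERIV_ident, simplified] tent_nonneg)

lemma step_bounds: "0 \<le> step y" "step y \<le> 1"
  using step_mono[of "min y (-1)" y] step_mono[of y "max y 1"]
  by (auto simp: step_left step_right)

lemma tent_kernel_has_integral:
  assumes "0 < d" "d \<le> a" "d \<le> pi - a"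
  shows "((\<lambda>x. tent ((x - a) / d) / d) has_integral 1) {0..pi}"
proof -
  have "((\<lambda>x. tent ((x - a) / d) / d) has_integral
      (step ((pi - a) / d) - step ((0 - a) / d))) {0..pi}"
  proof (rule fundamental_theorem_of_calculus)
    fix x
    have "((\<lambda>x. step ((x - a) / d)) has_real_derivative tent ((x - a) / d) / d) (at x)"
      using assms by (auto intro!: derivative_eq_intros)
    then show "((\<lambda>x. step ((x - a) / d)) has_vector_derivative tent ((x - a) / d) / d)
        (at x within {0..pi})"
      by (simp add: has_real_derivative_iff_has_vector_derivative has_vector_derivative_at_within)
  qed simp
  moreover have "step ((pi - a) / d) = 1"
    using assms by (intro step_right) (simp add: field_simps)
  moreover have "step ((0 - a) / d) = 0"
    using assms by (intro step_left) (simp add: field_simps)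
  ultimately show ?thesis by simp
qed

lemma inverse_Suc_less:
  assumes "N \<le> n" "inverse (real (Suc N)) < c"
  shows "inverse (real (Suc n)) < c"
proof -
  have "inverse (real (Suc n)) \<le> inverse (real (Suc N))"
    by (rule le_imp_inverse_le) (use assms in auto)
  then show ?thesis using assms(2) by linarith
qed

lemma tent_kernel_limit:
  fixes u :: "real \<Rightarrow> real"
  assumes u: "continuous_on {0..pi} u" and a: "0 < a" "a < pi"
  shows "(\<lambda>n. integral {0..pi} (\<lambda>x. u x * (tent ((x - a) * real (Suc n)) * real (Suc n))))
           \<longlonglongrightarrow> u a"
proof (rule LIMSEQ_I)
  fix r :: real assume r: "0 < r"
  have "a \<in> {0..pi}" using a by simp
  with u r obtain e where e: "0 < e" "\<And>x. x \<in> {0..pi} \<Longrightarrow> dist x a < e \<Longrightarrow> dist (u x) (u a) < r / 2"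
    unfolding continuous_on_iff by (meson half_gt_zero)
  define d0 where "d0 = Min {e, a, pi - a}"
  have d0: "0 < d0" "d0 \<le> e" "d0 \<le> a" "d0 \<le> pi - a"
    using e a by (auto simp: d0_def)
  obtain N where N: "inverse (real (Suc N)) < d0"
    using reals_Archimedean[OF d0(1)] by blast
  show "\<exists>no. \<forall>n\<ge>no. norm (integral {0..pi}
      (\<lambda>x. u x * (tent ((x - a) * real (Suc n)) * real (Suc n))) - u a) < r"
  proof (intro exI allI impI)
    fix n assume n: "N \<le> n"
    define d where "d = inverse (real (Suc n))"
    have d: "0 < d" "d < d0"
      using inverse_Suc_less[OF n N] by (simp_all add: d_def del: of_nat_Suc)
    define k where "k x = tent ((x - a) / d) / d" for x
    have kk: "k x = tent ((x - a) * real (Suc n)) * real (Suc n)" for x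
      by (simp add: k_def d_def field_simps)
    have k1: "(k has_integral 1) {0..pi}"
      unfolding k_def using d d0 by (intro tent_kernel_has_integral) auto
    have kc: "continuous_on {0..pi} k"
      unfolding k_def[abs_def] using d
      by (intro continuous_intros continuous_on_compose2[OF continuous_tent]) auto
    have ik: "(\<lambda>x. u x * k x) integrable_on {0..pi}"
      by (intro integrable_continuous_real continuous_intros u kc)
    have "((\<lambda>x. u x * k x - u a * k x) has_integral (integral {0..pi} (\<lambda>x. u x * k x) - u a * 1)) {0..pi}"
      by (intro has_integral_diff has_integral_mult_right k1 integrable_integral ik)
    moreover have "((\<lambda>x. r / 2 * k x) has_integral (r / 2 * 1)) {0..pi}"
      by (intro has_integral_mult_right k1)
    moreover have "norm (u x * k x - u a * k x) \<le> r / 2 * k x" if "x \<in> {0..pi}" for x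
    proof (cases "\<bar>x - a\<bar> < d")
      case True
      then have "\<bar>u x - u a\<bar> \<le> r / 2"
        using e(2)[OF that] d d0 by (simp add: dist_real_def)
      moreover have "0 \<le> k x" using d by (simp add: k_def tent_nonneg)
      ultimately have "\<bar>u x - u a\<bar> * k x \<le> r / 2 * k x" by (rule mult_right_mono)
      then show ?thesis using \<open>0 \<le> k x\<close> by (simp add: left_diff_distrib[symmetric] abs_mult)
    next
      case False
      then have "k x = 0" using d by (simp add: k_def tent_zero)
      then show ?thesis by simp
    qed
    ultimately have "norm (integral {0..pi} (\<lambda>x. u x * k x) - u a * 1) \<le> r / 2 * 1"
      by (metis (no_types, lifting) has_integral_iff integral_norm_bound_integral)
    then show "norm (integral {0..pi}
      (\<lambda>x. u x * (tent ((x - a) * real (Suc n)) * real (Suc n))) - u a) < r"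
      using r by (simp add: kk)
  qed
qed

lemma weak_deriv_integral_Icc:
  assumes u: "continuous_on {0..pi} u" and g: "L2_fun g" and w: "weak_deriv u g"
    and ab: "0 < a" "a < b" "b < pi"
  shows "u b - u a = integral {a..b} g"
proof -
  define K where "K c n x = tent ((x - c) * real (Suc n)) * real (Suc n)" for c n x
  define \<phi> where "\<phi> n x = step ((x - a) * real (Suc n)) - step ((x - b) * real (Suc n))" for n x
  have Kc: "continuous_on S (K c n)" for S c n
    unfolding K_def[abs_def]
    by (intro continuous_intros continuous_on_compose2[OF continuous_tent]) auto
  have d\<phi>: "(\<phi> n has_real_derivative (K a n x - K b n x)) (at x)" for n x
    unfolding \<phi>_def[abs_def] K_def by (auto intro!: derivative_eq_intros)
  then have deriv\<phi>: "deriv (\<phi> n) = (\<lambda>x. K a n x - K b n x)" for n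
    by (intro ext DERIV_imp_deriv)
  obtain N where N: "inverse (real (Suc N)) < min a (pi - b)"
    using reals_Archimedean[of "min a (pi - b)"] ab by auto
  have test: "test_fun (\<phi> n)" if n: "N \<le> n" for n
  proof -
    define d where "d = inverse (real (Suc n))"
    have d: "0 < d" "d < a" "d < pi - b"
      using inverse_Suc_less[OF n N] by (simp_all add: d_def del: of_nat_Suc)
    have dn: "(x - c) * real (Suc n) = (x - c) / d" for x c
      by (simp add: d_def field_simps)
    have z: "\<phi> n x = 0" if out: "x \<notin> {a - d..b + d}" for x
    proof -
      consider "x < a - d" | "b + d < x" using out unfolding atLeastAtMost_iff by linarith
      then show ?thesis
      proof cases
        case 1
        then have "(x - a) / d \<le> -1" "(x - b) / d \<le> -1"
          using ab d by (auto simp: field_simps)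
        then show ?thesis by (simp only: \<phi>_def dn step_left diff_self)
      next
        case 2
        then have "1 \<le> (x - a) / d" "1 \<le> (x - b) / d"
          using ab d by (auto simp: field_simps)
        then show ?thesis by (simp only: \<phi>_def dn step_right diff_self)
      qed
    qed
    have "closure {x. \<phi> n x \<noteq> 0} \<subseteq> {a - d..b + d}"
      by (rule closure_minimal) (use z in blast, simp)
    also have "\<dots> \<subseteq> {0<..<pi}" using d by auto
    finally have "closure {x. \<phi> n x \<noteq> 0} \<subseteq> {0<..<pi}" .
    then show ?thesis
      unfolding test_fun_def deriv\<phi>
      by (intro conjI allI continuous_on_diff Kc) (use d\<phi> in \<open>auto simp: real_differentiable_def\<close>)
  qed
  have \<phi>c: "continuous_on S (\<phi> n)" for S n
    by (rule DERIV_continuous_on, rule has_field_derivative_at_within, rule d\<phi>)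
  have "(\<lambda>n. integral {0..pi} (\<lambda>x. u x * K a n x) - integral {0..pi} (\<lambda>x. u x * K b n x))
      \<longlonglongrightarrow> u a - u b"
    unfolding K_def by (intro tendsto_diff tent_kernel_limit u) (use ab in auto)
  moreover have "integral {0..pi} (\<lambda>x. u x * K a n x) - integral {0..pi} (\<lambda>x. u x * K b n x)
      = (\<integral>x. u x * deriv (\<phi> n) x \<partial>leb_I)" for n
  proof -
    have "(\<integral>x. u x * deriv (\<phi> n) x \<partial>leb_I) = integral {0..pi} (\<lambda>x. u x * K a n x - u x * K b n x)"
      unfolding deriv\<phi> right_diff_distrib
      by (intro integral_leb_I_eq continuous_integrable_leb_I continuous_intros u Kc)
    also have "\<dots> = integral {0..pi} (\<lambda>x. u x * K a n x) - integral {0..pi} (\<lambda>x. u x * K b n x)"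
      by (intro integral_diff integrable_continuous_real continuous_intros u Kc)
    finally show ?thesis ..
  qed
  ultimately have lim1: "(\<lambda>n. \<integral>x. u x * deriv (\<phi> n) x \<partial>leb_I) \<longlonglongrightarrow> u a - u b" by simp
  have lim2: "(\<lambda>n. \<integral>x. g x * \<phi> n x \<partial>leb_I) \<longlonglongrightarrow> (\<integral>x. indicator {a..b} x * g x \<partial>leb_I)"
  proof (rule integral_dominated_convergence[where w = "\<lambda>x. norm (g x)"])
    have [measurable]: "g \<in> borel_measurable leb_I" by (rule L2_fun_measurable[OF g])
    show "(\<lambda>x. indicator {a..b} x * g x) \<in> borel_measurable leb_I"
      by (intro borel_measurable_times borel_measurable_indicator)
         (use ab in \<open>auto simp: sets_restrict_space_iff\<close>)
    show "(\<lambda>x. g x * \<phi> n x) \<in> borel_measurable leb_I" for n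
      by (intro borel_measurable_times L2_fun_measurable[OF g] L2_fun_measurable[OF continuous_L2_fun] \<phi>c)
    show "integrable leb_I (\<lambda>x. norm (g x))"
      using L2_fun_integrable[OF g] by simp
    show "AE x in leb_I. norm (g x * \<phi> n x) \<le> norm (g x)" for n
    proof (rule AE_I2)
      fix x
      have "\<bar>\<phi> n x\<bar> \<le> 1"
        using step_bounds[of "(x - a) * real (Suc n)"] step_bounds[of "(x - b) * real (Suc n)"]
        by (auto simp: \<phi>_def)
      then show "norm (g x * \<phi> n x) \<le> norm (g x)"
        by (simp add: abs_mult mult_left_le)
    qed
    have st: "(\<lambda>n. step ((x - c) * real (Suc n))) \<longlonglongrightarrow> (if c < x then 1 else 0)" if xc: "x \<noteq> c" for x c
    proof -
      obtain M where M: "inverse (real (Suc M)) < \<bar>x - c\<bar>"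
        using reals_Archimedean[of "\<bar>x - c\<bar>"] xc by auto
      have "step ((x - c) * real (Suc n)) = (if c < x then 1 else 0)" if "M \<le> n" for n
      proof -
        have "inverse (real (Suc n)) < \<bar>x - c\<bar>"
          by (rule inverse_Suc_less[OF that M])
        then have "1 < \<bar>x - c\<bar> * real (Suc n)" by (simp add: field_simps)
        then have "c < x \<Longrightarrow> 1 \<le> (x - c) * real (Suc n)" "\<not> c < x \<Longrightarrow> (x - c) * real (Suc n) \<le> -1"
          by (auto simp: abs_if algebra_simps split: if_splits)
        then show ?thesis by (simp add: step_left step_right del: of_nat_Suc)
      qed
      then show ?thesis
        by (intro tendsto_eventually eventually_sequentiallyI)
    qed
    have "AE x in lborel. x \<noteq> a \<and> x \<noteq> b"
      by (simp add: AE_lborel_singleton)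
    then have "AE x in leb_I. x \<noteq> a \<and> x \<noteq> b"
      by (subst AE_restrict_space_iff) auto
    then show "AE x in leb_I. (\<lambda>n. g x * \<phi> n x) \<longlonglongrightarrow> indicator {a..b} x * g x"
    proof eventually_elim
      case (elim x)
      have "(\<lambda>n. g x * \<phi> n x) \<longlonglongrightarrow> g x * ((if a < x then 1 else 0) - (if b < x then 1 else 0))"
        unfolding \<phi>_def using elim by (intro tendsto_intros st) auto
      also have "g x * ((if a < x then 1 else 0) - (if b < x then 1 else 0)) = indicator {a..b} x * g x"
        using elim ab by (auto simp: indicator_def)
      finally show ?case .
    qed
  qed
  have "\<forall>\<^sub>F n in sequentially. (\<integral>x. u x * deriv (\<phi> n) x \<partial>leb_I) = - (\<integral>x. g x * \<phi> n x \<partial>leb_I)"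
    using w test by (auto simp: weak_deriv_def eventually_sequentially)
  then have "(\<lambda>n. - (\<integral>x. g x * \<phi> n x \<partial>leb_I)) \<longlonglongrightarrow> u a - u b"
    by (rule Lim_transform_eventually[OF lim1])
  with tendsto_minus[OF lim2] have "u a - u b = - (\<integral>x. indicator {a..b} x * g x \<partial>leb_I)"
    using LIMSEQ_unique by blast
  then show ?thesis
    using integral_leb_I_indicator[OF L2_fun_integrable[OF g], of a b] ab by simp
qed

lemma weak_deriv_ftc:
  assumes u: "continuous_on {0..pi} u" and g: "L2_fun g" and w: "weak_deriv u g"
    and x: "x \<in> {0..pi}"
  shows "u x = u 0 + integral {0..x} g"
proof -
  have gi: "g integrable_on {0..pi}"
    by (rule integral_leb_I_eq(1)[OF L2_fun_integrable[OF g]])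
  define F where "F x = u x - integral {0..x} g" for x
  have Fc: "continuous_on {0..pi} F"
    unfolding F_def[abs_def] by (intro continuous_intros u indefinite_integral_continuous_1 gi)
  have Feq: "F b = F a" if "0 < a" "a < b" "b < pi" for a b
  proof -
    have "g integrable_on {0..b}"
      by (rule integrable_subinterval_real[OF gi]) (use that in auto)
    then have "integral {0..a} g + integral {a..b} g = integral {0..b} g"
      by (intro Henstock_Kurzweil_Integration.integral_combine) (use that in auto)
    then show ?thesis
      using weak_deriv_integral_Icc[OF u g w that] by (simp add: F_def)
  qed
  have "F y = F (pi / 2)" if y: "y \<in> {0<..<pi}" for y
  proof -
    consider "y < pi / 2" | "y = pi / 2" | "pi / 2 < y" by linarith
    then show ?thesis
    proof cases
      case 1
      then show ?thesis using Feq[of y "pi / 2"] y pi_gt_zero by auto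
    next
      case 2
      then show ?thesis by (rule arg_cong)
    next
      case 3
      then show ?thesis using Feq[of "pi / 2" y] y pi_gt_zero by auto
    qed
  qed
  note inner = this
  have cl: "closure {0<..<pi} = {0..pi}" by (rule closure_greaterThanLessThan) simp
  have c: "F y = F (pi / 2)" if "y \<in> {0..pi}" for y
  proof (rule continuous_constant_on_closure[where S = "{0<..<pi}" and f = F and a = "F (pi / 2)" and x = y])
    show "continuous_on (closure {0<..<pi}) F" unfolding cl by (rule Fc)
    show "y \<in> closure {0<..<pi}" unfolding cl by (rule that)
  qed (rule inner)
  have "F x = F 0" using c[of x] c[of 0] x by simp
  then show ?thesis by (simp add: F_def)
qed

lemma AE_zero_if_integrals_zero:
  fixes f :: "real \<Rightarrow> real"
  assumes f: "integrable leb_I f" and z: "\<And>x. x \<in> {0..pi} \<Longrightarrow> integral {0..x} f = 0"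
  shows "AE x in leb_I. f x = 0"
proof -
  define h where "h x = indicator {0..pi} x * f x" for x
  have h: "integrable lborel h"
    using f by (simp add: integrable_restrict_space h_def[abs_def])
  have iA: "integrable lborel (\<lambda>x. indicator A x * h x)" if "A \<in> sets borel" for A
    using integrable_mult_indicator[OF _ h, of A] that by simp
  have base: "(\<integral>x. indicator {..c} x * h x \<partial>lborel) = 0" for c
  proof -
    have "(\<integral>x. indicator {..c} x * h x \<partial>lborel)
        = (\<integral>x. indicator {0..min c pi} x * f x \<partial>leb_I)"
      by (auto simp: integral_restrict_space h_def indicator_def intro!: Bochner_Integration.integral_cong)
    also have "\<dots> = integral {0..min c pi} f"
      by (rule integral_leb_I_indicator[OF f]) auto
    also have "\<dots> = 0"
      using z[of "min c pi"] by (cases "0 \<le> c") auto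
    finally show ?thesis .
  qed
  have all: "(\<integral>x. h x \<partial>lborel) = 0"
  proof -
    have "(\<integral>x. h x \<partial>lborel) = (\<integral>x. indicator {..pi} x * h x \<partial>lborel)"
      by (rule Bochner_Integration.integral_cong) (auto simp: h_def indicator_def)
    then show ?thesis using base by simp
  qed
  have sets: "sets borel = sigma_sets UNIV (range (\<lambda>a::real. {..a}))"
    by (subst borel_eq_atMost) (simp add: sets_measure_of)
  have "(\<integral>x. indicator A x * h x \<partial>lborel) = 0" if A: "A \<in> sets borel" for A
  proof -
    have "Int_stable (range (\<lambda>a::real. {..a}))"
      by (auto simp: Int_stable_def)
    moreover have "range (\<lambda>a::real. {..a}) \<subseteq> Pow UNIV" by simp
    moreover have "A \<in> sigma_sets UNIV (range (\<lambda>a::real. {..a}))"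
      using A sets by simp
    ultimately show ?thesis
    proof (induction rule: sigma_sets_induct_disjoint)
      case (basic A)
      then show ?case using base by auto
    next
      case empty
      then show ?case by simp
    next
      case (compl A)
      then have "A \<in> sets borel" by (simp add: sets)
      have "(\<integral>x. indicator (UNIV - A) x * h x \<partial>lborel)
          = (\<integral>x. h x - indicator A x * h x \<partial>lborel)"
        by (rule Bochner_Integration.integral_cong) (auto simp: indicator_def)
      also have "\<dots> = 0"
        using h iA[OF \<open>A \<in> sets borel\<close>] compl all by simp
      finally show ?case .
    next
      case (union A)
      have AS: "A i \<in> sets borel" for i using union by (auto simp: sets)
      have "(LINT x:(\<Union>i. A i)|lborel. h x) = (\<Sum>i. LINT x:A i|lborel. h x)"
      proof (rule lebesgue_integral_countable_add)
        show "set_integrable lborel (\<Union>i. A i) h"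
          using iA[of "\<Union>i. A i"] AS by (auto simp: set_integrable_def)
      qed (use AS union(1) in \<open>auto simp: disjoint_family_on_def\<close>)
      then show ?case
        using union(3) by (simp add: set_lebesgue_integral_def)
    qed
  qed
  then have "AE x in lborel. h x = 0"
    using sigma_finite_measure.density_zero[OF lborel.sigma_finite_measure_axioms h] by (simp add: set_lebesgue_integral_def)
  then show ?thesis
    by (subst AE_restrict_space_iff) (auto simp: h_def)
qed

lemma weak_deriv_unique:
  assumes "continuous_on {0..pi} u" "L2_fun g" "weak_deriv u g" "L2_fun h" "weak_deriv u h"
  shows "AE x in leb_I. g x = h x"
proof -
  have gh: "integrable leb_I g" "integrable leb_I h"
    using assms by (auto intro: L2_fun_integrable)
  have "AE x in leb_I. g x - h x = 0"
  proof (rule AE_zero_if_integrals_zero)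
    show "integrable leb_I (\<lambda>x. g x - h x)" using gh by simp
    fix x assume x: "x \<in> {0..pi}"
    have "g integrable_on {0..x}" "h integrable_on {0..x}"
      using integral_leb_I_eq(1)[OF gh(1)] integral_leb_I_eq(1)[OF gh(2)] x
      by (auto intro: integrable_subinterval_real)
    then show "integral {0..x} (\<lambda>x. g x - h x) = 0"
      using weak_deriv_ftc[OF assms(1-3) x] weak_deriv_ftc[OF assms(1,4,5) x]
      by (simp add: integral_diff)
  qed
  then show ?thesis by simp
qed

lemma test_fun_continuous: "test_fun \<phi> \<Longrightarrow> continuous_on {0..pi} \<phi>"
  unfolding test_fun_def
  by (intro continuous_at_imp_continuous_on ballI differentiable_imp_continuous_within) blast

lemma test_fun_deriv_continuous: "test_fun \<phi> \<Longrightarrow> continuous_on {0..pi} (deriv \<phi>)"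
  by (auto simp: test_fun_def intro: continuous_on_subset)

lemma weak_deriv_add:
  assumes "continuous_on {0..pi} u" "continuous_on {0..pi} v"
    and "L2_fun g" "L2_fun h" "weak_deriv u g" "weak_deriv v h"
  shows "weak_deriv (\<lambda>x. u x + v x) (\<lambda>x. g x + h x)"
  unfolding weak_deriv_def
proof (intro allI impI)
  fix \<phi> assume t: "test_fun \<phi>"
  have L: "L2_fun \<phi>" "L2_fun (deriv \<phi>)"
    using t by (auto intro: continuous_L2_fun test_fun_continuous test_fun_deriv_continuous)
  have "integrable leb_I (\<lambda>x. u x * deriv \<phi> x)" "integrable leb_I (\<lambda>x. v x * deriv \<phi> x)"
    "integrable leb_I (\<lambda>x. g x * \<phi> x)" "integrable leb_I (\<lambda>x. h x * \<phi> x)"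
    using assms L by (auto intro!: L2_fun_mult_integrable continuous_L2_fun)
  then have "(\<integral>x. (u x + v x) * deriv \<phi> x \<partial>leb_I)
        = (\<integral>x. u x * deriv \<phi> x \<partial>leb_I) + (\<integral>x. v x * deriv \<phi> x \<partial>leb_I)"
      "(\<integral>x. (g x + h x) * \<phi> x \<partial>leb_I)
        = (\<integral>x. g x * \<phi> x \<partial>leb_I) + (\<integral>x. h x * \<phi> x \<partial>leb_I)"
    by (simp_all only: distrib_right Bochner_Integration.integral_add)
  moreover have "(\<integral>x. u x * deriv \<phi> x \<partial>leb_I) = - (\<integral>x. g x * \<phi> x \<partial>leb_I)"
      "(\<integral>x. v x * deriv \<phi> x \<partial>leb_I) = - (\<integral>x. h x * \<phi> x \<partial>leb_I)"
    using assms(5,6) t unfolding weak_deriv_def by blast+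
  ultimately show "(\<integral>x. (u x + v x) * deriv \<phi> x \<partial>leb_I) = - (\<integral>x. (g x + h x) * \<phi> x \<partial>leb_I)"
    by linarith
qed

lemma weak_deriv_scale:
  "weak_deriv u g \<Longrightarrow> weak_deriv (\<lambda>x. c * u x) (\<lambda>x. c * g x)"
  unfolding weak_deriv_def
proof (intro allI impI)
  fix \<phi>
  assume a: "\<forall>\<phi>. test_fun \<phi> \<longrightarrow> (\<integral>x. u x * deriv \<phi> x \<partial>leb_I) = - (\<integral>x. g x * \<phi> x \<partial>leb_I)"
    and t: "test_fun \<phi>"
  have "(\<integral>x. c * u x * deriv \<phi> x \<partial>leb_I) = c * (\<integral>x. u x * deriv \<phi> x \<partial>leb_I)"
      "(\<integral>x. c * g x * \<phi> x \<partial>leb_I) = c * (\<integral>x. g x * \<phi> x \<partial>leb_I)"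
    by (simp_all only: mult.assoc integral_mult_right_zero)
  moreover have "(\<integral>x. u x * deriv \<phi> x \<partial>leb_I) = - (\<integral>x. g x * \<phi> x \<partial>leb_I)"
    using a t by blast
  ultimately show "(\<integral>x. c * u x * deriv \<phi> x \<partial>leb_I) = - (\<integral>x. c * g x * \<phi> x \<partial>leb_I)"
    by simp
qed

text \<open>Each element of the Sobolev space is given by its unique representative that is continuous
  on the closed interval, set to 0 outside so that equality is equality of functions. Point
  values at the boundary are those of this representative.\<close>

typedef H1 = "{u :: real \<Rightarrow> real. continuous_on {0..pi} u \<and> (\<forall>x. x \<notin> {0..pi} \<longrightarrow> u x = 0)
    \<and> (\<exists>g. L2_fun g \<and> weak_deriv u g)}"
  morphisms H1_fun Abs_H1
  by (rule exI[of _ "\<lambda>_. 0"]) (auto simp: weak_deriv_def intro!: exI[of _ "\<lambda>_. 0"] L2_fun_zero)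

setup_lifting type_definition_H1

definition H1_deriv :: "H1 \<Rightarrow> real \<Rightarrow> real" where
  "H1_deriv u = (SOME g. L2_fun g \<and> weak_deriv (H1_fun u) g)"

lemma H1_fun_continuous: "continuous_on {0..pi} (H1_fun u)"
  using H1_fun[of u] by auto

lemma H1_fun_outside: "x \<notin> {0..pi} \<Longrightarrow> H1_fun u x = 0"
  using H1_fun[of u] by auto

lemma H1_fun_L2: "L2_fun (H1_fun u)"
  by (rule continuous_L2_fun[OF H1_fun_continuous])

lemma H1_deriv_L2: "L2_fun (H1_deriv u)" and H1_weak_deriv: "weak_deriv (H1_fun u) (H1_deriv u)"
proof -
  have "\<exists>g. L2_fun g \<and> weak_deriv (H1_fun u) g" using H1_fun[of u] by auto
  from someI_ex[OF this] show "L2_fun (H1_deriv u)" "weak_deriv (H1_fun u) (H1_deriv u)"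
    unfolding H1_deriv_def by auto
qed

lemma H1_deriv_AE_eqI:
  "L2_fun g \<Longrightarrow> weak_deriv (H1_fun u) g \<Longrightarrow> AE x in leb_I. H1_deriv u x = g x"
  by (rule weak_deriv_unique[OF H1_fun_continuous H1_deriv_L2 H1_weak_deriv])

lemma H1_ftc: "x \<in> {0..pi} \<Longrightarrow> H1_fun u x = H1_fun u 0 + integral {0..x} (H1_deriv u)"
  by (rule weak_deriv_ftc[OF H1_fun_continuous H1_deriv_L2 H1_weak_deriv])

instantiation H1 :: real_vector
begin

lift_definition zero_H1 :: H1 is "\<lambda>_. 0"
  by (auto simp: weak_deriv_def intro!: exI[of _ "\<lambda>_. 0"] L2_fun_zero)

lift_definition plus_H1 :: "H1 \<Rightarrow> H1 \<Rightarrow> H1" is "\<lambda>u v x. u x + v x"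
proof (intro conjI, goal_cases)
  case (3 u v)
  then show ?case by (blast intro: weak_deriv_add L2_fun_add)
qed (auto intro!: continuous_intros)

lift_definition scaleR_H1 :: "real \<Rightarrow> H1 \<Rightarrow> H1" is "\<lambda>c u x. c * u x"
proof (intro conjI, goal_cases)
  case (3 c u)
  then show ?case by (blast intro: weak_deriv_scale L2_fun_scale)
qed (auto intro!: continuous_intros)

definition uminus_H1 :: "H1 \<Rightarrow> H1" where "- u = (-1) *\<^sub>R u" for u :: H1

definition minus_H1 :: "H1 \<Rightarrow> H1 \<Rightarrow> H1" where "u - v = u + - v" for u v :: H1

instance
proof
  fix u v w :: H1 and a b :: real
  show "u + v + w = u + (v + w)" by transfer (simp add: add.assoc)
  show "u + v = v + u" by transfer (simp add: add.commute)
  show "0 + u = u" by transfer simp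
  show "- u + u = 0" unfolding uminus_H1_def by transfer simp
  show "u - v = u + - v" by (simp add: minus_H1_def)
  show "a *\<^sub>R (u + v) = a *\<^sub>R u + a *\<^sub>R v" by transfer (simp add: distrib_left)
  show "(a + b) *\<^sub>R u = a *\<^sub>R u + b *\<^sub>R u" by transfer (simp add: distrib_right)
  show "a *\<^sub>R b *\<^sub>R u = (a * b) *\<^sub>R u" by transfer (simp add: mult.assoc)
  show "1 *\<^sub>R u = u" by transfer simp
qed

end

lemma H1_fun_zero: "H1_fun 0 x = 0"
  and H1_fun_add: "H1_fun (u + v) x = H1_fun u x + H1_fun v x"
  and H1_fun_scaleR: "H1_fun (c *\<^sub>R u) x = c * H1_fun u x"
  by (transfer, simp)+

lemma H1_deriv_add: "AE x in leb_I. H1_deriv (u + v) x = H1_deriv u x + H1_deriv v x"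
proof (rule H1_deriv_AE_eqI)
  have "H1_fun (u + v) = (\<lambda>x. H1_fun u x + H1_fun v x)" by (simp add: fun_eq_iff H1_fun_add)
  then show "weak_deriv (H1_fun (u + v)) (\<lambda>x. H1_deriv u x + H1_deriv v x)"
    by (simp add: weak_deriv_add H1_fun_continuous H1_deriv_L2 H1_weak_deriv)
qed (intro L2_fun_add H1_deriv_L2)

lemma H1_deriv_scaleR: "AE x in leb_I. H1_deriv (c *\<^sub>R u) x = c * H1_deriv u x"
proof (rule H1_deriv_AE_eqI)
  have "H1_fun (c *\<^sub>R u) = (\<lambda>x. c * H1_fun u x)" by (simp add: fun_eq_iff H1_fun_scaleR)
  then show "weak_deriv (H1_fun (c *\<^sub>R u)) (\<lambda>x. c * H1_deriv u x)"
    by (simp add: weak_deriv_scale H1_weak_deriv)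
qed (intro L2_fun_scale H1_deriv_L2)

definition L2_form :: "H1 \<Rightarrow> H1 \<Rightarrow> real" where
  "L2_form u v = (\<integral>x. H1_fun u x * H1_fun v x \<partial>leb_I)"

definition Dirichlet_form :: "H1 \<Rightarrow> H1 \<Rightarrow> real" where
  "Dirichlet_form u v = (\<integral>x. H1_deriv u x * H1_deriv v x \<partial>leb_I)"

lemma L2_form_commute: "L2_form u v = L2_form v u"
  and Dirichlet_form_commute: "Dirichlet_form u v = Dirichlet_form v u"
  by (simp_all add: L2_form_def Dirichlet_form_def mult.commute)

lemma L2_form_add: "L2_form (u + v) w = L2_form u w + L2_form v w"
  by (simp add: L2_form_def H1_fun_add distrib_right L2_fun_mult_integrable H1_fun_L2)

lemma L2_form_scaleR: "L2_form (c *\<^sub>R u) w = c * L2_form u w"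
  by (simp add: L2_form_def H1_fun_scaleR mult.assoc)

lemma Dirichlet_form_add: "Dirichlet_form (u + v) w = Dirichlet_form u w + Dirichlet_form v w"
proof -
  have "Dirichlet_form (u + v) w = (\<integral>x. (H1_deriv u x + H1_deriv v x) * H1_deriv w x \<partial>leb_I)"
    unfolding Dirichlet_form_def
  proof (rule integral_cong_AE)
    show "AE x in leb_I. H1_deriv (u + v) x * H1_deriv w x = (H1_deriv u x + H1_deriv v x) * H1_deriv w x"
      using H1_deriv_add[of u v] by eventually_elim simp
  qed (intro borel_measurable_times borel_measurable_add L2_fun_measurable H1_deriv_L2)+
  then show ?thesis
    by (simp add: Dirichlet_form_def distrib_right L2_fun_mult_integrable H1_deriv_L2)
qed

lemma Dirichlet_form_scaleR: "Dirichlet_form (c *\<^sub>R u) w = c * Dirichlet_form u w"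
proof -
  have "Dirichlet_form (c *\<^sub>R u) w = (\<integral>x. (c * H1_deriv u x) * H1_deriv w x \<partial>leb_I)"
    unfolding Dirichlet_form_def
  proof (rule integral_cong_AE)
    show "AE x in leb_I. H1_deriv (c *\<^sub>R u) x * H1_deriv w x = (c * H1_deriv u x) * H1_deriv w x"
      using H1_deriv_scaleR[of c u] by eventually_elim simp
  qed (intro borel_measurable_times borel_measurable_const L2_fun_measurable H1_deriv_L2)+
  then show ?thesis
    unfolding Dirichlet_form_def by (simp only: mult.assoc integral_mult_right_zero)
qed

lemma L2_form_nonneg: "0 \<le> L2_form u u"
  and Dirichlet_form_nonneg: "0 \<le> Dirichlet_form u u"
  unfolding L2_form_def Dirichlet_form_def
  by (rule Bochner_Integration.integral_nonneg, simp)+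

lemma L2_form_eq_zero:
  assumes "L2_form u u = 0"
  shows "u = 0"
proof -
  have "integral {0..pi} (\<lambda>x. H1_fun u x * H1_fun u x) = 0"
    using assms integral_leb_I_eq(2)[OF L2_fun_mult_integrable[OF H1_fun_L2[of u] H1_fun_L2[of u]]]
    by (simp add: L2_form_def)
  then have "\<forall>x\<in>{0..pi}. H1_fun u x * H1_fun u x = 0"
    by (subst (asm) integral_eq_0_iff) (auto intro!: continuous_intros H1_fun_continuous)
  then have "H1_fun u = H1_fun 0"
    using H1_fun_outside[of _ u] by (fastforce simp: H1_fun_zero)
  then show ?thesis by (simp add: H1_fun_inject)
qed

instantiation H1 :: real_inner
begin

definition inner_H1 :: "H1 \<Rightarrow> H1 \<Rightarrow> real" where
  "inner u v = (\<integral>x. H1_fun u x * H1_fun v x \<partial>leb_I) + (\<integral>x. H1_deriv u x * H1_deriv v x \<partial>leb_I)"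

definition norm_H1 :: "H1 \<Rightarrow> real" where "norm u = sqrt (inner u u)" for u :: H1

definition dist_H1 :: "H1 \<Rightarrow> H1 \<Rightarrow> real" where "dist u v = norm (u - v)" for u v :: H1

definition sgn_H1 :: "H1 \<Rightarrow> H1" where "sgn u = u /\<^sub>R norm u" for u :: H1

definition uniformity_H1 :: "(H1 \<times> H1) filter" where
  "uniformity_H1 = (INF e\<in>{0<..}. principal {(x, y). dist x y < e})"

definition open_H1 :: "H1 set \<Rightarrow> bool" where
  "open_H1 U \<longleftrightarrow> (\<forall>x\<in>U. \<forall>\<^sub>F (x', y) in uniformity. x' = x \<longrightarrow> y \<in> U)"

instance
proof
  have inner_eq: "inner u v = L2_form u v + Dirichlet_form u v" for u v
    by (simp add: inner_H1_def L2_form_def Dirichlet_form_def)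
  fix u v w :: H1 and r :: real and U :: "H1 set"
  show "dist u v = norm (u - v)" by (rule dist_H1_def)
  show "sgn u = u /\<^sub>R norm u" by (rule sgn_H1_def)
  show "uniformity = (INF e\<in>{0<..}. principal {(x, y::H1). dist x y < e})"
    by (rule uniformity_H1_def)
  show "open U \<longleftrightarrow> (\<forall>x\<in>U. \<forall>\<^sub>F (x', y) in uniformity. x' = x \<longrightarrow> y \<in> U)"
    by (rule open_H1_def)
  show "inner u v = inner v u"
    unfolding inner_eq using L2_form_commute Dirichlet_form_commute by metis
  show "inner (u + v) w = inner u w + inner v w"
    by (simp add: inner_eq L2_form_add Dirichlet_form_add)
  show "inner (r *\<^sub>R u) v = r * inner u v"
    by (simp add: inner_eq L2_form_scaleR Dirichlet_form_scaleR distrib_left)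
  show "0 \<le> inner u u"
    using L2_form_nonneg Dirichlet_form_nonneg by (simp add: inner_eq)
  show "inner u u = 0 \<longleftrightarrow> u = 0"
  proof
    assume "inner u u = 0"
    then show "u = 0"
      using L2_form_nonneg[of u] Dirichlet_form_nonneg[of u] by (simp add: inner_eq L2_form_eq_zero)
  next
    assume "u = 0"
    then show "inner u u = 0"
      using L2_form_scaleR[of 0 0 u] Dirichlet_form_scaleR[of 0 0 u] by (simp add: inner_eq)
  qed
  show "norm u = sqrt (inner u u)" by (rule norm_H1_def)
qed

end

lemma H1_norm_square: "(norm u)\<^sup>2 = L2_form u u + Dirichlet_form u u"
  by (simp add: dot_square_norm[symmetric] inner_H1_def L2_form_def Dirichlet_form_def)

lemma bounded_linear_if_square_bound:
  fixes L :: "'a::real_normed_vector \<Rightarrow> real"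
  assumes "linear L" and b: "\<And>v. \<bar>L v\<bar> \<le> a + b * (norm v)\<^sup>2"
  shows "bounded_linear L"
proof -
  interpret linear L by fact
  show ?thesis
  proof (rule bounded_linear_intro)
    fix v
    show "norm (L v) \<le> norm v * (a + b)"
    proof (cases "v = 0")
      case True
      then show ?thesis by (simp add: zero)
    next
      case False
      have "L v = norm v * L (v /\<^sub>R norm v)" using False by (simp add: scaleR)
      moreover have "\<bar>L (v /\<^sub>R norm v)\<bar> \<le> a + b" using b[of "v /\<^sub>R norm v"] False by simp
      ultimately show ?thesis by (simp add: abs_mult mult_left_mono)
    qed
  qed (simp_all add: add scaleR)
qed

lemma abs_mult_integral_le:
  assumes "L2_fun f" "L2_fun g"
  shows "\<bar>\<integral>x. f x * g x \<partial>leb_I\<bar> \<le> (\<integral>x. f x * f x \<partial>leb_I) + (\<integral>x. g x * g x \<partial>leb_I)"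
proof -
  have ab: "\<bar>a * b\<bar> \<le> a * a + b * b" for a b :: real
  proof -
    have "0 \<le> (\<bar>a\<bar> - \<bar>b\<bar>)\<^sup>2" by simp
    then have "2 * (\<bar>a\<bar> * \<bar>b\<bar>) \<le> a * a + b * b"
      by (simp add: power2_eq_square algebra_simps)
    then show ?thesis
      by (simp add: abs_mult) (smt (verit) mult_nonneg_nonneg abs_ge_zero)
  qed
  have "\<bar>\<integral>x. f x * g x \<partial>leb_I\<bar> \<le> (\<integral>x. \<bar>f x * g x\<bar> \<partial>leb_I)"
    by (rule integral_abs_bound)
  also have "\<dots> \<le> (\<integral>x. f x * f x + g x * g x \<partial>leb_I)"
    using assms ab by (intro integral_mono) (auto intro!: L2_fun_mult_integrable Bochner_Integration.integrable_add)
  finally show ?thesis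
    using assms by (simp add: L2_fun_mult_integrable)
qed

lemma bounded_linear_L2_form: "bounded_linear (L2_form u)"
proof (rule bounded_linear_if_square_bound)
  show "linear (L2_form u)"
    by (rule linearI) (simp_all add: L2_form_commute[of u] L2_form_add L2_form_scaleR)
  show "\<bar>L2_form u v\<bar> \<le> L2_form u u + 1 * (norm v)\<^sup>2" for v
    using abs_mult_integral_le[OF H1_fun_L2[of u] H1_fun_L2[of v]] Dirichlet_form_nonneg[of v]
    by (simp add: H1_norm_square L2_form_def)
qed

lemma bounded_linear_Dirichlet_form: "bounded_linear (Dirichlet_form u)"
proof (rule bounded_linear_if_square_bound)
  show "linear (Dirichlet_form u)"
    by (rule linearI)
       (simp_all add: Dirichlet_form_commute[of u] Dirichlet_form_add Dirichlet_form_scaleR)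
  show "\<bar>Dirichlet_form u v\<bar> \<le> Dirichlet_form u u + 1 * (norm v)\<^sup>2" for v
    using abs_mult_integral_le[OF H1_deriv_L2[of u] H1_deriv_L2[of v]] L2_form_nonneg[of v]
    by (simp add: H1_norm_square Dirichlet_form_def)
qed

lemma bounded_linear_eval_0: "bounded_linear (\<lambda>v. H1_fun v 0)"
proof (rule bounded_linear_if_square_bound)
  show "linear (\<lambda>v. H1_fun v 0)"
    by (rule linearI) (simp_all add: H1_fun_add H1_fun_scaleR)
  fix v
  let ?v = "H1_fun v" and ?g = "H1_deriv v"
  have gi: "?g integrable_on {0..pi}"
    by (rule integral_leb_I_eq(1)[OF L2_fun_integrable[OF H1_deriv_L2]])
  have g2: "integrable leb_I (\<lambda>x. 1 + ?g x * ?g x)"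
    by (intro Bochner_Integration.integrable_add L2_fun_mult_integrable H1_deriv_L2
        continuous_integrable_leb_I continuous_intros)
  have sq: "\<bar>a\<bar> \<le> 1 + a * a" for a :: real
  proof -
    have "0 \<le> (\<bar>a\<bar> - 1)\<^sup>2" by simp
    then have "2 * \<bar>a\<bar> \<le> 1 + a * a" by (simp add: power2_eq_square algebra_simps)
    then show ?thesis using abs_ge_zero[of a] by linarith
  qed
  have Ig: "\<bar>integral {0..x} ?g\<bar> \<le> pi + Dirichlet_form v v" if x: "x \<in> {0..pi}" for x
  proof -
    have "\<bar>integral {0..x} ?g\<bar> \<le> integral {0..x} (\<lambda>x. 1 + ?g x * ?g x)"
      using integral_norm_bound_integral[of ?g "{0..x}" "\<lambda>x. 1 + ?g x * ?g x"] sq x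
        integrable_subinterval_real[OF gi] integrable_subinterval_real[OF integral_leb_I_eq(1)[OF g2]]
      by auto
    also have "\<dots> \<le> integral {0..pi} (\<lambda>x. 1 + ?g x * ?g x)"
      using x integral_leb_I_eq(1)[OF g2]
      by (intro integral_subset_le integrable_subinterval_real[OF integral_leb_I_eq(1)[OF g2]]) auto
    also have "\<dots> = (\<integral>x. 1 + ?g x * ?g x \<partial>leb_I)"
      by (rule integral_leb_I_eq(2)[OF g2, symmetric])
    also have "\<dots> = (\<integral>x. 1 \<partial>leb_I) + (\<integral>x. ?g x * ?g x \<partial>leb_I)"
      by (intro Bochner_Integration.integral_add L2_fun_mult_integrable H1_deriv_L2
        continuous_integrable_leb_I continuous_intros)
    also have "(\<integral>x. (1::real) \<partial>leb_I) = pi"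
      by (subst integral_leb_I_eq(2)) (auto intro!: continuous_integrable_leb_I)
    finally show ?thesis by (simp add: Dirichlet_form_def)
  qed
  have v2: "integrable leb_I (\<lambda>x. 1 + ?v x * ?v x + (pi + Dirichlet_form v v))"
    by (intro continuous_integrable_leb_I continuous_intros H1_fun_continuous)
  have "\<bar>?v 0\<bar> * pi = (\<integral>x. \<bar>?v 0\<bar> \<partial>leb_I)"
    by (subst integral_leb_I_eq(2)) (auto intro!: continuous_integrable_leb_I)
  also have "\<dots> \<le> (\<integral>x. 1 + ?v x * ?v x + (pi + Dirichlet_form v v) \<partial>leb_I)"
  proof (rule integral_mono)
    show "integrable leb_I (\<lambda>x. \<bar>?v 0\<bar>)"
      by (intro continuous_integrable_leb_I continuous_intros)
    fix x assume "x \<in> space leb_I"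
    then show "\<bar>?v 0\<bar> \<le> 1 + ?v x * ?v x + (pi + Dirichlet_form v v)"
      using H1_ftc[of x v] Ig[of x] sq[of "?v x"] by auto
  qed (rule v2)
  also have "\<dots> = (\<integral>x. ?v x * ?v x \<partial>leb_I) + (\<integral>x. 1 + (pi + Dirichlet_form v v) \<partial>leb_I)"
    by (subst Bochner_Integration.integral_add[symmetric])
       (auto intro!: continuous_integrable_leb_I continuous_intros H1_fun_continuous simp: algebra_simps)
  also have "(\<integral>x. 1 + (pi + Dirichlet_form v v) \<partial>leb_I) = (1 + (pi + Dirichlet_form v v)) * pi"
    by (subst integral_leb_I_eq(2)) (auto intro!: continuous_integrable_leb_I)
  also have "(\<integral>x. ?v x * ?v x \<partial>leb_I) = L2_form v v"
    by (simp add: L2_form_def)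
  finally have "\<bar>?v 0\<bar> * pi \<le> L2_form v v + (1 + (pi + Dirichlet_form v v)) * pi" .
  also have "\<dots> \<le> ((1 + pi) + 1 * (norm v)\<^sup>2) * pi"
    using L2_form_nonneg[of v] pi_gt3 mult_left_mono[of 1 pi "L2_form v v"]
    by (simp add: H1_norm_square algebra_simps)
  finally show "\<bar>?v 0\<bar> \<le> (1 + pi) + 1 * (norm v)\<^sup>2"
    by (rule mult_right_le_imp_le) simp
qed

section \<open>The dual space, the weak Neumann Laplacian and its semigroup\<close>

type_synonym Hm1 = "H1 \<Rightarrow>\<^sub>L real"

lift_definition H1_embed :: "H1 \<Rightarrow> Hm1" is "\<lambda>u v. \<integral>x. H1_fun u x * H1_fun v x \<partial>leb_I"
  using bounded_linear_L2_form by (simp add: L2_form_def[abs_def])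

lift_definition A_N :: "H1 \<Rightarrow> Hm1" is "\<lambda>u v. \<integral>x. H1_deriv u x * H1_deriv v x \<partial>leb_I"
  using bounded_linear_Dirichlet_form by (simp add: Dirichlet_form_def[abs_def])

lift_definition \<delta>\<^sub>0 :: Hm1 is "\<lambda>v. H1_fun v 0"
  by (rule bounded_linear_eval_0)

definition C0_semigroup :: "(real \<Rightarrow> 'a::real_normed_vector \<Rightarrow>\<^sub>L 'a) \<Rightarrow> bool" where
  "C0_semigroup T \<longleftrightarrow> T 0 = id_blinfun
     \<and> (\<forall>s\<ge>0. \<forall>t\<ge>0. T (s + t) = T s o\<^sub>L T t)
     \<and> (\<forall>f. continuous_on {0..} (\<lambda>t. T t f))"

definition generator :: "(real \<Rightarrow> 'a::real_normed_vector \<Rightarrow>\<^sub>L 'a) \<Rightarrow> ('a \<times> 'a) set" where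
  "generator T = {(f, g). ((\<lambda>h. (T h f - f) /\<^sub>R h) \<longlongrightarrow> g) (at_right 0)}"

text \<open>The operator to be generated is the negative of \<open>A_N\<close> on the dual space, with domain the
  image of the Sobolev space under the embedding. This determines the semigroup for nonnegative
  times; its values at negative times are irrelevant.\<close>

definition neumann_heat_semigroup :: "(real \<Rightarrow> Hm1 \<Rightarrow>\<^sub>L Hm1) \<Rightarrow> bool" where
  "neumann_heat_semigroup T \<longleftrightarrow>
     C0_semigroup T \<and> generator T = {(H1_embed u, - A_N u) | u. True}"

section \<open>The semiflow and its attractors\<close>

definition mild_solution ::
    "(real \<Rightarrow> Hm1 \<Rightarrow>\<^sub>L Hm1) \<Rightarrow> real \<Rightarrow> H1 \<Rightarrow> (real \<Rightarrow> H1) \<Rightarrow> bool" where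
  "mild_solution T \<beta> u\<^sub>0 u \<longleftrightarrow> continuous_on {0..} u
     \<and> (\<forall>t\<ge>0. H1_embed (u t) = T t (H1_embed u\<^sub>0)
          - integral {0..t} (\<lambda>\<tau>. tanh (\<beta> * H1_fun (u \<tau>) pi) *\<^sub>R T (t - \<tau>) \<delta>\<^sub>0))"

definition omega_limit ::
    "(real \<Rightarrow> 'a::topological_space \<Rightarrow> 'a) \<Rightarrow> 'a set \<Rightarrow> 'a set" where
  "omega_limit \<Phi> B = (\<Inter>s\<in>{0..}. closure (\<Union>t\<in>{s..}. \<Phi> t ` B))"

definition global_attractor :: "(real \<Rightarrow> 'a::topological_space \<Rightarrow> 'a) \<Rightarrow> 'a set" where
  "global_attractor \<Phi> = closure (\<Union>u. omega_limit \<Phi> {u})"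

definition global_B_attractor :: "(real \<Rightarrow> 'a::metric_space \<Rightarrow> 'a) \<Rightarrow> 'a set" where
  "global_B_attractor \<Phi> = (\<Union>B\<in>{B. bounded B}. omega_limit \<Phi> B)"

text \<open>\<open>z sin (z \<pi>)\<close> is even in \<open>z\<close>, so the branch of the square root does not matter.\<close>

definition char_fun :: "real \<Rightarrow> complex" where
  "char_fun \<omega> = csqrt (\<i> * of_real \<omega>) * sin (csqrt (\<i> * of_real \<omega>) * of_real pi)"

definition \<omega>\<^sub>0 :: real where
  "\<omega>\<^sub>0 = (LEAST \<omega>. \<omega> > 0 \<and> char_fun \<omega> \<in> of_real ` {0<..})"

text \<open>The value at \<open>\<omega>\<^sub>0\<close> is real by the choice of \<open>\<omega>\<^sub>0\<close>; numerically it is about 5.6655.\<close>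

definition \<beta>\<^sub>0 :: real where
  "\<beta>\<^sub>0 = Re (char_fun \<omega>\<^sub>0)"

end

theory Submission
  imports Defs
begin

text \<open>The proof works with the cosine coefficients \<open>a\<^sub>n(t)\<close> of \<open>u(t)\<close> (\<open>mode\<close>). The functions
\<open>cos (n x)\<close> are eigenfunctions of the weak Neumann Laplacian, and \<open>\<delta>\<^sub>0\<close> has the value 1 on each of them,
so the mild formulation decouples into \<open>a\<^sub>n' = - n\<^sup>2 a\<^sub>n - g\<close> with the scalar input
\<open>g = tanh (\<beta> y)\<close>, where \<open>y(t) = u(t, \<pi>) = \<Sum> w\<^sub>n (-1)\<^sup>n a\<^sub>n(t)\<close> (\<open>mild_solution_modes\<close>). After one unit of
time \<open>\<bar>a\<^sub>n\<bar> \<le> C / n\<^sup>2\<close> for \<open>n \<ge> 1\<close>, with C depending only on the norm of the initial value, so smallness of every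
single coefficient already gives smallness in the Sobolev norm (\<open>norm_small_of_modes\<close>). Moreover, if
\<open>\<integral> g\<^sup>2\<close> is small over a long window, all coefficients are small at its end
(\<open>small_input_small_modes\<close>). It remains to bound the total input \<open>\<integral> g\<^sup>2\<close>.

For \<open>\<beta> < 4 / \<pi>\<close> the squared L2 norm decreases at least at the rate \<open>2 (1 / \<beta> - \<pi> / 4) g\<^sup>2\<close>: the boundary
values differ by \<open>u(\<pi>) - u(0) = \<integral> u\<^sub>x\<close>, which the dissipation \<open>\<integral> u\<^sub>x\<^sup>2\<close> absorbs at the price
\<open>\<pi> g\<^sup>2 / 4\<close>, while \<open>g y \<ge> g\<^sup>2 / \<beta>\<close> (\<open>V_decreasing\<close>). Hence \<open>\<integral> g\<^sup>2\<close> is bounded uniformly on bounded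
sets, one among boundedly many windows is quiet, and the monotone norm keeps the solution small from
there on (\<open>uniform_decay\<close>).

For \<open>\<beta> < \<beta>\<^sub>0\<close> the bound comes from Popov's frequency criterion. The linear part maps the input g to
the output y with transfer function \<open>- K(i \<omega>)\<close>, where \<open>K(s) = 1 / (\<surd>s sinh (\<pi> \<surd>s))\<close>
(\<open>kernel_expansion\<close>), and one needs some \<open>q > 0\<close> with
\<open>- Re ((1 + i q \<omega>) K(i \<omega>)) \<le> 1 / \<beta>\<^sub>0\<close> for all \<open>\<omega>\<close>. Multiplied by \<open>\<bar>1 / K\<bar>\<^sup>2\<close> and
divided by \<open>v = \<pi>\<^sup>4 \<omega>\<^sup>2\<close>, this says that an entire function of v is nonnegative on the positive axis. Its power series has nonnegative
coefficients from degree two on, so it is convex there, and q is chosen such that it has a double zero at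
the frequency \<open>\<omega>\<^sub>0\<close> that defines \<open>\<beta>\<^sub>0\<close> (\<open>popov_frequency_inequality\<close>).

To pass from frequencies to time, the derivative of the Popov multiplier is replaced by a backward
difference quotient of step h; then convexity of a primitive of tanh takes the place of the chain rule
(\<open>delayed_increment\<close>) and the derivative of y is avoided. On \<open>[0, T]\<close> every \<open>a\<^sub>n\<close> with \<open>n \<ge> 1\<close> is a
T-periodic solution plus a multiple of \<open>exp (- n\<^sup>2 t)\<close>, and \<open>a\<^sub>0\<close> is a periodic function plus a linear one; the periodic parts are treated by Fourier series on the circle
(\<open>multiplier_bound\<close>) and the exponentials contribute a bounded amount. So \<open>\<integral> g\<^sup>2\<close> over \<open>[0, T]\<close> is bounded
independently of T (\<open>popov_bounded_energy\<close>).\<close>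

section \<open>Cosine series on the interval\<close>

definition ip :: "(real \<Rightarrow> real) \<Rightarrow> (real \<Rightarrow> real) \<Rightarrow> real" where
  "ip f g = (\<integral>x. f x * g x \<partial>leb_I)"

lemma ip_commute: "ip f g = ip g f"
  by (simp add: ip_def mult.commute)

lemma ip_add: "L2_fun f \<Longrightarrow> L2_fun g \<Longrightarrow> L2_fun h \<Longrightarrow> ip (\<lambda>x. f x + g x) h = ip f h + ip g h"
  by (simp add: ip_def distrib_right L2_fun_mult_integrable)

lemma ip_scale: "ip (\<lambda>x. c * f x) h = c * ip f h"
  by (simp add: ip_def mult.assoc)

lemma L2_fun_diff: "L2_fun f \<Longrightarrow> L2_fun g \<Longrightarrow> L2_fun (\<lambda>x. f x - g x)"
  using L2_fun_add[of f "\<lambda>x. (-1) * g x"] L2_fun_scale[of g "-1"] by simp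

lemma ip_diff: "L2_fun f \<Longrightarrow> L2_fun g \<Longrightarrow> L2_fun h \<Longrightarrow> ip (\<lambda>x. f x - g x) h = ip f h - ip g h"
  by (simp add: ip_def left_diff_distrib L2_fun_mult_integrable)

lemma L2_fun_sum: "(\<And>i. i \<in> S \<Longrightarrow> L2_fun (f i)) \<Longrightarrow> L2_fun (\<lambda>x. \<Sum>i\<in>S. f i x)"
  by (induction S rule: infinite_finite_induct) (auto intro: L2_fun_add L2_fun_zero)

lemma ip_sum:
  "(\<And>i. i \<in> S \<Longrightarrow> L2_fun (f i)) \<Longrightarrow> L2_fun h \<Longrightarrow> ip (\<lambda>x. \<Sum>i\<in>S. f i x) h = (\<Sum>i\<in>S. ip (f i) h)"
proof (induction S rule: infinite_finite_induct)
  case (insert x F)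
  then show ?case by (simp add: ip_add L2_fun_sum)
qed (simp_all add: ip_def)

lemma ip_nonneg: "0 \<le> ip f f"
  unfolding ip_def by (rule Bochner_Integration.integral_nonneg) simp

lemma ip_abs_le:
  assumes "L2_fun f" "L2_fun g"
  shows "2 * \<bar>ip f g\<bar> \<le> ip f f + ip g g"
proof -
  have "0 \<le> ip (\<lambda>x. f x + c * g x) (\<lambda>x. f x + c * g x)" for c by (rule ip_nonneg)
  moreover have "ip (\<lambda>x. f x + c * g x) (\<lambda>x. f x + c * g x) = ip f f + 2 * c * ip f g + c * c * ip g g" for c
  proof -
    note L = assms L2_fun_scale[OF assms(2), of c]
    have "ip (\<lambda>x. f x + c * g x) (\<lambda>x. f x + c * g x) =
       ip f (\<lambda>x. f x + c * g x) + c * ip g (\<lambda>x. f x + c * g x)"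
      by (simp add: ip_add L L2_fun_add ip_scale)
    also have "ip f (\<lambda>x. f x + c * g x) = ip f f + c * ip f g"
      using ip_add[OF L(1) L(3) L(1)] ip_scale[of c g f] by (simp add: ip_commute)
    also have "ip g (\<lambda>x. f x + c * g x) = ip f g + c * ip g g"
      using ip_add[OF L(1) L(3) L(2)] ip_scale[of c g g] by (simp add: ip_commute)
    finally show ?thesis by (simp add: algebra_simps)
  qed
  ultimately have "0 \<le> ip f f + 2 * c * ip f g + c * c * ip g g" for c by metis
  from this[of 1] this[of "-1"] show ?thesis by simp
qed

lemma ip_continuous_zero:
  assumes "continuous_on {0..pi} f" "ip f f = 0" "x \<in> {0..pi}"
  shows "f x = 0"
proof -
  have "integral {0..pi} (\<lambda>x. f x * f x) = 0"
    using assms(2) integral_leb_I_eq(2)[OF L2_fun_mult_integrable[OF continuous_L2_fun continuous_L2_fun]] assms(1)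
    by (simp add: ip_def)
  then have "\<forall>x\<in>{0..pi}. f x * f x = 0"
    by (subst (asm) integral_eq_0_iff) (auto intro!: continuous_intros assms)
  with assms(3) show ?thesis by simp
qed

lemma ip_le_sup:
  assumes "L2_fun f" "\<And>x. x \<in> {0..pi} \<Longrightarrow> \<bar>f x\<bar> \<le> M"
  shows "ip f f \<le> pi * M\<^sup>2"
proof -
  have "ip f f \<le> (\<integral>x. M\<^sup>2 \<partial>leb_I)"
    unfolding ip_def
  proof (rule integral_mono)
    show "integrable leb_I (\<lambda>x. M\<^sup>2)" by (intro continuous_integrable_leb_I continuous_intros)
    fix x assume "x \<in> space leb_I"
    then show "f x * f x \<le> M\<^sup>2"
      using assms(2)[of x] power_mono[of "\<bar>f x\<bar>" M 2] by (simp add: power2_eq_square)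
  qed (rule L2_fun_mult_integrable[OF assms(1) assms(1)])
  also have "\<dots> = pi * M\<^sup>2"
    by (subst integral_leb_I_eq(2)) (auto intro!: continuous_integrable_leb_I continuous_intros)
  finally show ?thesis .
qed

definition cosn :: "nat \<Rightarrow> real \<Rightarrow> real" where "cosn n x = cos (real n * x)"
definition sinn :: "nat \<Rightarrow> real \<Rightarrow> real" where "sinn n x = sin (real n * x)"
text \<open>The weight is the reciprocal of the squared L2 norm of \<open>cosn n\<close>, so that a cosine series has the
  coefficients \<open>wt n * ip f (cosn n)\<close>.\<close>

definition wt :: "nat \<Rightarrow> real" where "wt n = (if n = 0 then 1 / pi else 2 / pi)"

lemma continuous_on_cosn [continuous_intros]: "continuous_on S (cosn n)"
  unfolding cosn_def[abs_def] by (intro continuous_intros)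
lemma continuous_on_sinn [continuous_intros]: "continuous_on S (sinn n)"
  unfolding sinn_def[abs_def] by (intro continuous_intros)
lemma L2_cosn: "L2_fun (cosn n)" and L2_sinn: "L2_fun (sinn n)"
  by (intro continuous_L2_fun continuous_intros)+
lemma wt_nonneg: "0 \<le> wt n" and wt_pos: "0 < wt n" and wt_le: "wt n \<le> 1"
  using pi_gt3 by (auto simp: wt_def)

lemma integral_cos_int:
  assumes "k \<noteq> (0::int)"
  shows "integral {0..pi} (\<lambda>x. cos (of_int k * x)) = 0"
proof -
  have "((\<lambda>x. cos (of_int k * x)) has_integral (sin (of_int k * pi) / of_int k - sin (of_int k * 0) / of_int k)) {0..pi}"
  proof (rule fundamental_theorem_of_calculus)
    fix x :: real
    have "((\<lambda>x. sin (of_int k * x) / of_int k) has_real_derivative cos (of_int k * x)) (at x within {0..pi})"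
      using assms by (auto intro!: derivative_eq_intros)
    then show "((\<lambda>x. sin (of_int k * x) / of_int k) has_vector_derivative cos (of_int k * x)) (at x within {0..pi})"
      by (simp add: has_real_derivative_iff_has_vector_derivative)
  qed simp
  moreover have "sin (of_int k * pi) = 0" using sin_zero_iff_int2 by blast
  ultimately show ?thesis by (simp add: integral_unique)
qed

lemma integral_cos_int': "integral {0..pi} (\<lambda>x. cos (of_int k * x)) = (if k = (0::int) then pi else 0)"
  using integral_cos_int by (auto simp: )

lemma ip_continuous: 
  assumes "continuous_on {0..pi} f" "continuous_on {0..pi} g"
  shows "ip f g = integral {0..pi} (\<lambda>x. f x * g x)"
  unfolding ip_def by (intro integral_leb_I_eq continuous_integrable_leb_I continuous_intros assms)

lemma ip_cos_cos: "ip (cosn n) (cosn m) = (if n = m then 1 / wt n else 0)"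
  and ip_sin_sin: "ip (sinn n) (sinn m) = (if n = m \<and> n \<noteq> 0 then pi / 2 else 0)"
proof -
  let ?c = "\<lambda>k::int. \<lambda>x::real. cos (of_int k * x)"
  have i: "?c k integrable_on {0..pi}" for k
    by (intro integrable_continuous_real continuous_intros)
  have 1: "cosn n x * cosn m x = (?c (int n - int m) x + ?c (int n + int m) x) / 2" for x
    by (simp only: cosn_def cos_times_cos of_int_diff of_int_add of_int_of_nat_eq left_diff_distrib distrib_right)
  have 2: "sinn n x * sinn m x = (?c (int n - int m) x - ?c (int n + int m) x) / 2" for x
    by (simp only: sinn_def sin_times_sin of_int_diff of_int_add of_int_of_nat_eq left_diff_distrib distrib_right)
  have "ip (cosn n) (cosn m) = (integral {0..pi} (?c (int n - int m)) + integral {0..pi} (?c (int n + int m))) / 2"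
    by (subst ip_continuous) (auto intro!: continuous_intros simp: 1 integral_add[OF i i, symmetric] simp del: of_int_diff of_int_add)
  then show "ip (cosn n) (cosn m) = (if n = m then 1 / wt n else 0)"
    unfolding integral_cos_int' by (auto simp: wt_def)
  have "ip (sinn n) (sinn m) = (integral {0..pi} (?c (int n - int m)) - integral {0..pi} (?c (int n + int m))) / 2"
    by (subst ip_continuous) (auto intro!: continuous_intros simp: 2 integral_diff[OF i i, symmetric] simp del: of_int_diff of_int_add)
  then show "ip (sinn n) (sinn m) = (if n = m \<and> n \<noteq> 0 then pi / 2 else 0)"
    unfolding integral_cos_int' by auto
qed

text \<open>Finite cosine sums, generated without recording a degree: closure under products is then a plain
  induction, and the completeness arguments below need only that some degree exists.\<close>

inductive cos_poly :: "(real \<Rightarrow> real) \<Rightarrow> bool" where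
  monom: "cos_poly (\<lambda>x. c * cosn n x)"
| add: "cos_poly f \<Longrightarrow> cos_poly g \<Longrightarrow> cos_poly (\<lambda>x. f x + g x)"

lemma cos_poly_mult_cosn: "cos_poly f \<Longrightarrow> cos_poly (\<lambda>x. f x * (c * cosn n x))"
proof (induction rule: cos_poly.induct)
  case (monom d m)
  have "d * cosn m x * (c * cosn n x) = (d * c / 2) * cosn (m + n) x + (d * c / 2) * cosn (if m \<le> n then n - m else m - n) x" for x
  proof -
    have "real (if m \<le> n then n - m else m - n) * x = (if m \<le> n then - (real m * x - real n * x) else real m * x - real n * x)"
      by (simp add: of_nat_diff left_diff_distrib)
    then have "cos (real (if m \<le> n then n - m else m - n) * x) = cos (real m * x - real n * x)"
      by (simp only: cos_minus split: if_splits) simp_all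
    then show ?thesis
      by (simp add: cosn_def cos_add cos_diff algebra_simps)
  qed
  then show ?case by (simp only: cos_poly.intros)
next
  case (add f g)
  then show ?case by (simp add: distrib_right cos_poly.add)
qed

lemma cos_poly_mult: "cos_poly g \<Longrightarrow> cos_poly f \<Longrightarrow> cos_poly (\<lambda>x. f x * g x)"
proof (induction rule: cos_poly.induct)
  case (monom d m)
  then show ?case by (rule cos_poly_mult_cosn)
next
  case (add f g)
  then show ?case by (simp add: distrib_left cos_poly.add)
qed

lemma cos_poly_continuous: "cos_poly f \<Longrightarrow> continuous_on S f"
  by (induction rule: cos_poly.induct) (auto intro!: continuous_intros)

text \<open>This is the Stone--Weierstrass theorem; the algebra separates points because cos is injective on the
  interval.\<close>

lemma cos_poly_dense:
  assumes "continuous_on {0..pi} f" "0 < e"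
  obtains p where "cos_poly p" "\<And>x. x \<in> {0..pi} \<Longrightarrow> \<bar>f x - p x\<bar> < e"
proof -
  have "\<exists>p. cos_poly p \<and> (\<forall>x\<in>{0..pi}. \<bar>f x - p x\<bar> < e)"
  proof (rule Stone_Weierstrass_HOL[where P = cos_poly])
    show "cos_poly (\<lambda>x. c)" for c
      using monom[of c 0] by (simp add: cosn_def)
    show "\<exists>f. cos_poly f \<and> f x \<noteq> f y" if "x \<in> {0..pi} \<and> y \<in> {0..pi} \<and> x \<noteq> y" for x y
      using that cos_inj_pi[of x y] monom[of 1 1] by (intro exI[of _ "cosn 1"]) (auto simp: cosn_def[abs_def])
  qed (use assms in \<open>auto intro: cos_poly.add cos_poly_mult cos_poly_continuous\<close>)
  with that show ?thesis by blast
qed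

lemma cos_poly_orthogonal:
  assumes "cos_poly p" 
  shows "\<exists>N. \<forall>r. L2_fun r \<longrightarrow> (\<forall>n\<le>N. ip r (cosn n) = 0) \<longrightarrow> ip r p = 0"
  using assms
proof (induction rule: cos_poly.induct)
  case (monom c n)
  show ?case
    by (rule exI[of _ n]) (subst (2) ip_commute, simp add: ip_scale ip_commute)
next
  case (add f g)
  then obtain N M where "\<forall>r. L2_fun r \<longrightarrow> (\<forall>n\<le>N. ip r (cosn n) = 0) \<longrightarrow> ip r f = 0"
     "\<forall>r. L2_fun r \<longrightarrow> (\<forall>n\<le>M. ip r (cosn n) = 0) \<longrightarrow> ip r g = 0" by blast
  moreover have "L2_fun f" "L2_fun g" using add by (auto intro: continuous_L2_fun cos_poly_continuous)
  ultimately show ?case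
    by (intro exI[of _ "max N M"] allI impI, subst ip_commute, subst ip_add) (auto simp: ip_commute)
qed

text \<open>A function orthogonal to all cosines is orthogonal to every cosine sum, in particular to those that
  approximate it uniformly, hence to itself.\<close>

lemma cosine_coefficients_unique:
  assumes f: "continuous_on {0..pi} f" and z: "\<And>n. ip f (cosn n) = 0" and x: "x \<in> {0..pi}"
  shows "f x = 0"
proof -
  have Lf: "L2_fun f" by (rule continuous_L2_fun[OF f])
  have "ip f f \<le> pi * e\<^sup>2" if "0 < e" for e
  proof -
    obtain p where p: "cos_poly p" "\<And>x. x \<in> {0..pi} \<Longrightarrow> \<bar>f x - p x\<bar> < e"
      using cos_poly_dense[OF f \<open>0 < e\<close>] by blast
    have Lp: "L2_fun p" by (rule continuous_L2_fun[OF cos_poly_continuous[OF p(1)]])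
    have fp: "ip f p = 0" using cos_poly_orthogonal[OF p(1)] z Lf by blast
    have "ip f f = ip (\<lambda>x. f x - p x) f"
      using fp ip_diff[OF Lf Lp Lf] by (simp add: ip_commute)
    moreover have "2 * \<bar>ip (\<lambda>x. f x - p x) f\<bar> \<le> ip (\<lambda>x. f x - p x) (\<lambda>x. f x - p x) + ip f f"
      by (intro ip_abs_le L2_fun_diff Lf Lp)
    moreover have "ip (\<lambda>x. f x - p x) (\<lambda>x. f x - p x) \<le> pi * e\<^sup>2"
      using p(2) by (intro ip_le_sup L2_fun_diff Lf Lp) (auto intro: less_imp_le)
    ultimately show ?thesis by linarith
  qed
  then have "((\<lambda>e. pi * e\<^sup>2) \<longlongrightarrow> pi * 0\<^sup>2) (at_right 0) \<Longrightarrow> ip f f \<le> pi * 0\<^sup>2"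
    by (intro tendsto_lowerbound[of "\<lambda>e. pi * e\<^sup>2"]) (auto simp: eventually_at_right_field intro!: exI[of _ 1])
  moreover have "((\<lambda>e. pi * e\<^sup>2) \<longlongrightarrow> pi * 0\<^sup>2) (at_right 0)" by (intro tendsto_intros)
  ultimately have "ip f f = 0" using ip_nonneg[of f] by simp
  with ip_continuous_zero[OF f] x show ?thesis by blast
qed

text \<open>Absolute summability of the coefficients makes the series converge uniformly, and its sum has the same
  coefficients as f, so that the two agree by uniqueness.\<close>

lemma cosine_series_sums:
  assumes f: "continuous_on {0..pi} f" and s: "summable (\<lambda>n. \<bar>ip f (cosn n)\<bar>)" and x: "x \<in> {0..pi}"
  shows "(\<lambda>n. wt n * ip f (cosn n) * cosn n x) sums f x"
proof -
  define t where "t n x = wt n * ip f (cosn n) * cosn n x" for n x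
  define S where "S x = (\<Sum>n. t n x)" for x
  have tb: "norm (t n x) \<le> \<bar>ip f (cosn n)\<bar>" for n x
  proof -
    have "\<bar>wt n * cosn n x\<bar> \<le> 1"
      using wt_nonneg[of n] wt_le[of n] by (auto simp: abs_mult cosn_def intro: mult_le_one)
    then show ?thesis
      using mult_right_mono[of "\<bar>wt n * cosn n x\<bar>" 1 "\<bar>ip f (cosn n)\<bar>"] by (simp add: t_def abs_mult mult_ac)
  qed
  have ul: "uniform_limit UNIV (\<lambda>n x. \<Sum>i<n. t i x) S sequentially"
    unfolding S_def[abs_def] by (rule Weierstrass_m_test) (rule tb, rule s)
  have tc: "continuous_on A (t n)" for A n unfolding t_def[abs_def] by (intro continuous_intros)
  have Sc: "continuous_on UNIV S"
    by (rule uniform_limit_theorem[OF _ ul]) (auto intro!: always_eventually continuous_on_sum tc)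
  then have Sc: "continuous_on A S" for A using continuous_on_subset by blast
  have ipS: "ip S (cosn m) = ip f (cosn m)" for m
  proof -
    have ul2: "uniform_limit {0..pi} (\<lambda>n x. (\<Sum>i<n. t i x) * cosn m x) (\<lambda>x. S x * cosn m x) sequentially"
      by (intro uniform_lim_mult uniform_limit_on_subset[OF ul] uniform_limit_const compact_imp_bounded
          compact_continuous_image Sc continuous_on_cosn) auto
    obtain I J where IJ: "\<And>n. ((\<lambda>x. (\<Sum>i<n. t i x) * cosn m x) has_integral I n) {0..pi}"
      "((\<lambda>x. S x * cosn m x) has_integral J) {0..pi}" "I \<longlonglongrightarrow> J"
      by (rule uniform_limit_integral[OF ul2]) (auto intro!: continuous_intros continuous_on_sum tc)
    have J: "ip S (cosn m) = J"
      using IJ(2) by (simp add: ip_continuous Sc continuous_on_cosn integral_unique)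
    have "I n = ip f (cosn m)" if "m < n" for n
    proof -
      have "I n = ip (\<lambda>x. \<Sum>i<n. t i x) (cosn m)"
        using integral_unique[OF IJ(1)] by (subst ip_continuous) (auto intro!: continuous_on_sum tc continuous_intros)
      also have "\<dots> = (\<Sum>i<n. ip (t i) (cosn m))"
        by (intro ip_sum continuous_L2_fun tc continuous_intros)
      also have "\<dots> = (\<Sum>i<n. if i = m then ip f (cosn m) else 0)"
        by (intro sum.cong refl) (auto simp: t_def[abs_def] ip_scale ip_cos_cos wt_pos[THEN less_imp_neq, symmetric])
      also have "\<dots> = ip f (cosn m)" using that by simp
      finally show ?thesis .
    qed
    then have "I \<longlonglongrightarrow> ip f (cosn m)"
      by (intro tendsto_eventually) (auto simp: eventually_sequentially intro!: exI[of _ "Suc m"])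
    then show ?thesis using J IJ(3) LIMSEQ_unique by blast
  qed
  have "f x - S x = 0"
  proof (rule cosine_coefficients_unique[OF _ _ x])
    show "continuous_on {0..pi} (\<lambda>x. f x - S x)" by (intro continuous_intros f Sc)
    show "ip (\<lambda>x. f x - S x) (cosn n) = 0" for n
      using ipS by (simp add: ip_diff continuous_L2_fun f Sc L2_cosn)
  qed
  moreover have "(\<lambda>n. t n x) sums S x"
    unfolding S_def by (rule summable_sums, rule summable_comparison_test'[OF s tb])
  ultimately show ?thesis by (simp add: t_def)
qed

section \<open>Sine series of square integrable functions\<close>

lemma L2_fun_bounded:
  assumes "f \<in> borel_measurable leb_I" "\<And>x. x \<in> {0..pi} \<Longrightarrow> \<bar>f x\<bar> \<le> K"
  shows "L2_fun f"
  unfolding L2_fun_def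
proof
  interpret finite_measure leb_I by (rule finite_measure_leb_I)
  show "integrable leb_I (\<lambda>x. (f x)\<^sup>2)"
  proof (rule integrable_const_bound[where B = "K\<^sup>2"])
    show "AE x in leb_I. norm ((f x)\<^sup>2) \<le> K\<^sup>2"
      using assms(2) by (intro AE_I2) (metis abs_ge_zero norm_power power_mono real_norm_def space_leb_I)
  qed (use assms(1) in measurable)
qed (rule assms)

lemma L2_fun_mult_continuous:
  assumes f: "L2_fun f" and g: "continuous_on {0..pi} g"
  shows "L2_fun (\<lambda>x. f x * g x)"
proof -
  have [measurable]: "f \<in> borel_measurable leb_I" "g \<in> borel_measurable leb_I"
    by (intro L2_fun_measurable f continuous_L2_fun g)+
  have "compact (g ` {0..pi})" by (intro compact_continuous_image g compact_Icc)
  then obtain B where B: "\<And>x. x \<in> {0..pi} \<Longrightarrow> \<bar>g x\<bar> \<le> B"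
    using compact_imp_bounded bounded_real by (metis image_eqI)
  have "integrable leb_I (\<lambda>x. (f x * g x)\<^sup>2)"
  proof (rule Bochner_Integration.integrable_bound)
    show "integrable leb_I (\<lambda>x. B\<^sup>2 * (f x)\<^sup>2)" using f by (simp add: L2_fun_def)
    show "AE x in leb_I. norm ((f x * g x)\<^sup>2) \<le> norm (B\<^sup>2 * (f x)\<^sup>2)"
    proof (rule AE_I2)
      fix x assume "x \<in> space leb_I"
      then have "(g x)\<^sup>2 \<le> B\<^sup>2" using B[of x] power_mono[of "\<bar>g x\<bar>" B 2] by simp
      then show "norm ((f x * g x)\<^sup>2) \<le> norm (B\<^sup>2 * (f x)\<^sup>2)"
        using mult_left_mono[of "(g x)\<^sup>2" "B\<^sup>2" "(f x)\<^sup>2"] by (simp add: power_mult_distrib mult.commute)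
    qed
  qed measurable
  then show ?thesis by (simp add: L2_fun_def)
qed

lemma ip_triangle3:
  assumes "L2_fun f" "L2_fun g" "L2_fun h"
  shows "ip (\<lambda>x. f x + g x + h x) (\<lambda>x. f x + g x + h x) \<le> 3 * (ip f f + ip g g + ip h h)"
proof -
  have "ip (\<lambda>x. f x + g x + h x) (\<lambda>x. f x + g x + h x) 
      \<le> (\<integral>x. 3 * (f x * f x + g x * g x + h x * h x) \<partial>leb_I)"
    unfolding ip_def
  proof (rule integral_mono)
    show "integrable leb_I (\<lambda>x. (f x + g x + h x) * (f x + g x + h x))"
      by (intro L2_fun_mult_integrable L2_fun_add assms)
    show "integrable leb_I (\<lambda>x. 3 * (f x * f x + g x * g x + h x * h x))"
      by (intro integrable_mult_right Bochner_Integration.integrable_add L2_fun_mult_integrable assms)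
    fix x
    have "0 \<le> (f x - g x)\<^sup>2 + (f x - h x)\<^sup>2 + (g x - h x)\<^sup>2" by simp
    then show "(f x + g x + h x) * (f x + g x + h x) \<le> 3 * (f x * f x + g x * g x + h x * h x)"
      by (simp add: power2_eq_square algebra_simps)
  qed
  also have "\<dots> = 3 * (ip f f + ip g g + ip h h)"
    by (simp add: ip_def L2_fun_mult_integrable assms)
  finally show ?thesis .
qed

definition clamp_to :: "real \<Rightarrow> real \<Rightarrow> real" where "clamp_to k y = max (- k) (min k y)"

lemma clamp_to_bounds: "0 \<le> k \<Longrightarrow> \<bar>clamp_to k y\<bar> \<le> k" "0 \<le> k \<Longrightarrow> \<bar>clamp_to k y\<bar> \<le> \<bar>y\<bar>"
  "\<bar>y\<bar> \<le> k \<Longrightarrow> clamp_to k y = y" "0 \<le> k \<Longrightarrow> 0 \<le> y * clamp_to k y"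
  by (auto simp: clamp_to_def max_def min_def mult_nonneg_nonneg mult_nonpos_nonpos mult_nonpos_nonneg)

lemma continuous_clamp_to: "continuous_on S (clamp_to k)"
  unfolding clamp_to_def[abs_def] by (intro continuous_intros)

text \<open>A measurable function is an almost everywhere limit of continuous ones; truncating these at the
  bound of f allows dominated convergence.\<close>

lemma bounded_L2_approx_continuous:
  assumes f: "f \<in> borel_measurable leb_I" and b: "\<And>x. x \<in> {0..pi} \<Longrightarrow> \<bar>f x\<bar> \<le> k" and e: "0 < e"
  obtains g where "continuous_on {0..pi} g" "ip (\<lambda>x. f x - g x) (\<lambda>x. f x - g x) < e"
proof -
  have k: "0 \<le> k" using b[of 0] by auto
  have "(\<lambda>x. indicator {0..pi} x *\<^sub>R f x) \<in> borel_measurable lborel"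
    using f by (simp add: borel_measurable_restrict_space_iff)
  then have "(\<lambda>x. indicator {0..pi} x *\<^sub>R f x) \<in> borel_measurable lebesgue"
    by (rule measurable_completion)
  then have "(\<lambda>x. indicator {0..pi} x *\<^sub>R f x) measurable_on UNIV"
    by (intro lebesgue_measurable_imp_measurable_on_real) auto
  then obtain N g where N: "negligible N" and gc: "\<And>n. continuous_on UNIV (g n)"
    and gl: "\<And>x. x \<notin> N \<Longrightarrow> (\<lambda>n. g n x) \<longlonglongrightarrow> indicator {0..pi} x *\<^sub>R f x"
    unfolding measurable_on_def by auto
  define G where "G n x = clamp_to k (g n x)" for n x
  have Gc: "continuous_on S (G n)" for S n
    unfolding G_def[abs_def]
    by (intro continuous_on_compose2[OF continuous_clamp_to[of UNIV]] continuous_on_subset[OF gc]) auto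
  have LG: "L2_fun (G n)" for n by (rule continuous_L2_fun[OF Gc])
  have Lf: "L2_fun f" by (rule L2_fun_bounded[OF f b])
  have ae: "AE x in leb_I. x \<notin> N"
  proof -
    have "AE x in lebesgue. x \<notin> N"
      using N by (simp add: negligible_iff_null_sets AE_not_in)
    then have "AE x in lborel. x \<notin> N"
      by (simp add: AE_completion_iff)
    then show ?thesis by (subst AE_restrict_space_iff) auto
  qed
  have "(\<lambda>n. \<integral>x. (f x - G n x) * (f x - G n x) \<partial>leb_I) \<longlonglongrightarrow> (\<integral>x. 0 \<partial>leb_I)"
  proof (rule integral_dominated_convergence[where w = "\<lambda>x. (2 * k)\<^sup>2"])
    show "(\<lambda>x. (f x - G n x) * (f x - G n x)) \<in> borel_measurable leb_I" for n
      by (intro borel_measurable_integrable L2_fun_mult_integrable L2_fun_diff Lf LG)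
    show "integrable leb_I (\<lambda>x. (2 * k)\<^sup>2)" by (intro continuous_integrable_leb_I continuous_intros)
    show "AE x in leb_I. norm ((f x - G n x) * (f x - G n x)) \<le> (2 * k)\<^sup>2" for n
    proof (rule AE_I2)
      fix x assume "x \<in> space leb_I"
      then have "\<bar>f x - G n x\<bar> \<le> 2 * k"
        using b[of x] clamp_to_bounds(1)[OF k, of "g n x"] by (auto simp: G_def)
      from power_mono[OF this, of 2] show "norm ((f x - G n x) * (f x - G n x)) \<le> (2 * k)\<^sup>2"
        by (simp add: power2_eq_square abs_mult)
    qed
    show "AE x in leb_I. (\<lambda>n. (f x - G n x) * (f x - G n x)) \<longlonglongrightarrow> 0"
      using ae AE_space
    proof eventually_elim
      case (elim x)
      then have "(\<lambda>n. g n x) \<longlonglongrightarrow> f x" using gl[of x] by simp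
      moreover have "continuous (at (f x)) (clamp_to k)"
        using continuous_clamp_to[of UNIV k] by (simp add: continuous_on_eq_continuous_at)
      ultimately have "(\<lambda>n. G n x) \<longlonglongrightarrow> clamp_to k (f x)"
        unfolding G_def by (rule isCont_tendsto_compose[rotated])
      also have "clamp_to k (f x) = f x" using elim b by (intro clamp_to_bounds) auto
      finally have "(\<lambda>n. (f x - G n x) * (f x - G n x)) \<longlonglongrightarrow> (f x - f x) * (f x - f x)"
        by (intro tendsto_intros)
      then show ?case by simp
    qed
  qed simp
  then have "\<forall>\<^sub>F n in sequentially. ip (\<lambda>x. f x - G n x) (\<lambda>x. f x - G n x) < e"
    unfolding ip_def using e by (intro order_tendstoD(2)) auto
  then obtain n where "ip (\<lambda>x. f x - G n x) (\<lambda>x. f x - G n x) < e"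
    by (auto simp: eventually_sequentially)
  with that[OF Gc] show ?thesis by blast
qed

text \<open>The products \<open>sin x * p x\<close> with a cosine sum p are sine sums. So f is divided by sin, truncated to
  become bounded, and the quotient is approximated by cosine sums; the factor sin removes the
  singularity at the two ends again.\<close>

lemma sine_poly_dense_L2:
  assumes f: "L2_fun f" and e: "0 < e"
  obtains p where "cos_poly p" "ip (\<lambda>x. f x - sin x * p x) (\<lambda>x. f x - sin x * p x) < e"
proof -
  have [measurable]: "f \<in> borel_measurable leb_I" by (rule L2_fun_measurable[OF f])
  have [measurable]: "(\<lambda>x::real. sin x) \<in> borel_measurable leb_I"
    by (intro L2_fun_measurable continuous_L2_fun continuous_intros)
  have [measurable]: "clamp_to k \<in> borel_measurable borel" for k
    by (intro borel_measurable_continuous_onI continuous_clamp_to)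
  define F where "F k x = clamp_to (real k) (f x / sin x)" for k :: nat and x
  have Fm: "F k \<in> borel_measurable leb_I" for k unfolding F_def[abs_def] by measurable
  have Fb: "\<bar>F k x\<bar> \<le> real k" for k x unfolding F_def by (rule clamp_to_bounds) simp
  have LF: "L2_fun (F k)" for k by (rule L2_fun_bounded[OF Fm Fb])
  have sinL: "L2_fun (\<lambda>x. sin x * g x)" if "L2_fun g" for g
    using L2_fun_mult_continuous[OF that, of sin] by (simp add: mult.commute continuous_intros)
  have sin_le: "ip (\<lambda>x. sin x * g x) (\<lambda>x. sin x * g x) \<le> ip g g" if g: "L2_fun g" for g
    unfolding ip_def
  proof (rule integral_mono)
    fix x
    have "(sin x)\<^sup>2 * (g x)\<^sup>2 \<le> 1 * (g x)\<^sup>2"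
      by (rule mult_right_mono) (auto simp: abs_square_le_1)
    then show "sin x * g x * (sin x * g x) \<le> g x * g x" by (simp add: power2_eq_square mult_ac)
  qed (intro L2_fun_mult_integrable sinL g)+
  have "(\<lambda>k. \<integral>x. (f x - sin x * F k x) * (f x - sin x * F k x) \<partial>leb_I) \<longlonglongrightarrow> (\<integral>x. 0 \<partial>leb_I)"
  proof (rule integral_dominated_convergence[where w = "\<lambda>x. f x * f x"])
    show "(\<lambda>x. (f x - sin x * F n x) * (f x - sin x * F n x)) \<in> borel_measurable leb_I" for n
      by (intro borel_measurable_integrable L2_fun_mult_integrable L2_fun_diff f sinL LF)
    show "integrable leb_I (\<lambda>x. f x * f x)" by (intro L2_fun_mult_integrable f)
    have pos: "AE x in leb_I. 0 < sin x"
    proof -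
      have "AE x in lborel. x \<noteq> 0 \<and> x \<noteq> pi" by (simp add: AE_lborel_singleton)
      then have "AE x in leb_I. x \<noteq> 0 \<and> x \<noteq> pi" by (subst AE_restrict_space_iff) auto
      then show ?thesis using AE_space by eventually_elim (auto intro!: sin_gt_zero)
    qed
    show "AE x in leb_I. norm ((f x - sin x * F n x) * (f x - sin x * F n x)) \<le> f x * f x" for n
      using pos
    proof eventually_elim
      case (elim x)
      define s where "s = sin x * F n x"
      have "0 \<le> (sin x)\<^sup>2 * (f x / sin x * F n x)"
        unfolding F_def by (intro mult_nonneg_nonneg clamp_to_bounds) auto
      then have 1: "0 \<le> f x * s" using elim by (simp add: s_def power2_eq_square field_simps)
      have "\<bar>F n x\<bar> \<le> \<bar>f x / sin x\<bar>" unfolding F_def by (rule clamp_to_bounds) simp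
      then have 2: "\<bar>s\<bar> \<le> \<bar>f x\<bar>" using elim by (simp add: s_def abs_mult field_simps)
      have "\<bar>f x - s\<bar> \<le> \<bar>f x\<bar>"
        using 1 2 by (auto simp: zero_le_mult_iff abs_if split: if_splits)
      from mult_mono[OF this this] show ?case by (simp add: s_def abs_mult[symmetric])
    qed
    show "AE x in leb_I. (\<lambda>n. (f x - sin x * F n x) * (f x - sin x * F n x)) \<longlonglongrightarrow> 0"
      using pos
    proof eventually_elim
      case (elim x)
      obtain M where M: "\<bar>f x / sin x\<bar> \<le> real M" using real_arch_simple by blast
      have "f x - sin x * F n x = 0" if "M \<le> n" for n
        unfolding F_def using elim M that by (subst clamp_to_bounds(3)) auto
      then show ?case
        by (intro tendsto_eventually) (auto simp: eventually_sequentially)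
    qed
  qed simp
  then have "\<forall>\<^sub>F k in sequentially. ip (\<lambda>x. f x - sin x * F k x) (\<lambda>x. f x - sin x * F k x) < e / 9"
    unfolding ip_def using e by (intro order_tendstoD(2)) auto
  then obtain k where k: "ip (\<lambda>x. f x - sin x * F k x) (\<lambda>x. f x - sin x * F k x) < e / 9"
    by (auto simp: eventually_sequentially)
  obtain g where g: "continuous_on {0..pi} g" "ip (\<lambda>x. F k x - g x) (\<lambda>x. F k x - g x) < e / 9"
    using bounded_L2_approx_continuous[OF Fm Fb, of "e / 9" k] e by auto
  have Lg: "L2_fun g" by (rule continuous_L2_fun[OF g(1)])
  \<comment> \<open>The supremum error d costs \<open>\<pi> d\<^sup>2\<close> in the squared L2 norm; \<open>4 / 40 < 1 / 9\<close>.\<close>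
  define d where "d = sqrt (e / 40)"
  have d: "0 < d" "pi * d\<^sup>2 < e / 9" using e pi_less_4 by (auto simp: d_def field_simps)
  obtain p where p: "cos_poly p" "\<And>x. x \<in> {0..pi} \<Longrightarrow> \<bar>g x - p x\<bar> < d"
    using cos_poly_dense[OF g(1) d(1)] by blast
  have Lp: "L2_fun p" by (rule continuous_L2_fun[OF cos_poly_continuous[OF p(1)]])
  have 3: "ip (\<lambda>x. g x - p x) (\<lambda>x. g x - p x) \<le> pi * d\<^sup>2"
    using p(2) by (intro ip_le_sup L2_fun_diff Lg Lp) (auto intro: less_imp_le)
  define u where "u x = f x - sin x * F k x" for x
  define v where "v x = sin x * (F k x - g x)" for x
  define w where "w x = sin x * (g x - p x)" for x
  have L: "L2_fun u" "L2_fun v" "L2_fun w"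
    unfolding u_def[abs_def] v_def[abs_def] w_def[abs_def] by (intro L2_fun_diff f sinL LF Lg Lp)+
  have "(\<lambda>x. f x - sin x * p x) = (\<lambda>x. u x + v x + w x)"
    by (simp add: u_def v_def w_def fun_eq_iff algebra_simps)
  then have "ip (\<lambda>x. f x - sin x * p x) (\<lambda>x. f x - sin x * p x) \<le> 3 * (ip u u + ip v v + ip w w)"
    using ip_triangle3[OF L] by simp
  moreover have "ip v v \<le> ip (\<lambda>x. F k x - g x) (\<lambda>x. F k x - g x)"
    unfolding v_def[abs_def] by (intro sin_le L2_fun_diff LF Lg)
  moreover have "ip w w \<le> ip (\<lambda>x. g x - p x) (\<lambda>x. g x - p x)"
    unfolding w_def[abs_def] by (intro sin_le L2_fun_diff Lg Lp)
  moreover have "ip u u < e / 9" using k by (simp add: u_def[abs_def])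
  moreover have "ip (\<lambda>x. g x - p x) (\<lambda>x. g x - p x) < e / 9"
    using 3 d(2) by (rule le_less_trans)
  ultimately have "ip (\<lambda>x. f x - sin x * p x) (\<lambda>x. f x - sin x * p x) < e"
    using g(2) by argo
  with that[OF p(1)] show ?thesis by blast
qed

lemma sin_cos_poly_orthogonal:
  assumes "cos_poly p" 
  shows "\<exists>N. \<forall>r. L2_fun r \<longrightarrow> (\<forall>n\<le>N. ip r (sinn n) = 0) \<longrightarrow> ip r (\<lambda>x. sin x * p x) = 0"
  using assms
proof (induction rule: cos_poly.induct)
  case (monom c n)
  have eq: "sin x * (c * cosn n x) = (c / 2) * sinn (n + 1) x + (if n = 0 then c / 2 else - (c / 2)) * sinn (if n = 0 then 1 else n - 1) x" for x
  proof (cases n)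
    case (Suc m)
    have "sin x * cos (real n * x) = (sin (x + real n * x) + sin (x - real n * x)) / 2"
      by (rule sin_times_cos)
    moreover have "x - real n * x = - (real m * x)" "x + real n * x = real (n + 1) * x"
      by (simp_all add: Suc algebra_simps)
    ultimately have e: "sin x * cosn n x = (sinn (n + 1) x + - sinn m x) / 2"
      by (simp only: cosn_def sinn_def sin_minus)
    have "sin x * (c * cosn n x) = c * (sin x * cosn n x)" by simp
    also have "\<dots> = (c / 2) * sinn (n + 1) x - (c / 2) * sinn m x"
      unfolding e by (simp add: field_simps)
    finally show ?thesis by (simp add: Suc)
  qed (simp add: cosn_def sinn_def)
  show ?case
    unfolding eq
  proof (intro exI[of _ "n + 1"] allI impI)
    fix r assume r: "L2_fun r" "\<forall>k\<le>n + 1. ip r (sinn k) = 0"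
    then have "ip (sinn (n + 1)) r = 0" "ip (sinn (if n = 0 then 1 else n - 1)) r = 0"
      by (simp_all add: ip_commute)
    then show "ip r (\<lambda>x. (c / 2) * sinn (n + 1) x + (if n = 0 then c / 2 else - (c / 2)) * sinn (if n = 0 then 1 else n - 1) x) = 0"
      by (subst ip_commute)
         (simp only: ip_add[OF L2_fun_scale[OF L2_sinn] L2_fun_scale[OF L2_sinn] r(1)] ip_scale mult_zero_right add_0)
  qed
next
  case (add f g)
  then obtain N M where NM: "\<forall>r. L2_fun r \<longrightarrow> (\<forall>n\<le>N. ip r (sinn n) = 0) \<longrightarrow> ip r (\<lambda>x. sin x * f x) = 0"
     "\<forall>r. L2_fun r \<longrightarrow> (\<forall>n\<le>M. ip r (sinn n) = 0) \<longrightarrow> ip r (\<lambda>x. sin x * g x) = 0" by blast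
  have "L2_fun (\<lambda>x. sin x * f x)" "L2_fun (\<lambda>x. sin x * g x)"
    by (intro continuous_L2_fun continuous_intros cos_poly_continuous add)+
  with NM show ?case
    by (intro exI[of _ "max N M"] allI impI, subst ip_commute, simp only: distrib_left, subst ip_add) (auto simp: ip_commute)
qed

text \<open>The residual of a partial sum is orthogonal to all low sine sums, and therefore no longer than the
  error of any of the approximations from \<open>sine_poly_dense_L2\<close>.\<close>

lemma sine_parseval:
  assumes f: "L2_fun f"
  shows "(\<lambda>n. 2 / pi * (ip f (sinn n))\<^sup>2) sums ip f f"
proof -
  define s where "s n = ip f (sinn n)" for n
  have s0: "s 0 = 0" by (simp add: s_def ip_def sinn_def)
  define c where "c n = 2 / pi * s n" for n
  define S where "S N x = (\<Sum>n<N. c n * sinn n x)" for N x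
  define r where "r N x = f x - S N x" for N x
  have LS: "L2_fun (S N)" and Lr: "L2_fun (r N)" for N
    unfolding S_def[abs_def] r_def[abs_def] by (intro L2_fun_diff f L2_fun_sum L2_fun_scale L2_sinn)+
  have Ssin: "ip (S N) (sinn m) = (if m < N then s m else 0)" for N m
  proof -
    have "ip (S N) (sinn m) = (\<Sum>n<N. c n * ip (sinn n) (sinn m))"
      unfolding S_def[abs_def] by (simp add: ip_sum L2_fun_scale L2_sinn ip_scale)
    also have "\<dots> = (\<Sum>n<N. if n = m then s m else 0)"
      by (intro sum.cong refl) (auto simp: ip_sin_sin s0 c_def)
    finally show ?thesis by simp
  qed
  have rS: "ip (r N) (S N) = 0" for N
  proof -
    have "ip (S N) (r N) = (\<Sum>n<N. c n * ip (sinn n) (r N))"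
      by (subst S_def[abs_def]) (simp add: ip_sum L2_fun_scale L2_sinn ip_scale Lr)
    also have "\<dots> = (\<Sum>n<N. 0)"
    proof (intro sum.cong refl)
      fix n assume "n \<in> {..<N}"
      then have "ip (r N) (sinn n) = 0"
        unfolding r_def[abs_def] by (simp add: ip_diff f LS L2_sinn Ssin s_def)
      then show "c n * ip (sinn n) (r N) = 0" by (simp add: ip_commute)
    qed
    finally show ?thesis by (simp add: ip_commute)
  qed
  have SS: "ip (S N) (S N) = (\<Sum>n<N. 2 / pi * (s n)\<^sup>2)" for N
  proof -
    have "ip (S N) (S N) = (\<Sum>n<N. c n * ip (sinn n) (S N))"
      by (subst S_def[abs_def]) (simp add: ip_sum L2_fun_scale L2_sinn ip_scale LS)
    also have "\<dots> = (\<Sum>n<N. 2 / pi * (s n)\<^sup>2)"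
      by (intro sum.cong refl, subst ip_commute) (simp add: Ssin power2_eq_square c_def)
    finally show ?thesis .
  qed
  have fr: "ip f f = ip (r N) (r N) + ip (S N) (S N)" for N
  proof -
    have "ip f f = ip (\<lambda>x. r N x + S N x) (\<lambda>x. r N x + S N x)" by (simp add: r_def)
    also have "\<dots> = ip (r N) (\<lambda>x. r N x + S N x) + ip (S N) (\<lambda>x. r N x + S N x)"
      by (intro ip_add Lr LS L2_fun_add)
    also have "ip (r N) (\<lambda>x. r N x + S N x) = ip (r N) (r N) + ip (r N) (S N)"
      using ip_add[OF Lr LS Lr, of N N N] by (simp add: ip_commute)
    also have "ip (S N) (\<lambda>x. r N x + S N x) = ip (r N) (S N) + ip (S N) (S N)"
      using ip_add[OF Lr LS LS, of N N N] by (simp add: ip_commute)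
    finally show ?thesis by (simp add: rS)
  qed
  have "(\<lambda>N. ip (S N) (S N)) \<longlonglongrightarrow> ip f f"
  proof (rule LIMSEQ_I)
    fix e :: real assume "0 < e"
    then obtain p where p: "cos_poly p" "ip (\<lambda>x. f x - sin x * p x) (\<lambda>x. f x - sin x * p x) < e"
      using sine_poly_dense_L2[OF f] by blast
    have Lp: "L2_fun (\<lambda>x. sin x * p x)"
      by (intro continuous_L2_fun continuous_intros cos_poly_continuous p)
    obtain M where M: "\<And>r. L2_fun r \<Longrightarrow> (\<And>n. n \<le> M \<Longrightarrow> ip r (sinn n) = 0) \<Longrightarrow> ip r (\<lambda>x. sin x * p x) = 0"
      using sin_cos_poly_orthogonal[OF p(1)] by blast
    have "norm (ip (S N) (S N) - ip f f) < e" if N: "M < N" for N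
    proof -
      have "ip (r N) (\<lambda>x. sin x * p x) = 0"
      proof (rule M[OF Lr])
        fix n assume "n \<le> M"
        then show "ip (r N) (sinn n) = 0"
          using N unfolding r_def[abs_def] by (simp add: ip_diff f LS L2_sinn Ssin s_def)
      qed
      moreover have "ip (r N) (r N) = ip f (r N) - ip (S N) (r N)"
        using ip_diff[OF f LS Lr, of N N] by (simp add: r_def[abs_def])
      moreover have "ip (\<lambda>x. f x - sin x * p x) (r N) = ip f (r N) - ip (\<lambda>x. sin x * p x) (r N)"
        by (intro ip_diff f Lp Lr)
      ultimately have "ip (r N) (r N) = ip (\<lambda>x. f x - sin x * p x) (r N)"
        using rS[of N] by (simp add: ip_commute)
      moreover have "2 * \<bar>ip (\<lambda>x. f x - sin x * p x) (r N)\<bar> \<le>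
          ip (\<lambda>x. f x - sin x * p x) (\<lambda>x. f x - sin x * p x) + ip (r N) (r N)"
        by (intro ip_abs_le L2_fun_diff f Lp Lr)
      ultimately have "ip (r N) (r N) < e" using p(2) by linarith
      then show ?thesis using fr[of N] ip_nonneg[of "r N"] by simp
    qed
    then show "\<exists>no. \<forall>n\<ge>no. norm (ip (S n) (S n) - ip f f) < e"
      by (intro exI[of _ "Suc M"]) auto
  qed
  then show ?thesis by (simp add: sums_def SS s_def)
qed

section \<open>Cosine coefficients of Sobolev functions\<close>

definition mode :: "H1 \<Rightarrow> nat \<Rightarrow> real" where "mode u n = ip (H1_fun u) (cosn n)"

lemma test_fun_deriv: "test_fun \<phi> \<Longrightarrow> (\<phi> has_real_derivative deriv \<phi> x) (at x)"
  by (simp add: test_fun_def DERIV_deriv_iff_real_differentiable)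

lemma test_fun_boundary: "test_fun \<phi> \<Longrightarrow> \<phi> 0 = 0" "test_fun \<phi> \<Longrightarrow> \<phi> pi = 0"
  using closure_subset[of "{x. \<phi> x \<noteq> 0}"] by (auto simp: test_fun_def)

lemma has_real_derivative_cosn: "(cosn n has_real_derivative - (real n * sinn n x)) (at x)"
  and has_real_derivative_sinn: "(sinn n has_real_derivative real n * cosn n x) (at x)"
  unfolding cosn_def[abs_def] sinn_def[abs_def] by (auto intro!: derivative_eq_intros)

lemma weak_deriv_cong:
  assumes "\<And>x. x \<in> {0..pi} \<Longrightarrow> u x = v x" "weak_deriv u g" shows "weak_deriv v g"
proof -
  have "(\<integral>x. u x * d x \<partial>leb_I) = (\<integral>x. v x * d x \<partial>leb_I)" for d
    by (rule Bochner_Integration.integral_cong) (use assms in auto)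
  with assms(2) show ?thesis by (simp add: weak_deriv_def)
qed

lemma weak_deriv_cosn: "weak_deriv (cosn n) (\<lambda>x. - real n * sinn n x)"
  unfolding weak_deriv_def
proof (intro allI impI)
  fix \<phi> assume t: "test_fun \<phi>"
  note c = test_fun_continuous[OF t] test_fun_deriv_continuous[OF t]
  have "((\<lambda>x. cosn n x * deriv \<phi> x + - real n * sinn n x * \<phi> x) has_integral cosn n pi * \<phi> pi - cosn n 0 * \<phi> 0) {0..pi}"
  proof (rule fundamental_theorem_of_calculus)
    fix x
    have "((\<lambda>x. cosn n x * \<phi> x) has_real_derivative (cosn n x * deriv \<phi> x + - real n * sinn n x * \<phi> x)) (at x)"
      by (rule derivative_eq_intros has_real_derivative_cosn test_fun_deriv[OF t])+ (simp add: algebra_simps)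
    then show "((\<lambda>x. cosn n x * \<phi> x) has_vector_derivative (cosn n x * deriv \<phi> x + - real n * sinn n x * \<phi> x)) (at x within {0..pi})"
      by (simp add: has_real_derivative_iff_has_vector_derivative has_vector_derivative_at_within)
  qed simp
  then have "integral {0..pi} (\<lambda>x. cosn n x * deriv \<phi> x + - real n * sinn n x * \<phi> x) = 0"
    using test_fun_boundary[OF t] by (simp add: integral_unique)
  moreover have "integral {0..pi} (\<lambda>x. cosn n x * deriv \<phi> x + - real n * sinn n x * \<phi> x)
      = integral {0..pi} (\<lambda>x. cosn n x * deriv \<phi> x) + integral {0..pi} (\<lambda>x. - real n * sinn n x * \<phi> x)"
    by (intro integral_add integrable_continuous_real continuous_intros c)
  moreover have "(\<integral>x. cosn n x * deriv \<phi> x \<partial>leb_I) = integral {0..pi} (\<lambda>x. cosn n x * deriv \<phi> x)"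
    "(\<integral>x. - real n * sinn n x * \<phi> x \<partial>leb_I) = integral {0..pi} (\<lambda>x. - real n * sinn n x * \<phi> x)"
    by (intro integral_leb_I_eq continuous_integrable_leb_I continuous_intros c)+
  ultimately show "(\<integral>x. cosn n x * deriv \<phi> x \<partial>leb_I) = - (\<integral>x. - real n * sinn n x * \<phi> x \<partial>leb_I)"
    by linarith
qed

definition cosH :: "nat \<Rightarrow> H1" where
  "cosH n = Abs_H1 (\<lambda>x. if x \<in> {0..pi} then cosn n x else 0)"

lemma H1_fun_cosH: "H1_fun (cosH n) x = (if x \<in> {0..pi} then cosn n x else 0)"
proof -
  let ?u = "\<lambda>x. if x \<in> {0..pi} then cosn n x else 0"
  have "continuous_on {0..pi} ?u \<longleftrightarrow> continuous_on {0..pi} (cosn n)"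
    by (rule continuous_on_cong) auto
  then have "continuous_on {0..pi} ?u" using continuous_on_cosn by blast
  moreover have "weak_deriv ?u (\<lambda>x. - real n * sinn n x)"
    by (rule weak_deriv_cong[OF _ weak_deriv_cosn]) simp
  moreover have "L2_fun (\<lambda>x. - real n * sinn n x)" by (intro L2_fun_scale L2_sinn)
  ultimately have "?u \<in> {u. continuous_on {0..pi} u \<and> (\<forall>x. x \<notin> {0..pi} \<longrightarrow> u x = 0)
    \<and> (\<exists>g. L2_fun g \<and> weak_deriv u g)}" by auto
  then show ?thesis unfolding cosH_def by (subst Abs_H1_inverse) auto
qed

lemma ip_cong: "(\<And>x. x \<in> {0..pi} \<Longrightarrow> f x = f' x) \<Longrightarrow> (\<And>x. x \<in> {0..pi} \<Longrightarrow> g x = g' x) \<Longrightarrow> ip f g = ip f' g'"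
  unfolding ip_def by (rule Bochner_Integration.integral_cong) auto

lemma H1_embed_cosH: "blinfun_apply (H1_embed u) (cosH n) = mode u n"
proof -
  have "blinfun_apply (H1_embed u) (cosH n) = ip (H1_fun u) (H1_fun (cosH n))"
    by (transfer fixing: n) (simp add: ip_def)
  also have "\<dots> = mode u n" unfolding mode_def by (rule ip_cong) (auto simp: H1_fun_cosH)
  finally show ?thesis .
qed

lemma delta_cosH: "blinfun_apply \<delta>\<^sub>0 (cosH n) = 1"
  by transfer (simp add: H1_fun_cosH cosn_def)

text \<open>Integration by parts for a weak derivative: the product \<open>u sin (n x)\<close> is again a Sobolev function, and it
  vanishes at both ends because the sine does.\<close>

lemma ip_H1_deriv_sinn: "ip (H1_deriv u) (sinn n) = - real n * mode u n"
proof -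
  let ?f = "H1_fun u" and ?g = "H1_deriv u"
  have w: "weak_deriv (\<lambda>x. ?f x * sinn n x) (\<lambda>x. ?g x * sinn n x + real n * (?f x * cosn n x))"
    unfolding weak_deriv_def
  proof (intro allI impI)
    fix \<phi> assume t: "test_fun \<phi>"
    note c = test_fun_continuous[OF t] test_fun_deriv_continuous[OF t]
    have d: "((\<lambda>x. sinn n x * \<phi> x) has_real_derivative (real n * cosn n x * \<phi> x + sinn n x * deriv \<phi> x)) (at x)" for x
      by (rule derivative_eq_intros has_real_derivative_sinn test_fun_deriv[OF t])+ (simp add: algebra_simps)
    then have dd: "deriv (\<lambda>x. sinn n x * \<phi> x) = (\<lambda>x. real n * cosn n x * \<phi> x + sinn n x * deriv \<phi> x)"
      by (intro ext DERIV_imp_deriv)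
    have tt: "test_fun (\<lambda>x. sinn n x * \<phi> x)"
      unfolding test_fun_def dd
    proof (intro conjI allI)
      show "(\<lambda>x. sinn n x * \<phi> x) differentiable at x" for x
        using d real_differentiable_def by blast
      have "continuous_on UNIV \<phi>" by (rule DERIV_continuous_on, rule has_field_derivative_at_within, rule test_fun_deriv[OF t])
      moreover have "continuous_on UNIV (deriv \<phi>)" using t by (simp add: test_fun_def)
      ultimately show "continuous_on UNIV (\<lambda>x. real n * cosn n x * \<phi> x + sinn n x * deriv \<phi> x)"
        by (intro continuous_intros)
      have "closure {x. sinn n x * \<phi> x \<noteq> 0} \<subseteq> closure {x. \<phi> x \<noteq> 0}" by (intro closure_mono) auto
      then show "closure {x. sinn n x * \<phi> x \<noteq> 0} \<subseteq> {0<..<pi}" using t by (auto simp: test_fun_def)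
    qed
    have "(\<integral>x. ?f x * (real n * cosn n x * \<phi> x + sinn n x * deriv \<phi> x) \<partial>leb_I) = - (\<integral>x. ?g x * (sinn n x * \<phi> x) \<partial>leb_I)"
      using H1_weak_deriv[of u, unfolded weak_deriv_def, THEN spec, THEN mp, OF tt] by (simp only: dd)
    moreover have I: "integrable leb_I (\<lambda>x. real n * (?f x * cosn n x) * \<phi> x)"
      "integrable leb_I (\<lambda>x. ?f x * sinn n x * deriv \<phi> x)"
      "integrable leb_I (\<lambda>x. ?g x * (sinn n x * \<phi> x))"
    proof -
      show "integrable leb_I (\<lambda>x. real n * (?f x * cosn n x) * \<phi> x)"
        by (intro continuous_integrable_leb_I continuous_intros H1_fun_continuous c)
      show "integrable leb_I (\<lambda>x. ?f x * sinn n x * deriv \<phi> x)"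
        by (intro continuous_integrable_leb_I continuous_intros H1_fun_continuous c)
      show "integrable leb_I (\<lambda>x. ?g x * (sinn n x * \<phi> x))"
        by (rule L2_fun_mult_integrable[OF H1_deriv_L2 continuous_L2_fun]) (intro continuous_intros c)
    qed
    moreover have "(\<lambda>x. ?f x * (real n * cosn n x * \<phi> x + sinn n x * deriv \<phi> x))
        = (\<lambda>x. real n * (?f x * cosn n x) * \<phi> x + ?f x * sinn n x * deriv \<phi> x)"
      "(\<lambda>x. (?g x * sinn n x + real n * (?f x * cosn n x)) * \<phi> x)
        = (\<lambda>x. ?g x * (sinn n x * \<phi> x) + real n * (?f x * cosn n x) * \<phi> x)"
      by (simp_all add: fun_eq_iff distrib_left distrib_right mult_ac)
    moreover note Bochner_Integration.integral_add[OF I(1) I(2)] Bochner_Integration.integral_add[OF I(3) I(1)]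
    ultimately show "(\<integral>x. ?f x * sinn n x * deriv \<phi> x \<partial>leb_I)
       = - (\<integral>x. (?g x * sinn n x + real n * (?f x * cosn n x)) * \<phi> x \<partial>leb_I)" by simp
  qed
  have L: "L2_fun (\<lambda>x. ?g x * sinn n x)" "L2_fun (\<lambda>x. real n * (?f x * cosn n x))"
    by (intro L2_fun_mult_continuous H1_deriv_L2 continuous_on_sinn)
       (intro continuous_L2_fun continuous_intros H1_fun_continuous)
  have "?f pi * sinn n pi = ?f 0 * sinn n 0 + integral {0..pi} (\<lambda>x. ?g x * sinn n x + real n * (?f x * cosn n x))"
    by (rule weak_deriv_ftc[OF _ _ w]) (intro continuous_intros H1_fun_continuous L2_fun_add L | simp)+
  then have "integral {0..pi} (\<lambda>x. ?g x * sinn n x + real n * (?f x * cosn n x)) = 0"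
    by (simp add: sinn_def)
  then have "(\<integral>x. ?g x * sinn n x + real n * (?f x * cosn n x) \<partial>leb_I) = 0"
    using integral_leb_I_eq(2)[OF L2_fun_integrable[OF L2_fun_add[OF L]]] by simp
  then have "(\<integral>x. ?g x * sinn n x \<partial>leb_I) + (\<integral>x. real n * (?f x * cosn n x) \<partial>leb_I) = 0"
    using Bochner_Integration.integral_add[OF L2_fun_integrable[OF L(1)] L2_fun_integrable[OF L(2)]] by simp
  then show ?thesis by (simp add: ip_def mode_def)
qed

text \<open>The cosines are eigenfunctions of the weak Neumann Laplacian.\<close>

lemma A_N_cosH: "blinfun_apply (A_N u) (cosH n) = (real n)\<^sup>2 * mode u n"
proof -
  have "weak_deriv (H1_fun (cosH n)) (\<lambda>x. - real n * sinn n x)"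
    by (rule weak_deriv_cong[OF _ weak_deriv_cosn]) (simp add: H1_fun_cosH)
  then have ae: "AE x in leb_I. H1_deriv (cosH n) x = - real n * sinn n x"
    by (intro H1_deriv_AE_eqI L2_fun_scale L2_sinn)
  have "blinfun_apply (A_N u) (cosH n) = (\<integral>x. H1_deriv u x * H1_deriv (cosH n) x \<partial>leb_I)"
    by (transfer fixing: n) simp
  also have "\<dots> = (\<integral>x. H1_deriv u x * (- real n * sinn n x) \<partial>leb_I)"
  proof (rule integral_cong_AE)
    show "AE x in leb_I. H1_deriv u x * H1_deriv (cosH n) x = H1_deriv u x * (- real n * sinn n x)"
      using ae by eventually_elim simp
  qed (intro borel_measurable_times L2_fun_measurable H1_deriv_L2 L2_fun_scale L2_sinn)+
  also have "\<dots> = - real n * ip (H1_deriv u) (sinn n)"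
    by (simp add: ip_def mult.left_commute)
  finally show ?thesis by (simp add: ip_H1_deriv_sinn power2_eq_square)
qed

text \<open>Parseval's identity for the weak derivative, in terms of the coefficients of the function itself.\<close>

lemma mode_square_sums: "(\<lambda>n. 2 / pi * (real n * mode u n)\<^sup>2) sums Dirichlet_form u u"
  using sine_parseval[OF H1_deriv_L2[of u], unfolded ip_H1_deriv_sinn] by (simp add: Dirichlet_form_def ip_def)

lemma summable_inverse_squares: "summable (\<lambda>n. 1 / (real n)\<^sup>2)"
  using inverse_power_summable[of 2, where 'a = real] by (simp add: divide_inverse)

lemma mode_summable: "summable (\<lambda>n. \<bar>mode u n\<bar>)"
proof -
  have "summable (\<lambda>n. (real n * mode u n)\<^sup>2)"
    using summable_mult[OF sums_summable[OF mode_square_sums[of u]], of "pi / 2"] by simp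
  then have s: "summable (\<lambda>n. 1 / (real n)\<^sup>2 + (real n * mode u n)\<^sup>2)"
    by (intro summable_add summable_inverse_squares)
  show ?thesis
  proof (rule summable_comparison_test'[OF s])
    fix n :: nat assume "1 \<le> n"
    have "0 \<le> (1 / real n - real n * \<bar>mode u n\<bar>)\<^sup>2" by simp
    also have "\<dots> = 1 / (real n)\<^sup>2 + (real n * mode u n)\<^sup>2 - 2 * \<bar>mode u n\<bar>"
      using \<open>1 \<le> n\<close> by (simp add: power2_eq_square algebra_simps abs_mult_self_eq)
    finally show "norm \<bar>mode u n\<bar> \<le> 1 / (real n)\<^sup>2 + (real n * mode u n)\<^sup>2" by simp
  qed
qed

lemma H1_fun_cosine_sums: "x \<in> {0..pi} \<Longrightarrow> (\<lambda>n. wt n * mode u n * cosn n x) sums H1_fun u x"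
  using cosine_series_sums[OF H1_fun_continuous[of u], of x] mode_summable[of u] by (simp add: mode_def)

lemma mode_bound: "\<bar>mode u n\<bar> \<le> ((norm u)\<^sup>2 + pi) / 2"
proof -
  have "2 * \<bar>mode u n\<bar> \<le> ip (H1_fun u) (H1_fun u) + ip (cosn n) (cosn n)"
    unfolding mode_def by (intro ip_abs_le H1_fun_L2 L2_cosn)
  moreover have "ip (cosn n) (cosn n) \<le> pi" by (simp add: ip_cos_cos wt_def)
  moreover have "ip (H1_fun u) (H1_fun u) \<le> (norm u)\<^sup>2"
    using Dirichlet_form_nonneg[of u] by (simp add: H1_norm_square L2_form_def ip_def)
  ultimately show ?thesis by simp
qed

text \<open>The derivative part is an identity by Parseval; for the L2 part the crude supremum bound suffices.\<close>

lemma norm_H1_le_modes: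
  "(norm u)\<^sup>2 \<le> pi * (\<Sum>n. \<bar>mode u n\<bar>)\<^sup>2 + (\<Sum>n. (real n * mode u n)\<^sup>2)"
proof -
  have s: "summable (\<lambda>n. (real n * mode u n)\<^sup>2)"
    using summable_mult[OF sums_summable[OF mode_square_sums[of u]], of "pi / 2"] by simp
  have "Dirichlet_form u u = (\<Sum>n. 2 / pi * (real n * mode u n)\<^sup>2)"
    by (rule sums_unique[OF mode_square_sums])
  also have "\<dots> \<le> (\<Sum>n. (real n * mode u n)\<^sup>2)"
  proof (rule suminf_le)
    fix n show "2 / pi * (real n * mode u n)\<^sup>2 \<le> (real n * mode u n)\<^sup>2"
      using mult_right_mono[of "2 / pi" 1 "(real n * mode u n)\<^sup>2"] pi_gt3 by simp
  qed (use s in \<open>auto intro: sums_summable[OF mode_square_sums]\<close>)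
  finally have D: "Dirichlet_form u u \<le> (\<Sum>n. (real n * mode u n)\<^sup>2)" .
  have "ip (H1_fun u) (H1_fun u) \<le> pi * (\<Sum>n. \<bar>mode u n\<bar>)\<^sup>2"
  proof (rule ip_le_sup[OF H1_fun_L2])
    fix x assume x: "x \<in> {0..pi}"
    have b: "\<bar>wt n * mode u n * cosn n x\<bar> \<le> \<bar>mode u n\<bar>" for n
    proof -
      have "\<bar>wt n * cosn n x\<bar> \<le> 1"
        using wt_nonneg[of n] wt_le[of n] by (auto simp: abs_mult cosn_def intro: mult_le_one)
      then show ?thesis
        using mult_right_mono[of "\<bar>wt n * cosn n x\<bar>" 1 "\<bar>mode u n\<bar>"] by (simp add: abs_mult mult_ac)
    qed
    have sm: "summable (\<lambda>n. \<bar>wt n * mode u n * cosn n x\<bar>)"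
      by (rule summable_comparison_test'[OF mode_summable[of u]]) (use b in auto)
    have "\<bar>H1_fun u x\<bar> = \<bar>\<Sum>n. wt n * mode u n * cosn n x\<bar>"
      using sums_unique[OF H1_fun_cosine_sums[OF x, of u]] by simp
    also have "\<dots> \<le> (\<Sum>n. \<bar>wt n * mode u n * cosn n x\<bar>)" by (rule summable_rabs[OF sm])
    also have "\<dots> \<le> (\<Sum>n. \<bar>mode u n\<bar>)" by (rule suminf_le[OF b sm mode_summable])
    finally show "\<bar>H1_fun u x\<bar> \<le> (\<Sum>n. \<bar>mode u n\<bar>)" .
  qed
  with D show ?thesis by (simp add: H1_norm_square L2_form_def ip_def)
qed

section \<open>The heat semigroup on the cosine modes\<close>

lemma bounded_linear_eval_pi: "bounded_linear (\<lambda>v. H1_fun v pi)"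
proof (rule bounded_linear_if_square_bound)
  show "linear (\<lambda>v. H1_fun v pi)"
    by (rule linearI) (simp_all add: H1_fun_add H1_fun_scaleR)
  fix v
  let ?a = "\<lambda>n. \<bar>mode v n\<bar>"
  have s2: "(\<lambda>n. (real n * mode v n)\<^sup>2) sums (pi / 2 * Dirichlet_form v v)"
    using sums_mult[OF mode_square_sums[of v], of "pi / 2"] by simp
  define M where "M n = (if n = 0 then ((norm v)\<^sup>2 + pi) / 2 else 0) + (1 / (real n)\<^sup>2 + (real n * mode v n)\<^sup>2)" for n
  have M: "M sums (((norm v)\<^sup>2 + pi) / 2 + ((\<Sum>n. 1 / (real n)\<^sup>2) + pi / 2 * Dirichlet_form v v))"
    unfolding M_def[abs_def]
    by (intro sums_add s2 summable_sums[OF summable_inverse_squares] sums_single)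
  have b: "\<bar>wt n * mode v n * cosn n pi\<bar> \<le> M n" for n
  proof -
    have "\<bar>wt n * cosn n pi\<bar> \<le> 1"
      using wt_nonneg[of n] wt_le[of n] by (auto simp: abs_mult cosn_def intro: mult_le_one)
    then have "\<bar>wt n * mode v n * cosn n pi\<bar> \<le> \<bar>mode v n\<bar>"
      using mult_right_mono[of "\<bar>wt n * cosn n pi\<bar>" 1 "\<bar>mode v n\<bar>"] by (simp add: abs_mult mult_ac)
    also have "\<dots> \<le> M n"
    proof (cases "n = 0")
      case True
      then show ?thesis using mode_bound[of v 0] by (simp add: M_def)
    next
      case False
      have "0 \<le> (1 / real n - real n * \<bar>mode v n\<bar>)\<^sup>2" by simp
      also have "\<dots> = 1 / (real n)\<^sup>2 + (real n * mode v n)\<^sup>2 - 2 * \<bar>mode v n\<bar>"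
        using False by (simp add: power2_eq_square algebra_simps abs_mult_self_eq)
      finally show ?thesis using False by (simp add: M_def)
    qed
    finally show ?thesis .
  qed
  have sm: "summable (\<lambda>n. \<bar>wt n * mode v n * cosn n pi\<bar>)"
    by (rule summable_comparison_test'[OF sums_summable[OF M]]) (use b in auto)
  have "\<bar>H1_fun v pi\<bar> = \<bar>\<Sum>n. wt n * mode v n * cosn n pi\<bar>"
    using sums_unique[OF H1_fun_cosine_sums[of pi v]] by simp
  also have "\<dots> \<le> (\<Sum>n. \<bar>wt n * mode v n * cosn n pi\<bar>)" by (rule summable_rabs[OF sm])
  also have "\<dots> \<le> (\<Sum>n. M n)" by (rule suminf_le[OF b sm sums_summable[OF M]])
  also have "\<dots> = ((norm v)\<^sup>2 + pi) / 2 + ((\<Sum>n. 1 / (real n)\<^sup>2) + pi / 2 * Dirichlet_form v v)"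
    using sums_unique[OF M] by simp
  also have "\<dots> \<le> (pi / 2 + (\<Sum>n. 1 / (real n)\<^sup>2)) + (1 / 2 + pi / 2) * (norm v)\<^sup>2"
    using L2_form_nonneg[of v] pi_gt_zero by (simp add: H1_norm_square algebra_simps)
  finally show "\<bar>H1_fun v pi\<bar> \<le> (pi / 2 + (\<Sum>n. 1 / (real n)\<^sup>2)) + (1 / 2 + pi / 2) * (norm v)\<^sup>2" .
qed

text \<open>The generator is defined by one-sided difference quotients, whereas the calculus of integrals speaks
  of derivatives within a set; this lemma translates.\<close>

lemma right_difference_quotient:
  fixes F :: "real \<Rightarrow> 'a::real_normed_vector"
  assumes "(F has_vector_derivative D) (at t within {t..})"
  shows "((\<lambda>h. (F (t + h) - F t) /\<^sub>R h) \<longlongrightarrow> D) (at_right 0)"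
proof -
  have "((\<lambda>y. (1 / norm (y - t)) *\<^sub>R (F y - (F t + (y - t) *\<^sub>R D))) \<longlongrightarrow> 0) (at t within {t..})"
    using assms by (simp add: has_vector_derivative_def has_derivative_within)
  moreover have "filterlim (\<lambda>h. t + h) (at t within {t..}) (at_right 0)"
    unfolding filterlim_at
    by (auto intro!: tendsto_eq_intros simp: eventually_at_filter)
  ultimately have "((\<lambda>h. (1 / norm (t + h - t)) *\<^sub>R (F (t + h) - (F t + (t + h - t) *\<^sub>R D))) \<longlongrightarrow> 0) (at_right 0)"
    by (rule filterlim_compose)
  moreover have "\<forall>\<^sub>F h in at_right 0. (1 / norm (t + h - t)) *\<^sub>R (F (t + h) - (F t + (t + h - t) *\<^sub>R D)) = (F (t + h) - F t) /\<^sub>R h - D"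
    by (auto simp: eventually_at_filter divide_inverse scaleR_diff_right scaleR_add_right)
  ultimately have "((\<lambda>h. (F (t + h) - F t) /\<^sub>R h - D) \<longlongrightarrow> 0) (at_right 0)"
    by (rule Lim_transform_eventually)
  then show ?thesis by (simp add: LIM_zero_iff)
qed

text \<open>Applying \<open>T h\<close> to the integral shifts the interval of integration by h, so its difference quotient is the
  difference of two averages of \<open>T s f\<close>, one just after t and one just after 0. In this way the generator gives
  information on the orbit of every f, such as \<open>\<delta>\<^sub>0\<close>, which lies outside its domain.\<close>

lemma C0_semigroup_integral_generator:
  fixes T :: "real \<Rightarrow> 'a::banach \<Rightarrow>\<^sub>L 'a"
  assumes T: "C0_semigroup T" and t: "0 \<le> t"
  shows "(integral {0..t} (\<lambda>s. T s f), T t f - f) \<in> generator T"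
proof -
  have T0: "T 0 = id_blinfun" and Tadd: "\<And>s t. 0 \<le> s \<Longrightarrow> 0 \<le> t \<Longrightarrow> T (s + t) = T s o\<^sub>L T t"
    and Tc: "continuous_on {0..} (\<lambda>t. T t f)" using T by (auto simp: C0_semigroup_def)
  define W where "W r = integral {0..r} (\<lambda>s. T s f)" for r
  have Tc': "continuous_on {a..b} (\<lambda>t. T t f)" if "0 \<le> a" for a b
    by (rule continuous_on_subset[OF Tc]) (use that in auto)
  have W: "(W has_vector_derivative T r f) (at r within {r..})" if r: "0 \<le> r" for r
  proof -
    have "(W has_vector_derivative T r f) (at r within {0..r + 1})"
      unfolding W_def[abs_def] by (rule integral_has_vector_derivative[OF Tc']) (use r in auto)
    then have "(W has_vector_derivative T r f) (at r within {r..r + 1})"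
      by (rule has_vector_derivative_within_subset) (use r in auto)
    moreover have "at r within {r..r + 1} = at r within {r..}"
      by (rule at_within_nhd[where S = "{..<r + 1}"]) auto
    ultimately show ?thesis by simp
  qed
  have eq: "T h (W t) - W t = (W (t + h) - W t) - (W (0 + h) - W 0)" if h: "0 < h" for h
  proof -
    have "T h (W t) = integral {0..t} (T h \<circ> (\<lambda>s. T s f))"
      unfolding W_def
      by (rule integral_linear[symmetric, OF integrable_continuous_real[OF Tc'] blinfun.bounded_linear_right]) simp
    also have "\<dots> = integral {0..t} ((\<lambda>s. T s f) \<circ> (+) h)"
      using h by (intro integral_cong) (simp add: Tadd)
    also have "\<dots> = integral {h..t + h} (\<lambda>s. T s f)" by (subst integral_shift_Icc_real) simp
    also have "\<dots> = W (t + h) - W h"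
      using Henstock_Kurzweil_Integration.integral_combine[of 0 h "t + h" "\<lambda>s. T s f"] h t
      by (simp add: W_def integrable_continuous_real[OF Tc'] eq_diff_eq add.commute)
    finally show ?thesis by (simp add: W_def)
  qed
  have "((\<lambda>h. (W (t + h) - W t) /\<^sub>R h - (W (0 + h) - W 0) /\<^sub>R h) \<longlongrightarrow> T t f - T 0 f) (at_right 0)"
    using t by (intro tendsto_diff right_difference_quotient W) auto
  then have "((\<lambda>h. (T h (W t) - W t) /\<^sub>R h) \<longlongrightarrow> T t f - T 0 f) (at_right 0)"
  proof (rule Lim_transform_eventually)
    show "\<forall>\<^sub>F h in at_right 0. (W (t + h) - W t) /\<^sub>R h - (W (0 + h) - W 0) /\<^sub>R h = (T h (W t) - W t) /\<^sub>R h"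
      using eventually_at_right_less[of 0] by eventually_elim (simp only: eq scaleR_diff_right)
  qed
  then show ?thesis by (simp add: generator_def W_def T0)
qed

text \<open>Tested against \<open>cos (n x)\<close>, the generator relation for the integral of \<open>T s f\<close> becomes the scalar
  integral equation \<open>\<phi>(r) = \<phi>(0) - n\<^sup>2 \<integral> \<phi>\<close>.\<close>

lemma heat_semigroup_mode:
  assumes T: "neumann_heat_semigroup T" and t: "0 \<le> t"
  shows "T t f (cosH n) = exp (- (real n)\<^sup>2 * t) * f (cosH n)"
proof -
  have C0: "C0_semigroup T" and gen: "generator T = {(H1_embed u, - A_N u) | u. True}"
    using T by (auto simp: neumann_heat_semigroup_def)
  define \<phi> where "\<phi> s = T s f (cosH n)" for s
  have Tc: "continuous_on {0..} (\<lambda>t. T t f)" using C0 by (simp add: C0_semigroup_def)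
  have \<phi>c: "continuous_on {0..r} \<phi>" for r
    unfolding \<phi>_def[abs_def] by (intro continuous_intros continuous_on_subset[OF Tc]) auto
  have eq: "\<phi> r = \<phi> 0 - (real n)\<^sup>2 * integral {0..r} \<phi>" if r: "0 \<le> r" for r
  proof -
    have "(integral {0..r} (\<lambda>s. T s f), T r f - f) \<in> generator T"
      by (rule C0_semigroup_integral_generator[OF C0 r])
    then obtain u where u: "integral {0..r} (\<lambda>s. T s f) = H1_embed u" "T r f - f = - A_N u"
      unfolding gen by auto
    have "(T r f - f) (cosH n) = - ((real n)\<^sup>2 * (H1_embed u) (cosH n))"
      unfolding u(2) by (simp add: blinfun.minus_left A_N_cosH H1_embed_cosH)
    also have "(H1_embed u) (cosH n) = integral {0..r} ((\<lambda>g. blinfun_apply g (cosH n)) \<circ> (\<lambda>s. T s f))"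
      unfolding u(1)[symmetric]
      by (rule integral_linear[symmetric, OF integrable_continuous_real blinfun.bounded_linear_left])
         (auto intro: continuous_on_subset[OF Tc])
    also have "\<dots> = integral {0..r} \<phi>" by (simp add: \<phi>_def[abs_def] o_def)
    finally have "T r f (cosH n) - f (cosH n) = - ((real n)\<^sup>2 * integral {0..r} \<phi>)"
      by (simp add: blinfun.diff_left)
    moreover have "\<phi> 0 = f (cosH n)" using C0 by (simp add: \<phi>_def C0_semigroup_def)
    ultimately show ?thesis by (simp add: \<phi>_def)
  qed
  have d: "(\<phi> has_real_derivative - (real n)\<^sup>2 * \<phi> r) (at r within {0..t})" if r: "r \<in> {0..t}" for r
  proof (rule has_field_derivative_transform_within[where d = 1 and f = "\<lambda>r. \<phi> 0 - (real n)\<^sup>2 * integral {0..r} \<phi>"])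
    show "((\<lambda>r. \<phi> 0 - (real n)\<^sup>2 * integral {0..r} \<phi>) has_real_derivative - (real n)\<^sup>2 * \<phi> r) (at r within {0..t})"
      using integral_has_real_derivative[OF \<phi>c r] by (auto intro!: derivative_eq_intros)
  qed (use r in \<open>auto intro!: eq[symmetric]\<close>)
  have "\<exists>c. \<forall>r\<in>{0..t}. exp ((real n)\<^sup>2 * r) * \<phi> r = c"
  proof (rule has_field_derivative_zero_constant)
    fix r assume "r \<in> {0..t}"
    from d[OF this] show "((\<lambda>r. exp ((real n)\<^sup>2 * r) * \<phi> r) has_real_derivative 0) (at r within {0..t})"
      by (auto intro!: derivative_eq_intros)
  qed simp
  then have "exp ((real n)\<^sup>2 * t) * \<phi> t = exp ((real n)\<^sup>2 * 0) * \<phi> 0" using t by force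
  moreover have "\<phi> 0 = f (cosH n)" using C0 by (simp add: \<phi>_def C0_semigroup_def)
  ultimately show ?thesis by (simp add: \<phi>_def exp_minus field_simps)
qed

lemma mild_solution_modes:
  assumes T: "neumann_heat_semigroup T" and u: "mild_solution T \<beta> u0 u"
  defines "y \<equiv> \<lambda>t. H1_fun (u t) pi"
  shows "continuous_on {0..} y"
    and "0 \<le> t \<Longrightarrow> ((\<lambda>t. mode (u t) n) has_real_derivative - (real n)\<^sup>2 * mode (u t) n - tanh (\<beta> * y t)) (at t within {0..})"
    and "mode (u 0) n = mode u0 n"
proof -
  have uc: "continuous_on {0..} u" and
    ueq: "\<And>t. 0 \<le> t \<Longrightarrow> H1_embed (u t) = T t (H1_embed u0)
          - integral {0..t} (\<lambda>\<tau>. tanh (\<beta> * y \<tau>) *\<^sub>R T (t - \<tau>) \<delta>\<^sub>0)"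
    using u by (auto simp: mild_solution_def y_def)
  show yc: "continuous_on {0..} y"
    unfolding y_def by (rule bounded_linear.continuous_on[OF bounded_linear_eval_pi uc])
  define g where "g t = tanh (\<beta> * y t)" for t
  have gc: "continuous_on {0..} g" unfolding g_def[abs_def]
    by (intro continuous_intros yc) (simp_all add: cosh_real_nonzero)
  have Tc: "continuous_on {0..} (\<lambda>t. T t f)" for f using T by (simp add: neumann_heat_semigroup_def C0_semigroup_def)
  define k where "k = (real n)\<^sup>2"
  have eq: "mode (u t) n = exp (- k * t) * (mode u0 n - integral {0..t} (\<lambda>\<tau>. g \<tau> * exp (k * \<tau>)))" if t: "0 \<le> t" for t
  proof -
    have c: "continuous_on {0..t} (\<lambda>\<tau>. g \<tau> *\<^sub>R T (t - \<tau>) \<delta>\<^sub>0)"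
      by (intro continuous_intros continuous_on_subset[OF gc] continuous_on_compose2[OF Tc]) auto
    have "(integral {0..t} (\<lambda>\<tau>. g \<tau> *\<^sub>R T (t - \<tau>) \<delta>\<^sub>0)) (cosH n)
       = integral {0..t} ((\<lambda>g. blinfun_apply g (cosH n)) \<circ> (\<lambda>\<tau>. g \<tau> *\<^sub>R T (t - \<tau>) \<delta>\<^sub>0))"
      by (rule integral_linear[symmetric, OF integrable_continuous_real[OF c] blinfun.bounded_linear_left])
    also have "\<dots> = integral {0..t} (\<lambda>\<tau>. exp (- k * t) * (g \<tau> * exp (k * \<tau>)))"
      by (intro integral_cong)
         (simp add: blinfun.scaleR_left heat_semigroup_mode[OF T] delta_cosH k_def right_diff_distrib exp_diff exp_minus field_simps)
    also have "\<dots> = exp (- k * t) * integral {0..t} (\<lambda>\<tau>. g \<tau> * exp (k * \<tau>))" by simp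
    finally have "(integral {0..t} (\<lambda>\<tau>. g \<tau> *\<^sub>R T (t - \<tau>) \<delta>\<^sub>0)) (cosH n) = exp (- k * t) * integral {0..t} (\<lambda>\<tau>. g \<tau> * exp (k * \<tau>))" .
    moreover have "mode (u t) n = (H1_embed (u t)) (cosH n)" by (simp add: H1_embed_cosH)
    ultimately show ?thesis
      unfolding ueq[OF t] g_def[symmetric]
      by (simp add: blinfun.diff_left heat_semigroup_mode[OF T t] H1_embed_cosH k_def right_diff_distrib)
  qed
  show "mode (u 0) n = mode u0 n" using eq[of 0] by simp
  assume t: "0 \<le> t"
  have hc: "continuous_on {0..t + 1} (\<lambda>\<tau>. g \<tau> * exp (k * \<tau>))"
    by (intro continuous_intros continuous_on_subset[OF gc]) auto
  have "((\<lambda>t. mode (u t) n) has_real_derivative - k * mode (u t) n - g t) (at t within {0..t + 1})"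
  proof (rule has_field_derivative_transform_within[where d = 1 and f = "\<lambda>t. exp (- k * t) * (mode u0 n - integral {0..t} (\<lambda>\<tau>. g \<tau> * exp (k * \<tau>)))"])
    have "((\<lambda>t. integral {0..t} (\<lambda>\<tau>. g \<tau> * exp (k * \<tau>))) has_real_derivative g t * exp (k * t)) (at t within {0..t + 1})"
      by (rule integral_has_real_derivative[OF hc]) (use t in auto)
    then show "((\<lambda>t. exp (- k * t) * (mode u0 n - integral {0..t} (\<lambda>\<tau>. g \<tau> * exp (k * \<tau>)))) has_real_derivative - k * mode (u t) n - g t) (at t within {0..t + 1})"
      unfolding eq[OF t] by (auto intro!: derivative_eq_intros simp: exp_minus field_simps)
  qed (use eq t in auto)
  moreover have "at t within {0..t + 1} = at t within {0..}"
    by (rule at_within_nhd[where S = "{..<t + 1}"]) auto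
  ultimately show "((\<lambda>t. mode (u t) n) has_real_derivative - (real n)\<^sup>2 * mode (u t) n - tanh (\<beta> * y t)) (at t within {0..})"
    by (simp add: k_def g_def)
qed

section \<open>Trigonometric approximation and Fourier multipliers on the circle\<close>

text \<open>The characters of the circle of length T.\<close>

definition circ :: "real \<Rightarrow> int \<Rightarrow> real \<Rightarrow> complex" where
  "circ T j t = cis (2 * pi * of_int j * t / T)"

definition fcoef :: "real \<Rightarrow> (real \<Rightarrow> real) \<Rightarrow> int \<Rightarrow> complex" where
  "fcoef T f j = integral {0..T} (\<lambda>t. of_real (f t) * circ T (- j) t)"

lemma continuous_on_circ [continuous_intros]: "continuous_on S (circ T j)"
  unfolding circ_def[abs_def] by (cases "T = 0") (auto intro!: continuous_intros)

lemma circ_mult: "circ T j t * circ T k t = circ T (j + k) t"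
  by (simp add: circ_def cis_mult add_divide_distrib algebra_simps)

lemma cnj_circ: "cnj (circ T j t) = circ T (- j) t"
  by (simp add: circ_def cis_cnj)

lemma integral_circ:
  assumes "0 < T"
  shows "integral {0..T} (circ T j) = (if j = 0 then of_real T else 0)"
proof (cases "j = 0")
  case True
  then have "circ T j = (\<lambda>t. 1)" by (simp add: circ_def fun_eq_iff)
  then show ?thesis using True assms by (simp add: scaleR_conv_of_real)
next
  case False
  define w where "w = 2 * pi * of_int j / T"
  have w: "w \<noteq> 0" using False assms by (simp add: w_def)
  have cw: "circ T j t = cis (w * t)" for t by (simp add: circ_def w_def)
  have "(circ T j has_integral (cis (w * T) / (\<i> * of_real w) - cis (w * 0) / (\<i> * of_real w))) {0..T}"
  proof (rule fundamental_theorem_of_calculus)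
    fix t
    have "((\<lambda>t. cis (w * t)) has_vector_derivative (w *\<^sub>R (\<i> * cis (w * t)))) (at t within {0..T})"
      by (auto intro!: derivative_eq_intros simp: has_vector_derivative_def scaleR_conv_of_real mult_ac)
    from has_vector_derivative_mult_left[OF this, of "1 / (\<i> * of_real w)"]
    show "((\<lambda>t. cis (w * t) / (\<i> * of_real w)) has_vector_derivative circ T j t) (at t within {0..T})"
      using w by (simp add: cw scaleR_conv_of_real)
  qed (use assms in simp)
  moreover have "cis (w * T) = 1"
    using assms by (simp add: w_def cis_conv_exp exp_eq_1 mult_ac)
  ultimately show ?thesis using False by (simp add: integral_unique)
qed

inductive trig_poly :: "real \<Rightarrow> (real \<Rightarrow> complex) \<Rightarrow> bool" for T where
  monom: "trig_poly T (\<lambda>t. c * circ T j t)"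
| add: "trig_poly T f \<Longrightarrow> trig_poly T g \<Longrightarrow> trig_poly T (\<lambda>t. f t + g t)"

lemma trig_poly_mult_circ: "trig_poly T f \<Longrightarrow> trig_poly T (\<lambda>t. f t * (c * circ T j t))"
proof (induction rule: trig_poly.induct)
  case (monom d k)
  have "d * circ T k t * (c * circ T j t) = (d * c) * circ T (k + j) t" for t
    by (simp add: circ_mult[symmetric])
  then show ?case by (simp only: trig_poly.intros)
qed (simp add: distrib_right trig_poly.add)

lemma trig_poly_mult: "trig_poly T g \<Longrightarrow> trig_poly T f \<Longrightarrow> trig_poly T (\<lambda>t. f t * g t)"
  by (induction rule: trig_poly.induct) (simp_all add: trig_poly_mult_circ distrib_left trig_poly.add)

lemma trig_poly_continuous: "trig_poly T f \<Longrightarrow> continuous_on S f"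
  by (induction rule: trig_poly.induct) (auto intro!: continuous_intros)

text \<open>A continuous function with equal values at 0 and T is a continuous function on the unit circle, where the
  Stone--Weierstrass theorem applies.\<close>

lemma trig_poly_dense:
  assumes T: "0 < T" and f: "continuous_on {0..T} f" "f 0 = f T" and e: "0 < e"
  obtains p where "trig_poly T p" "\<And>t. t \<in> {0..T} \<Longrightarrow> cmod (of_real (f t) - p t) < e"
proof -
  define F where "F = (\<lambda>s. f (T * s)) \<circ> (\<lambda>z. Arg2pi z / (2 * pi))"
  have "path (\<lambda>s. f (T * s))"
    unfolding path_def using T by (intro continuous_on_compose2[OF f(1)] continuous_intros) (auto intro: mult_left_le)
  then have "homotopic_loops UNIV (\<lambda>s. f (T * s)) (\<lambda>s. f (T * s))"
    using f(2) by (simp add: homotopic_loops_refl pathstart_def pathfinish_def)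
  from homotopic_with_imp_continuous[OF homotopic_loops_imp_homotopic_circlemaps[OF this]]
  have Fc: "continuous_on (sphere 0 1) F" by (simp add: F_def)
  have Fcis: "F (cis (2 * pi * t / T)) = f t" if t: "t \<in> {0..T}" for t
  proof (cases "t = T")
    case True
    then show ?thesis using T f(2) using Arg2pi_of_real[of 1] by (simp add: F_def)
  next
    case False
    then have "0 \<le> 2 * pi * t / T" "2 * pi * t / T < 2 * pi" using t T by (auto simp: field_simps)
    then have "Arg2pi (cis (2 * pi * t / T)) = 2 * pi * t / T"
      by (intro Arg2pi_unique[of 1]) (auto simp: cis_conv_exp)
    then show ?thesis using T by (simp add: F_def)
  qed
  define P where "P G \<longleftrightarrow> continuous_on (sphere 0 1) G \<and> (\<exists>p. trig_poly T p \<and> (\<forall>t. of_real (G (cis (2 * pi * t / T))) = p t))" for G :: "complex \<Rightarrow> real"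
  have c1: "of_real (cos (2 * pi * t / T)) = (1/2) * circ T 1 t + (1/2) * circ T (-1) t" for t
    by (simp add: circ_def complex_eq_iff)
  have s1: "of_real (sin (2 * pi * t / T)) = (- \<i> /2) * circ T 1 t + (\<i> / 2) * circ T (-1) t" for t
    by (simp add: circ_def complex_eq_iff)
  have "\<exists>g. P g \<and> (\<forall>x\<in>sphere 0 1. \<bar>F x - g x\<bar> < e)"
  proof (rule Stone_Weierstrass_HOL[where P = P])
    fix c :: real show "P (\<lambda>x. c)"
      unfolding P_def using monom[of T "of_real c" 0]
      by (auto simp: circ_def intro!: exI[of _ "\<lambda>t. of_real c"])
  next
    fix G H assume "P G \<and> P H"
    then show "P (\<lambda>x. G x + H x)" "P (\<lambda>x. G x * H x)"
      unfolding P_def by (auto intro!: continuous_intros) 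
        (metis (no_types, lifting) trig_poly.add, metis (no_types, lifting) trig_poly_mult)
  next
    fix x y :: complex assume "x \<in> sphere 0 1 \<and> y \<in> sphere 0 1 \<and> x \<noteq> y"
    then have "Re x \<noteq> Re y \<or> Im x \<noteq> Im y" by (auto simp: complex_eq_iff)
    moreover have "P Re"
      unfolding P_def using trig_poly.add[OF monom[of T "1/2" 1] monom[of T "1/2" "-1"]]
      by (auto intro!: continuous_intros exI simp: c1)
    moreover have "P Im"
      unfolding P_def using trig_poly.add[OF monom[of T "- \<i> / 2" 1] monom[of T "\<i> / 2" "-1"]]
      by (auto intro!: continuous_intros exI simp: s1)
    ultimately show "\<exists>f. P f \<and> f x \<noteq> f y" by blast
  qed (use Fc e in \<open>auto simp: P_def\<close>)
  then obtain g p where g: "\<And>x. x \<in> sphere 0 1 \<Longrightarrow> \<bar>F x - g x\<bar> < e" and p: "trig_poly T p"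
    "\<And>t. of_real (g (cis (2 * pi * t / T))) = p t" unfolding P_def by blast
  show ?thesis
  proof (rule that[OF p(1)])
    fix t assume t: "t \<in> {0..T}"
    have "cmod (of_real (f t) - p t) = \<bar>F (cis (2 * pi * t / T)) - g (cis (2 * pi * t / T))\<bar>"
      unfolding p(2)[symmetric] Fcis[OF t] by (metis norm_of_real of_real_diff)
    also have "\<dots> < e" by (rule g) simp
    finally show "cmod (of_real (f t) - p t) < e" .
  qed
qed

lemma trig_poly_orthogonal:
  assumes "trig_poly T p"
  shows "\<exists>N. \<forall>r. continuous_on {0..T} r \<longrightarrow> (\<forall>k. \<bar>k\<bar> \<le> int N \<longrightarrow> integral {0..T} (\<lambda>t. r t * circ T k t) = 0)
    \<longrightarrow> integral {0..T} (\<lambda>t. r t * p t) = 0"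
  using assms
proof (induction rule: trig_poly.induct)
  case (monom c j)
  have "integral {0..T} (\<lambda>t. r t * (c * circ T j t)) = c * integral {0..T} (\<lambda>t. r t * circ T j t)" for r
    by (subst integral_mult_right[symmetric]) (simp add: mult_ac)
  then show ?case by (intro exI[of _ "nat \<bar>j\<bar>"]) auto
next
  case (add f g)
  then obtain N M where NM: 
   "\<And>r. continuous_on {0..T} r \<Longrightarrow> (\<forall>k. \<bar>k\<bar> \<le> int N \<longrightarrow> integral {0..T} (\<lambda>t. r t * circ T k t) = 0)
    \<Longrightarrow> integral {0..T} (\<lambda>t. r t * f t) = 0"
   "\<And>r. continuous_on {0..T} r \<Longrightarrow> (\<forall>k. \<bar>k\<bar> \<le> int M \<longrightarrow> integral {0..T} (\<lambda>t. r t * circ T k t) = 0)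
    \<Longrightarrow> integral {0..T} (\<lambda>t. r t * g t) = 0" by blast
  have "integral {0..T} (\<lambda>t. r t * (f t + g t)) = integral {0..T} (\<lambda>t. r t * f t) + integral {0..T} (\<lambda>t. r t * g t)"
    if "continuous_on {0..T} r" for r :: "real \<Rightarrow> complex"
    unfolding distrib_left
    by (intro integral_add integrable_continuous_real continuous_intros that trig_poly_continuous[OF add(1)] trig_poly_continuous[OF add(2)])
  with NM show ?case by (intro exI[of _ "max N M"]) auto
qed

lemma fcoef_uminus: "fcoef T f (- j) = cnj (fcoef T f j)"
  unfolding fcoef_def integral_cnj by (simp add: cnj_circ)

text \<open>If X arises from g by a Fourier multiplier whose real part is at most \<open>\<kappa>\<close>, Parseval's identity bounds
  \<open>\<integral> g X\<close> by \<open>\<kappa> \<integral> g\<^sup>2\<close>. To avoid convergence of Fourier series, g is split into a partial sum S and a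
  rest R: the rest sees only the uniform approximation error of X, and the partial sum obeys Bessel's
  inequality, which is where \<open>\<kappa> \<ge> 0\<close> enters.\<close>

lemma multiplier_bound:
  assumes T: "0 < T" and g: "continuous_on {0..T} g" and X: "continuous_on {0..T} X" "X 0 = X T"
    and \<mu>: "\<And>j. fcoef T X j = \<mu> j * fcoef T g j" "\<And>j. Re (\<mu> j) \<le> \<kappa>" and \<kappa>: "0 \<le> \<kappa>"
  shows "integral {0..T} (\<lambda>t. g t * X t) \<le> \<kappa> * integral {0..T} (\<lambda>t. (g t)\<^sup>2)"
proof -
  define E where "E = integral {0..T} (\<lambda>t. (g t)\<^sup>2)"
  note ci = integrable_continuous_real continuous_intros
  have gc: "continuous_on {0..T} (\<lambda>t. complex_of_real (g t))" and Xc: "continuous_on {0..T} (\<lambda>t. complex_of_real (X t))"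
    by (intro continuous_intros g X)+
  have ofr: "integral {0..T} (\<lambda>t. complex_of_real (f t)) = of_real (integral {0..T} f)" if "continuous_on {0..T} f" for f
    using integral_linear[OF integrable_continuous_real[OF that] bounded_linear_of_real] by (simp add: o_def)
  have main: "integral {0..T} (\<lambda>t. g t * X t) \<le> \<kappa> * E + e * ((T + E) / 2)" if e: "0 < e" for e
  proof -
    obtain p where p: "trig_poly T p" "\<And>t. t \<in> {0..T} \<Longrightarrow> cmod (of_real (X t) - p t) < e"
      using trig_poly_dense[OF T X e] by blast
    note pc = trig_poly_continuous[OF p(1)]
    obtain N where N: "\<And>r. continuous_on {0..T} r \<Longrightarrow> (\<And>k. \<bar>k\<bar> \<le> int N \<Longrightarrow> integral {0..T} (\<lambda>t. r t * circ T k t) = 0)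
    \<Longrightarrow> integral {0..T} (\<lambda>t. r t * p t) = 0"
      using trig_poly_orthogonal[OF p(1)] by blast
    define J where "J = {- int N..int N}"
    define S where "S t = (\<Sum>j\<in>J. (fcoef T g j / of_real T) * circ T j t)" for t
    define R where "R t = of_real (g t) - S t" for t
    have Sc: "continuous_on {0..T} S" unfolding S_def[abs_def] by (intro continuous_intros)
    have Rc: "continuous_on {0..T} R" unfolding R_def[abs_def] by (intro continuous_intros gc Sc)
    have Sint: "integral {0..T} (\<lambda>t. S t * r t) = (\<Sum>j\<in>J. (fcoef T g j / of_real T) * integral {0..T} (\<lambda>t. circ T j t * r t))"
      if r: "continuous_on {0..T} r" for r
    proof -
      have "integral {0..T} (\<lambda>t. S t * r t) = integral {0..T} (\<lambda>t. \<Sum>j\<in>J. (fcoef T g j / of_real T) * (circ T j t * r t))"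
        by (simp add: S_def sum_distrib_right mult.assoc)
      also have "\<dots> = (\<Sum>j\<in>J. integral {0..T} (\<lambda>t. (fcoef T g j / of_real T) * (circ T j t * r t)))"
        by (intro integral_sum ci r) (simp add: J_def)
      finally show ?thesis by simp
    qed
    have circ0: "integral {0..T} (\<lambda>t. circ T j t * circ T k t) = (if j = - k then of_real T else 0)" for j k
      unfolding circ_mult using integral_circ[OF T, of "j + k"] by auto
    have Rorth: "integral {0..T} (\<lambda>t. R t * circ T k t) = 0" if "\<bar>k\<bar> \<le> int N" for k
    proof -
      have "integral {0..T} (\<lambda>t. R t * circ T k t) = integral {0..T} (\<lambda>t. of_real (g t) * circ T k t) - integral {0..T} (\<lambda>t. S t * circ T k t)"
        unfolding R_def left_diff_distrib by (intro integral_diff ci gc Sc)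
      also have "integral {0..T} (\<lambda>t. S t * circ T k t) = (\<Sum>j\<in>J. if j = - k then fcoef T g j else 0)"
        unfolding Sint[OF continuous_on_circ] circ0 using T by (intro sum.cong refl) auto
      also have "\<dots> = fcoef T g (- k)" using that by (simp add: J_def) (use that in auto)
      finally show ?thesis by (simp add: fcoef_def)
    qed
    define B where "B = (\<Sum>j\<in>J. (cmod (fcoef T g j))\<^sup>2) / T"
    have SgB: "integral {0..T} (\<lambda>t. S t * of_real (g t)) = of_real B"
    proof -
      have "integral {0..T} (\<lambda>t. circ T j t * of_real (g t)) = cnj (fcoef T g j)" for j
        unfolding fcoef_uminus[symmetric] by (simp add: fcoef_def mult.commute)
      then show ?thesis
        unfolding Sint[OF gc] B_def by (simp add: complex_norm_square[unfolded of_real_power] sum_divide_distrib)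
    qed
    have RcnjS: "integral {0..T} (\<lambda>t. R t * cnj (S t)) = 0"
    proof -
      have "integral {0..T} (\<lambda>t. R t * cnj (S t)) = integral {0..T} (\<lambda>t. \<Sum>j\<in>J. cnj (fcoef T g j / of_real T) * (R t * circ T (- j) t))"
        by (simp add: S_def sum_distrib_left cnj_circ mult_ac)
      also have "\<dots> = (\<Sum>j\<in>J. integral {0..T} (\<lambda>t. cnj (fcoef T g j / of_real T) * (R t * circ T (- j) t)))"
        by (intro integral_sum ci Rc) (simp add: J_def)
      also have "\<dots> = 0"
        by (intro sum.neutral ballI) (auto simp: J_def intro!: Rorth)
      finally show ?thesis .
    qed
    have RR: "integral {0..T} (\<lambda>t. (cmod (R t))\<^sup>2) = E - B"
    proof -
      have "complex_of_real (integral {0..T} (\<lambda>t. (cmod (R t))\<^sup>2)) = integral {0..T} (\<lambda>t. of_real ((cmod (R t))\<^sup>2))"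
        by (intro ofr[symmetric] continuous_intros Rc)
      also have "\<dots> = integral {0..T} (\<lambda>t. (of_real ((g t)\<^sup>2) - S t * of_real (g t)) - R t * cnj (S t))"
      proof (rule integral_cong)
        fix t
        have "complex_of_real ((cmod (R t))\<^sup>2) = R t * cnj (R t)" by (rule complex_norm_square)
        also have "cnj (R t) = of_real (g t) - cnj (S t)" by (simp add: R_def)
        finally show "complex_of_real ((cmod (R t))\<^sup>2) = (of_real ((g t)\<^sup>2) - S t * of_real (g t)) - R t * cnj (S t)"
          by (simp add: R_def power2_eq_square algebra_simps)
      qed
      also have "\<dots> = (integral {0..T} (\<lambda>t. of_real ((g t)\<^sup>2)) - integral {0..T} (\<lambda>t. S t * of_real (g t))) - integral {0..T} (\<lambda>t. R t * cnj (S t))"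
        by (subst integral_diff, (intro ci gc Sc Rc g)+, subst integral_diff, (intro ci gc Sc Rc g)+, rule refl)
      also have "\<dots> = of_real (E - B)"
        by (simp only: RcnjS SgB E_def of_real_diff) (subst ofr, (intro continuous_intros g)+, simp)
      finally show ?thesis using of_real_eq_iff by blast
    qed
    have BE: "B \<le> E"
      using RR integral_nonneg[of "\<lambda>t. (cmod (R t))\<^sup>2" "{0..T}"] by (simp add: integrable_continuous_real Rc continuous_intros)
    have SX: "Re (integral {0..T} (\<lambda>t. S t * of_real (X t))) \<le> \<kappa> * B"
    proof -
      have "integral {0..T} (\<lambda>t. circ T j t * of_real (X t)) = cnj (fcoef T X j)" for j
        unfolding fcoef_uminus[symmetric] by (simp add: fcoef_def mult.commute)
      then have "integral {0..T} (\<lambda>t. S t * of_real (X t)) = (\<Sum>j\<in>J. cnj (\<mu> j) * of_real ((cmod (fcoef T g j))\<^sup>2 / T))"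
        unfolding Sint[OF Xc] by (intro sum.cong refl) (simp add: \<mu>(1) complex_norm_square[unfolded of_real_power])
      then have "Re (integral {0..T} (\<lambda>t. S t * of_real (X t))) = (\<Sum>j\<in>J. Re (\<mu> j) * ((cmod (fcoef T g j))\<^sup>2 / T))"
        by simp
      also have "\<dots> \<le> (\<Sum>j\<in>J. \<kappa> * ((cmod (fcoef T g j))\<^sup>2 / T))"
        using T by (intro sum_mono mult_right_mono \<mu>) auto
      finally show ?thesis by (simp add: B_def sum_distrib_left sum_divide_distrib)
    qed
    have RX: "cmod (integral {0..T} (\<lambda>t. R t * of_real (X t))) \<le> e * ((T + E) / 2)"
    proof -
      have "integral {0..T} (\<lambda>t. R t * of_real (X t)) = integral {0..T} (\<lambda>t. R t * (of_real (X t) - p t) + R t * p t)"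
        by (simp add: algebra_simps)
      also have "\<dots> = integral {0..T} (\<lambda>t. R t * (of_real (X t) - p t)) + integral {0..T} (\<lambda>t. R t * p t)"
        by (intro integral_add ci Rc Xc pc)
      also have "integral {0..T} (\<lambda>t. R t * p t) = 0"
        by (rule N[OF Rc Rorth])
      finally have "cmod (integral {0..T} (\<lambda>t. R t * of_real (X t))) = cmod (integral {0..T} (\<lambda>t. R t * (of_real (X t) - p t)))"
        by simp
      also have "\<dots> \<le> integral {0..T} (\<lambda>t. e * ((1 + (cmod (R t))\<^sup>2) / 2))"
      proof (rule integral_norm_bound_integral)
        fix t assume t: "t \<in> {0..T}"
        have "0 \<le> (1 - cmod (R t))\<^sup>2" by simp
        then have "cmod (R t) \<le> (1 + (cmod (R t))\<^sup>2) / 2" by (simp add: power2_eq_square algebra_simps)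
        then have "cmod (R t) * cmod (of_real (X t) - p t) \<le> (1 + (cmod (R t))\<^sup>2) / 2 * e"
          using p(2)[OF t] by (intro mult_mono) auto
        then show "cmod (R t * (of_real (X t) - p t)) \<le> e * ((1 + (cmod (R t))\<^sup>2) / 2)"
          by (simp add: norm_mult mult.commute)
      qed (auto intro!: integrable_continuous_real continuous_intros Rc Xc pc)
      also have "\<dots> = e * ((integral {0..T} (\<lambda>t. 1) + integral {0..T} (\<lambda>t. (cmod (R t))\<^sup>2)) / 2)"
        by (simp only: integral_mult_right integral_divide) (subst integral_add, (intro ci Rc)+, rule refl)
      also have "\<dots> = e * ((T + (E - B)) / 2)" using T by (simp add: RR)
      also have "\<dots> \<le> e * ((T + E) / 2)"
      proof -
        have "0 \<le> B" unfolding B_def using T by (intro divide_nonneg_pos sum_nonneg) auto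
        then show ?thesis using e by (intro mult_left_mono) auto
      qed
      finally show ?thesis .
    qed
    have "of_real (integral {0..T} (\<lambda>t. g t * X t)) = integral {0..T} (\<lambda>t. complex_of_real (g t * X t))"
      by (intro ofr[symmetric] continuous_intros g X)
    also have "\<dots> = integral {0..T} (\<lambda>t. S t * of_real (X t) + R t * of_real (X t))"
      by (simp add: R_def algebra_simps)
    also have "\<dots> = integral {0..T} (\<lambda>t. S t * of_real (X t)) + integral {0..T} (\<lambda>t. R t * of_real (X t))"
      by (intro integral_add ci Rc Sc Xc)
    finally have "integral {0..T} (\<lambda>t. g t * X t) = Re (integral {0..T} (\<lambda>t. S t * of_real (X t))) + Re (integral {0..T} (\<lambda>t. R t * of_real (X t)))"
      by (metis Re_complex_of_real plus_complex.simps(1))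
    also have "\<dots> \<le> \<kappa> * B + e * ((T + E) / 2)"
      using SX RX complex_Re_le_cmod[of "integral {0..T} (\<lambda>t. R t * of_real (X t))"] by linarith
    also have "\<dots> \<le> \<kappa> * E + e * ((T + E) / 2)"
      using BE \<kappa> by (simp add: mult_left_mono)
    finally show ?thesis .
  qed
  have E0: "0 \<le> E" unfolding E_def by (intro integral_nonneg ci g) simp
  have "integral {0..T} (\<lambda>t. g t * X t) \<le> \<kappa> * E + d" if "0 < d" for d
  proof -
    have "0 < d / ((T + E) / 2)" using that T E0 by simp
    from main[OF this] show ?thesis using T E0 by simp
  qed
  then show ?thesis unfolding E_def by (rule field_le_epsilon)
qed

section \<open>Fourier coefficients of periodic solutions\<close>

definition freq :: "real \<Rightarrow> int \<Rightarrow> real" where "freq T j = 2 * pi * of_int j / T"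

lemma fcoef_add:
  assumes "continuous_on {0..T} f" "continuous_on {0..T} g"
  shows "fcoef T (\<lambda>t. f t + g t) j = fcoef T f j + fcoef T g j"
  unfolding fcoef_def of_real_add distrib_right
  by (intro integral_add integrable_continuous_real continuous_intros assms)

lemma fcoef_diff:
  assumes "continuous_on {0..T} f" "continuous_on {0..T} g"
  shows "fcoef T (\<lambda>t. f t - g t) j = fcoef T f j - fcoef T g j"
  unfolding fcoef_def of_real_diff left_diff_distrib
  by (intro integral_diff integrable_continuous_real continuous_intros assms)

lemma fcoef_scale: "fcoef T (\<lambda>t. c * f t) j = of_real c * fcoef T f j"
  unfolding fcoef_def of_real_mult mult.assoc by (rule integral_mult_right)

lemma fcoef_const: "0 < T \<Longrightarrow> fcoef T (\<lambda>t. c) j = (if j = 0 then of_real (c * T) else 0)"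
  unfolding fcoef_def by (simp add: integral_circ)

lemma fcoef_zero:
  assumes "continuous_on {0..T} f" shows "fcoef T f 0 = of_real (integral {0..T} f)"
proof -
  have "circ T 0 t = 1" for t by (simp add: circ_def)
  then show ?thesis
    using integral_linear[OF integrable_continuous_real[OF assms] bounded_linear_of_real[where 'a = complex]]
    by (simp add: fcoef_def o_def)
qed

lemma circ_freq: "circ T j t = exp (\<i> * of_real (freq T j * t))"
  by (simp add: circ_def freq_def cis_conv_exp)

lemma circ_deriv: "((\<lambda>t. circ T j t) has_vector_derivative (\<i> * of_real (freq T j) * circ T j t)) (at t within S)"
proof -
  have "((\<lambda>z. exp (\<i> * of_real (freq T j) * z)) has_field_derivative (\<i> * of_real (freq T j) * exp (\<i> * of_real (freq T j) * of_real t))) (at (of_real t))"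
    by (auto intro!: derivative_eq_intros)
  from has_vector_derivative_real_field[OF this, of S]
  show ?thesis by (simp add: circ_freq mult.assoc)
qed

lemma circ_0: "circ T j 0 = 1" by (simp add: circ_def)
lemma circ_T: "T \<noteq> 0 \<Longrightarrow> circ T j T = 1" by (simp add: circ_def cis_conv_exp exp_eq_1 mult_ac)

lemma circ_add: "circ T j (s + t) = circ T j s * circ T j t"
  by (simp add: circ_def cis_mult add_divide_distrib distrib_left)

text \<open>For a periodic solution of \<open>p' = - k p - G\<close> the boundary term of the integration by parts vanishes.\<close>

lemma fcoef_periodic_ode:
  assumes T: "0 < T" and p: "\<And>t. t \<in> {0..T} \<Longrightarrow> (p has_real_derivative - k * p t - G t) (at t within {0..T})"
    and per: "p T = p 0" and G: "continuous_on {0..T} G"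
  shows "(of_real k + \<i> * of_real (freq T j)) * fcoef T p j = - fcoef T G j"
proof -
  have pc: "continuous_on {0..T} p" using p by (rule DERIV_continuous_on)
  let ?e = "circ T (- j)" and ?w = "freq T j"
  have fm: "freq T (- j) = - ?w" by (simp add: freq_def)
  have "((\<lambda>t. of_real (- k * p t - G t) * ?e t - \<i> * of_real ?w * (of_real (p t) * ?e t)) has_integral (of_real (p T) * ?e T - of_real (p 0) * ?e 0)) {0..T}"
  proof (rule fundamental_theorem_of_calculus)
    fix t assume t: "t \<in> {0..T}"
    from has_vector_derivative_mult[OF has_vector_derivative_of_real[OF p[OF t]] circ_deriv[of T "- j" t "{0..T}"]]
    show "((\<lambda>t. of_real (p t) * ?e t) has_vector_derivative (of_real (- k * p t - G t) * ?e t - \<i> * of_real ?w * (of_real (p t) * ?e t))) (at t within {0..T})"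
      by (simp add: fm algebra_simps)
  qed (use T in simp)
  then have "integral {0..T} (\<lambda>t. of_real (- k * p t - G t) * ?e t - \<i> * of_real ?w * (of_real (p t) * ?e t)) = 0"
    using per T by (simp add: integral_unique circ_0 circ_T)
  also have "integral {0..T} (\<lambda>t. of_real (- k * p t - G t) * ?e t - \<i> * of_real ?w * (of_real (p t) * ?e t))
     = fcoef T (\<lambda>t. - k * p t - G t) j - \<i> * of_real ?w * fcoef T p j"
    unfolding fcoef_def integral_mult_right[symmetric]
    by (intro integral_diff integrable_continuous_real continuous_intros pc G)
  also have "fcoef T (\<lambda>t. - k * p t - G t) j = - of_real k * fcoef T p j - fcoef T G j"
    using fcoef_diff[of T "\<lambda>t. - k * p t" G j] fcoef_scale[of T "- k" p j] pc G by (simp add: continuous_intros)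
  finally show ?thesis by algebra
qed

lemma fcoef_series:
  assumes f: "\<And>n. continuous_on {0..T} (f n)" and M: "\<And>n t. t \<in> {0..T} \<Longrightarrow> \<bar>f n t\<bar> \<le> M n" "summable M"
  shows "(\<lambda>n. fcoef T (f n) j) sums fcoef T (\<lambda>t. \<Sum>n. f n t) j"
    and "continuous_on {0..T} (\<lambda>t. \<Sum>n. f n t)"
proof -
  have ul: "uniform_limit {0..T} (\<lambda>n t. \<Sum>i<n. f i t) (\<lambda>t. \<Sum>n. f n t) sequentially"
    by (rule Weierstrass_m_test) (use M in auto)
  show c: "continuous_on {0..T} (\<lambda>t. \<Sum>n. f n t)"
    by (rule uniform_limit_theorem[OF _ ul]) (auto intro!: always_eventually continuous_on_sum f)
  have ul2: "uniform_limit {0..T} (\<lambda>n t. complex_of_real (\<Sum>i<n. f i t) * circ T (- j) t) (\<lambda>t. of_real (\<Sum>n. f n t) * circ T (- j) t) sequentially"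
    by (intro uniform_lim_mult bounded_linear.uniform_limit[OF bounded_linear_of_real ul]
        uniform_limit_const compact_imp_bounded compact_continuous_image continuous_intros c) auto
  obtain I J where IJ: "\<And>n. ((\<lambda>t. complex_of_real (\<Sum>i<n. f i t) * circ T (- j) t) has_integral I n) {0..T}"
    "((\<lambda>t. of_real (\<Sum>n. f n t) * circ T (- j) t) has_integral J) {0..T}" "I \<longlonglongrightarrow> J"
    by (rule uniform_limit_integral[OF ul2]) (auto intro!: continuous_intros f)
  have "I = (\<lambda>n. \<Sum>i<n. fcoef T (f i) j)"
  proof
    fix n
    have "I n = integral {0..T} (\<lambda>t. \<Sum>i<n. of_real (f i t) * circ T (- j) t)"
      using integral_unique[OF IJ(1)[of n]] by (simp add: sum_distrib_right)
    also have "\<dots> = (\<Sum>i<n. fcoef T (f i) j)"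
      unfolding fcoef_def by (intro integral_sum integrable_continuous_real continuous_intros f) auto
    finally show "I n = (\<Sum>i<n. fcoef T (f i) j)" .
  qed
  moreover have "J = fcoef T (\<lambda>t. \<Sum>n. f n t) j"
    using integral_unique[OF IJ(2)] by (simp add: fcoef_def)
  ultimately show "(\<lambda>n. fcoef T (f n) j) sums fcoef T (\<lambda>t. \<Sum>n. f n t) j"
    using IJ(3) by (simp add: sums_def)
qed

text \<open>Translation by h on the circle of length T, for functions given on one period.\<close>

definition pshift :: "real \<Rightarrow> real \<Rightarrow> (real \<Rightarrow> real) \<Rightarrow> real \<Rightarrow> real" where
  "pshift T h f t = (if t \<le> h then f (t - h + T) else f (t - h))"

lemma continuous_on_pshift:
  assumes h: "0 < h" "h < T" and f: "continuous_on {0..T} f" "f T = f 0"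
  shows "continuous_on {0..T} (pshift T h f)"
  unfolding pshift_def[abs_def]
  by (rule continuous_on_cases_le) (use h f in \<open>auto intro!: continuous_intros continuous_on_compose2[OF f(1)]\<close>)

lemma fcoef_pshift:
  assumes h: "0 < h" "h < T" and f: "continuous_on {0..T} f" "f T = f 0"
  shows "fcoef T (pshift T h f) j = circ T (- j) h * fcoef T f j"
proof -
  let ?e = "circ T (- j)"
  define F where "F s = of_real (f s) * ?e s" for s
  have Fc: "continuous_on {0..T} F" unfolding F_def[abs_def] by (intro continuous_intros f)
  have Fi: "F integrable_on {a..b}" if "0 \<le> a" "b \<le> T" for a b
    by (rule integrable_continuous_real[OF continuous_on_subset[OF Fc]]) (use that in auto)
  have pc: "continuous_on {0..T} (\<lambda>t. of_real (pshift T h f t) * ?e t)"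
    by (intro continuous_intros continuous_on_pshift h f)
  have eT: "?e (t + T) = ?e t" for t using h by (simp add: circ_add circ_T)
  have "fcoef T (pshift T h f) j = integral {0..h} (\<lambda>t. of_real (pshift T h f t) * ?e t) + integral {h..T} (\<lambda>t. of_real (pshift T h f t) * ?e t)"
    unfolding fcoef_def
    by (rule Henstock_Kurzweil_Integration.integral_combine[symmetric]) (use h in \<open>auto intro: integrable_continuous_real[OF pc]\<close>)
  also have "integral {0..h} (\<lambda>t. of_real (pshift T h f t) * ?e t) = integral {0..h} ((\<lambda>s. ?e h * F s) \<circ> (+) (T - h))"
  proof (rule integral_cong)
    fix t assume "t \<in> {0..h}"
    then have "pshift T h f t = f (T - h + t)" by (simp add: pshift_def algebra_simps)
    moreover have "?e t = ?e h * ?e (T - h + t)" using eT[of t] by (simp add: circ_add[symmetric] algebra_simps)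
    ultimately show "of_real (pshift T h f t) * ?e t = ((\<lambda>s. ?e h * F s) \<circ> (+) (T - h)) t"
      by (simp add: F_def)
  qed
  also have "\<dots> = integral {T - h..T} (\<lambda>s. ?e h * F s)" by (subst integral_shift_Icc_real) simp
  also have "\<dots> = ?e h * integral {T - h..T} F" by simp
  also have "integral {h..T} (\<lambda>t. of_real (pshift T h f t) * ?e t) = integral {h..T} ((\<lambda>s. ?e h * F s) \<circ> (+) (- h))"
  proof (rule integral_cong)
    fix t assume t: "t \<in> {h..T}"
    then have "pshift T h f t = f (- h + t)" using f(2) by (auto simp: pshift_def algebra_simps)
    moreover have "?e t = ?e h * ?e (- h + t)" by (simp add: circ_add[symmetric])
    ultimately show "of_real (pshift T h f t) * ?e t = ((\<lambda>s. ?e h * F s) \<circ> (+) (- h)) t"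
      by (simp add: F_def)
  qed
  also have "\<dots> = integral {0..T - h} (\<lambda>s. ?e h * F s)" by (subst integral_shift_Icc_real) simp
  also have "\<dots> = ?e h * integral {0..T - h} F" by simp
  also have "?e h * integral {T - h..T} F + ?e h * integral {0..T - h} F = ?e h * integral {0..T} F"
    using Henstock_Kurzweil_Integration.integral_combine[of 0 "T - h" T F] h Fi by (simp add: distrib_left[symmetric] add.commute)
  finally show ?thesis by (simp add: fcoef_def F_def[abs_def])
qed

section \<open>The transfer function as a cosine series\<close>

text \<open>The reciprocal of the transfer function at \<open>s = i \<omega>\<close>, namely \<open>\<surd>s sinh (\<pi> \<surd>s)\<close> with
  \<open>\<surd>s = (1 + i) \<surd>(\<omega> / 2)\<close>.\<close>

definition symH :: "real \<Rightarrow> complex" where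
  "symH \<omega> = (1 + \<i>) * of_real (sqrt (\<omega> / 2)) * sinh ((1 + \<i>) * of_real (sqrt (\<omega> / 2)) * of_real pi)"

text \<open>The function \<open>v(x) = cosh (\<surd>s (\<pi> - x))\<close> satisfies \<open>v'' = s v\<close>, \<open>v'(\<pi>) = 0\<close> and \<open>- v'(0) = symH \<omega>\<close>, so its cosine
  coefficients are \<open>symH \<omega> / (n\<^sup>2 + s)\<close>. The claim is its cosine series at \<open>x = \<pi>\<close>, where \<open>v = 1\<close>.\<close>

lemma kernel_expansion:
  assumes \<omega>: "0 < \<omega>"
  shows symH_nonzero: "symH \<omega> \<noteq> 0"
    and "(\<lambda>n. of_real (wt n * (-1) ^ n) / (of_real ((real n)\<^sup>2) + \<i> * of_real \<omega>)) sums (1 / symH \<omega>)"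
proof -
  define z where "z = (1 + \<i>) * of_real (sqrt (\<omega> / 2))"
  have z2: "z\<^sup>2 = \<i> * of_real \<omega>"
  proof -
    have "z\<^sup>2 = (1 + \<i>)\<^sup>2 * of_real ((sqrt (\<omega> / 2))\<^sup>2)" by (simp add: z_def power_mult_distrib)
    also have "\<dots> = \<i> * of_real \<omega>" using \<omega> by (simp add: power2_eq_square algebra_simps)
    finally show ?thesis .
  qed
  have H: "symH \<omega> = z * sinh (z * of_real pi)" by (simp add: symH_def z_def)
  define v where "v x = cosh (z * (of_real pi - of_real x))" for x :: real
  define s where "s n = of_real ((real n)\<^sup>2) + \<i> * of_real \<omega>" for n
  have s0: "s n \<noteq> 0" for n using \<omega> by (simp add: s_def complex_eq_iff)
  have vc: "continuous_on S v" for S unfolding v_def[abs_def] cosh_def by (intro continuous_intros)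
  have I: "((\<lambda>x. v x * of_real (cosn n x)) has_integral (symH \<omega> / s n)) {0..pi}" for n
  proof -
    define F where "F x = (- z * sinh (z * (of_real pi - x)) * cos (of_nat n * x) + of_nat n * cosh (z * (of_real pi - x)) * sin (of_nat n * x)) / s n" for x
    have FD: "(F has_field_derivative (cosh (z * (of_real pi - x)) * cos (of_nat n * x))) (at x)" for x
      unfolding F_def
      by (rule derivative_eq_intros refl s0 | simp)+
         (use s0[of n] in \<open>simp add: field_simps s_def z2[symmetric] power2_eq_square\<close>)
    have "((\<lambda>x. v x * of_real (cosn n x)) has_integral (F (of_real pi) - F (of_real 0))) {0..pi}"
    proof (rule fundamental_theorem_of_calculus)
      fix x
      have "((\<lambda>x. F (of_real x)) has_vector_derivative (cosh (z * (of_real pi - of_real x)) * cos (of_nat n * of_real x))) (at x within {0..pi})"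
        by (rule has_vector_derivative_real_field[OF FD])
      moreover have "of_real (cosn n x) = cos (of_nat n * of_real x :: complex)"
        by (simp add: cosn_def cos_of_real[symmetric] del: cos_of_real)
      ultimately show "((\<lambda>x. F (of_real x)) has_vector_derivative v x * of_real (cosn n x)) (at x within {0..pi})"
        by (simp add: v_def)
    qed simp
    moreover have "sin (of_nat n * of_real pi :: complex) = 0"
      using sin_of_real[of "real n * pi", where 'a = complex] by simp
    ultimately show ?thesis by (simp add: F_def H)
  qed
  have ReI: "ip (\<lambda>x. Re (v x)) (cosn n) = Re (symH \<omega> / s n)" and ImI: "ip (\<lambda>x. Im (v x)) (cosn n) = Im (symH \<omega> / s n)" for n
    using has_integral_linear[OF I bounded_linear_Re, of n] has_integral_linear[OF I bounded_linear_Im, of n]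
    by (subst ip_continuous; auto intro!: continuous_intros vc integral_unique simp: o_def)+
  have sinv: "cmod (1 / s n) \<le> 1 / (real n)\<^sup>2" if "1 \<le> n" for n
  proof -
    have "(real n)\<^sup>2 \<le> cmod (s n)" using complex_Re_le_cmod[of "s n"] by (simp add: s_def)
    then show ?thesis using that by (simp add: norm_divide frac_le)
  qed
  have sq: "summable (\<lambda>n. cmod (symH \<omega>) * (1 / (real n)\<^sup>2))"
    using inverse_power_summable[of 2, where 'a = real] by (intro summable_mult) (simp add: divide_inverse)
  have sb: "summable (\<lambda>n. cmod (symH \<omega> / s n))"
  proof (rule summable_comparison_test'[OF sq])
    fix n :: nat assume "1 \<le> n"
    from mult_left_mono[OF sinv[OF this], of "cmod (symH \<omega>)"]
    show "norm (cmod (symH \<omega> / s n)) \<le> cmod (symH \<omega>) * (1 / (real n)\<^sup>2)" by (simp add: norm_divide)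
  qed
  have cp: "cosn n pi = (-1) ^ n" for n by (simp add: cosn_def mult.commute)
  have "(\<lambda>n. wt n * Re (symH \<omega> / s n) * cosn n pi) sums Re (v pi)"
    unfolding ReI[symmetric]
    by (rule cosine_series_sums) (auto intro!: continuous_intros vc summable_comparison_test'[OF sb] simp: ReI abs_Re_le_cmod simp del: Re_divide)
  moreover have "(\<lambda>n. wt n * Im (symH \<omega> / s n) * cosn n pi) sums Im (v pi)"
    unfolding ImI[symmetric]
    by (rule cosine_series_sums) (auto intro!: continuous_intros vc summable_comparison_test'[OF sb] simp: ImI abs_Im_le_cmod simp del: Im_divide)
  moreover have ofr: "Re (complex_of_real r * c) = r * Re c" "Im (complex_of_real r * c) = r * Im c" for r c
    by simp_all
  ultimately have "(\<lambda>n. of_real (wt n * (-1) ^ n) * (symH \<omega> / s n)) sums v pi"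
    unfolding sums_complex_iff cp ofr by (simp only: mult_ac)
  then have *: "(\<lambda>n. of_real (wt n * (-1) ^ n) * (symH \<omega> / s n)) sums 1" by (simp add: v_def)
  then show "symH \<omega> \<noteq> 0" by (auto dest: sums_unique)
  with sums_divide[OF *, of "symH \<omega>"]
  show "(\<lambda>n. of_real (wt n * (-1) ^ n) / (of_real ((real n)\<^sup>2) + \<i> * of_real \<omega>)) sums (1 / symH \<omega>)"
    by (simp add: s_def)
qed

section \<open>Power series of the characteristic function\<close>

text \<open>With \<open>a = \<pi> \<surd>(\<omega> / 2)\<close>, these are \<open>\<pi>\<close> times the real and imaginary part of \<open>symH \<omega>\<close>.\<close>

definition reH :: "real \<Rightarrow> real" where "reH a = a * (sinh a * cos a - cosh a * sin a)"
definition imH :: "real \<Rightarrow> real" where "imH a = a * (sinh a * cos a + cosh a * sin a)"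

lemma sinh_Complex: "sinh (Complex x y) = Complex (sinh x * cos y) (cosh x * sin y)"
  by (simp add: complex_eq_iff sinh_def cosh_def Re_exp Im_exp field_simps)

lemma symH_eq: "symH \<omega> = Complex (reH (pi * sqrt (\<omega> / 2))) (imH (pi * sqrt (\<omega> / 2))) / of_real pi"
proof -
  let ?a = "pi * sqrt (\<omega> / 2)"
  have e: "(1 + \<i>) * of_real (sqrt (\<omega> / 2)) * of_real pi = Complex ?a ?a"
    by (simp add: complex_eq_iff)
  have "reH ?a / pi = sqrt (\<omega> / 2) * (sinh ?a * cos ?a - cosh ?a * sin ?a)"
    "imH ?a / pi = sqrt (\<omega> / 2) * (sinh ?a * cos ?a + cosh ?a * sin ?a)"
    by (simp_all add: reH_def imH_def)
  then show ?thesis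
    unfolding symH_def e sinh_Complex
    by (simp add: complex_eq_iff algebra_simps)
qed

text \<open>With \<open>z = (1 + i) a\<close> one has \<open>z\<^sup>2 = 2 i a\<^sup>2\<close>, so the even powers in \<open>z sinh z\<close> are powers of an imaginary number
  and separate into real and imaginary part.\<close>

lemma symH_series: "(\<lambda>k. (\<i> * of_real (2 * a\<^sup>2)) ^ (k + 1) / fact (2 * k + 1)) sums Complex (reH a) (imH a)"
proof -
  define z where "z = Complex a a"
  have "(\<lambda>n. z * (if even n then 0 else z ^ n /\<^sub>R fact n)) sums (z * sinh z)"
    by (intro sums_mult sinh_converges)
  also have "z * sinh z = Complex (reH a) (imH a)"
    by (simp add: z_def sinh_Complex complex_eq_iff reH_def imH_def algebra_simps)
  finally have "(\<lambda>k. z * (if even (2 * k + 1) then 0 else z ^ (2 * k + 1) /\<^sub>R fact (2 * k + 1))) sums Complex (reH a) (imH a)"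
    by (subst sums_mono_reindex[of "\<lambda>k. 2 * k + 1"]) (auto simp: strict_mono_def elim!: oddE)
  moreover have "z * z = \<i> * of_real (2 * a\<^sup>2)"
    by (simp add: z_def complex_eq_iff power2_eq_square)
  then have "z * (if even (2 * k + 1) then 0 else z ^ (2 * k + 1) /\<^sub>R fact (2 * k + 1)) = (\<i> * of_real (2 * a\<^sup>2)) ^ (k + 1) / fact (2 * k + 1)" for k
  proof -
    have "z * z ^ (2 * k + 1) = (z * z) ^ (k + 1)"
      by (simp add: power_mult power_mult_distrib power_add[symmetric] mult_2 flip: power_Suc)
    with \<open>z * z = _\<close> show ?thesis by (simp add: scaleR_conv_of_real divide_inverse mult_ac)
  qed
  ultimately show ?thesis by simp
qed

lemma reH_series: "(\<lambda>m. (-1) ^ (m + 1) * (2 * a\<^sup>2) ^ (2 * m + 2) / fact (4 * m + 3)) sums reH a"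
  and imH_series: "(\<lambda>m. (-1) ^ m * (2 * a\<^sup>2) ^ (2 * m + 1) / fact (4 * m + 1)) sums imH a"
proof -
  define w where "w = 2 * a\<^sup>2"
  have t: "(\<i> * complex_of_real w) ^ (k + 1) / fact (2 * k + 1) = \<i> ^ (k + 1) * of_real (w ^ (k + 1) / fact (2 * k + 1))" for k
    by (simp add: power_mult_distrib)
  have s: "(\<lambda>k. \<i> ^ (k + 1) * of_real (w ^ (k + 1) / fact (2 * k + 1))) sums Complex (reH a) (imH a)"
    using symH_series[of a] unfolding w_def[symmetric] t .
  have ie: "\<i> ^ (2 * m) = (-1) ^ m" for m by (simp add: power_mult)
  have R: "Re (\<i> ^ (k + 1) * of_real r) = (if even k then 0 else (-1) ^ ((k + 1) div 2) * r)" for k r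
  proof (cases "even k")
    case True
    then obtain m where "k = 2 * m" by (auto elim: evenE)
    then show ?thesis using ie[of m] by (simp add: mult_ac)
  next
    case False
    then obtain m where k: "k = 2 * m + 1" by (auto elim: oddE)
    then have "\<i> ^ (k + 1) = (-1) ^ (m + 1)" using ie[of "m + 1"] by simp
    also have "\<dots> = of_real ((-1) ^ (m + 1))" by simp
    finally show ?thesis using k by (simp del: of_real_power)
  qed
  have J: "Im (\<i> ^ (k + 1) * of_real r) = (if even k then (-1) ^ (k div 2) * r else 0)" for k r
  proof (cases "even k")
    case True
    then obtain m where k: "k = 2 * m" by (auto elim: evenE)
    then have "\<i> ^ (k + 1) = \<i> * (-1) ^ m" using ie[of m] by simp
    also have "\<dots> = \<i> * of_real ((-1) ^ m)" by simp
    finally show ?thesis using k by (simp del: of_real_power)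
  next
    case False
    then obtain m where k: "k = 2 * m + 1" by (auto elim: oddE)
    then have "\<i> ^ (k + 1) = (-1) ^ (m + 1)" using ie[of "m + 1"] by simp
    also have "\<dots> = of_real ((-1) ^ (m + 1))" by simp
    finally show ?thesis using k by (simp del: of_real_power)
  qed
  have "(\<lambda>k. if even k then 0 else (-1) ^ ((k + 1) div 2) * (w ^ (k + 1) / fact (2 * k + 1))) sums reH a"
    using s[THEN sums_Re] unfolding R by simp
  then have "(\<lambda>m. if even (2 * m + 1) then 0 else (-1) ^ ((2 * m + 1 + 1) div 2) * (w ^ (2 * m + 1 + 1) / fact (2 * (2 * m + 1) + 1))) sums reH a"
    by (subst sums_mono_reindex[of "\<lambda>m. 2 * m + 1"]) (auto simp: strict_mono_def elim!: oddE)
  moreover have "2 * (2 * m + 1) + 1 = 4 * m + 3" "2 * m + 1 + 1 = 2 * m + 2" "(2 * m + 2) div 2 = m + 1" "odd (2 * m + 1)" for m :: nat by simp_all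
  ultimately show "(\<lambda>m. (-1) ^ (m + 1) * (2 * a\<^sup>2) ^ (2 * m + 2) / fact (4 * m + 3)) sums reH a"
    unfolding w_def[symmetric] by (simp only: if_False times_divide_eq_right not_False_eq_True not_True_eq_False)
  have "(\<lambda>k. if even k then (-1) ^ (k div 2) * (w ^ (k + 1) / fact (2 * k + 1)) else 0) sums imH a"
    using s[THEN sums_Im] unfolding J by simp
  then have "(\<lambda>m. if even (2 * m) then (-1) ^ ((2 * m) div 2) * (w ^ (2 * m + 1) / fact (2 * (2 * m) + 1)) else 0) sums imH a"
    by (subst sums_mono_reindex[of "\<lambda>m. 2 * m"]) (auto simp: strict_mono_def elim!: evenE)
  moreover have "2 * (2 * m) + 1 = 4 * m + 1" for m :: nat by simp
  ultimately show "(\<lambda>m. (-1) ^ m * (2 * a\<^sup>2) ^ (2 * m + 1) / fact (4 * m + 1)) sums imH a"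
    unfolding w_def[symmetric] by (simp del: fact_Suc)
qed

lemma reH_imH_square: "(reH a)\<^sup>2 + (imH a)\<^sup>2 = a\<^sup>2 * (cosh (2 * a) - cos (2 * a))"
proof -
  have "(reH a)\<^sup>2 + (imH a)\<^sup>2 = a\<^sup>2 * (2 * ((sinh a)\<^sup>2 * (cos a)\<^sup>2 + (cosh a)\<^sup>2 * (sin a)\<^sup>2))"
    by (simp add: reH_def imH_def power2_eq_square algebra_simps)
  also have "2 * ((sinh a)\<^sup>2 * (cos a)\<^sup>2 + (cosh a)\<^sup>2 * (sin a)\<^sup>2) = cosh (2 * a) - cos (2 * a)"
  proof -
    have "(cos a)\<^sup>2 = 1 - (sin a)\<^sup>2" by (simp add: cos_squared_eq)
    moreover have "(cosh a)\<^sup>2 = (sinh a)\<^sup>2 + 1" by (simp add: cosh_square_eq)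
    ultimately show ?thesis
      by (simp add: cosh_double cos_double) (simp add: algebra_simps)
  qed
  finally show ?thesis .
qed

lemma absH_series: "(\<lambda>m. (2 * a\<^sup>2) * (2 * (2 * a\<^sup>2)) ^ (2 * m + 1) / fact (4 * m + 2)) sums ((reH a)\<^sup>2 + (imH a)\<^sup>2)"
proof -
  have "(\<lambda>n. (if even n then (2 * a) ^ n /\<^sub>R fact n else 0) - cos_coeff n *\<^sub>R (2 * a) ^ n) sums (cosh (2 * a) - cos (2 * a))"
    by (intro sums_diff cosh_converges cos_converges)
  then have "(\<lambda>n. a\<^sup>2 * ((if even n then (2 * a) ^ n /\<^sub>R fact n else 0) - cos_coeff n *\<^sub>R (2 * a) ^ n)) sums ((reH a)\<^sup>2 + (imH a)\<^sup>2)"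
    unfolding reH_imH_square by (rule sums_mult)
  then have "(\<lambda>m. a\<^sup>2 * ((if even (4 * m + 2) then (2 * a) ^ (4 * m + 2) /\<^sub>R fact (4 * m + 2) else 0) - cos_coeff (4 * m + 2) *\<^sub>R (2 * a) ^ (4 * m + 2)))
     sums ((reH a)\<^sup>2 + (imH a)\<^sup>2)"
  proof (subst sums_mono_reindex[of "\<lambda>m. 4 * m + 2"])
    fix n :: nat assume n: "n \<notin> range (\<lambda>m. 4 * m + 2)"
    show "a\<^sup>2 * ((if even n then (2 * a) ^ n /\<^sub>R fact n else 0) - cos_coeff n *\<^sub>R (2 * a) ^ n) = 0"
    proof (cases "even n")
      case True
      have "even (n div 2)"
      proof (rule ccontr)
        assume "odd (n div 2)"
        then obtain m where "n div 2 = 2 * m + 1" by (auto elim: oddE)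
        then have "n = 4 * m + 2" using True by (auto elim!: evenE)
        with n show False by auto
      qed
      then show ?thesis using True by (simp add: cos_coeff_def divide_inverse)
    qed (simp add: cos_coeff_def)
  qed (auto simp: strict_mono_def)
  moreover have "a\<^sup>2 * ((if even (4 * m + 2) then (2 * a) ^ (4 * m + 2) /\<^sub>R fact (4 * m + 2) else 0) - cos_coeff (4 * m + 2) *\<^sub>R (2 * a) ^ (4 * m + 2))
     = (2 * a\<^sup>2) * (2 * (2 * a\<^sup>2)) ^ (2 * m + 1) / fact (4 * m + 2)" for m
  proof -
    have "(2 * a) ^ (4 * m + 2) = ((2 * a)\<^sup>2) ^ (2 * m + 1)" by (simp only: power_mult[symmetric]) (simp add: algebra_simps)
    also have "(2 * a)\<^sup>2 = 2 * (2 * a\<^sup>2)" by (simp add: power2_eq_square)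
    finally have "(2 * a) ^ (4 * m + 2) = (2 * (2 * a\<^sup>2)) ^ (2 * m + 1)" .
    moreover have "cos_coeff (4 * m + 2) = - 1 / fact (4 * m + 2)"
    proof -
      have "(4 * m + 2) div 2 = 2 * m + 1" by simp
      then show ?thesis unfolding cos_coeff_def by (simp del: fact_Suc)
    qed
    ultimately show ?thesis by (simp add: divide_inverse del: fact_Suc power_Suc) 
  qed
  ultimately show ?thesis by (simp del: fact_Suc power_Suc)
qed

section \<open>The first crossing frequency\<close>

lemma imH_reH_deriv:
  "((\<lambda>a. sinh a * cos a + cosh a * sin a) has_real_derivative 2 * cosh a * cos a) (at a)"
  "(imH has_real_derivative (sinh a * cos a + cosh a * sin a) + a * (2 * cosh a * cos a)) (at a)"
  "(reH has_real_derivative (sinh a * cos a - cosh a * sin a) - a * (2 * sinh a * sin a)) (at a)"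
  unfolding imH_def reH_def by (auto intro!: derivative_eq_intros simp: algebra_simps)

lemma char_fun_eq:
  assumes "0 < \<omega>"
  shows "char_fun \<omega> = Complex (- reH (pi * sqrt (\<omega> / 2))) (imH (pi * sqrt (\<omega> / 2))) / of_real pi"
proof -
  let ?b = "sqrt (\<omega> / 2)"
  have c: "csqrt (\<i> * of_real \<omega>) = Complex ?b ?b"
  proof (rule csqrt_unique)
    show "(Complex ?b ?b)\<^sup>2 = \<i> * of_real \<omega>"
      using assms by (simp add: complex_eq_iff power2_eq_square)
  qed (use assms in simp)
  let ?a = "pi * ?b"
  have e: "Complex ?b ?b * of_real pi = Complex ?a ?a" by (simp add: complex_eq_iff)
  have r: "reH ?a / pi = ?b * (sinh ?a * cos ?a - cosh ?a * sin ?a)"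
    "imH ?a / pi = ?b * (sinh ?a * cos ?a + cosh ?a * sin ?a)"
    by (simp_all add: reH_def imH_def)
  have sC: "sin (Complex x y) = Complex (sin x * cosh y) (cos x * sinh y)" for x y
    by (simp add: complex_eq_iff Re_sin Im_sin cosh_def sinh_def field_simps)
  from r show ?thesis
    unfolding char_fun_def c e sC by (simp add: complex_eq_iff algebra_simps)
qed

lemma cos_neg_second_quadrant: "pi / 2 < x \<Longrightarrow> x \<le> pi \<Longrightarrow> cos x < 0"
  using cos_gt_zero_pi[of "pi - x"] by simp

text \<open>The number \<open>a\<^sub>0\<close> is the first positive zero of \<open>sinh a cos a + cosh a sin a\<close>: this function is positive up to
  \<open>\<pi> / 2\<close>, decreasing from there to \<open>\<pi>\<close>, positive at \<open>3 \<pi> / 4\<close> and negative at \<open>\<pi>\<close>. Therefore the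
  least element that defines \<open>\<omega>\<^sub>0\<close> exists and equals \<open>2 a\<^sub>0\<^sup>2 / \<pi>\<^sup>2\<close>.\<close>

lemma first_crossing:
  obtains a\<^sub>0 where "3 * pi / 4 < a\<^sub>0" "a\<^sub>0 < pi" "sinh a\<^sub>0 * cos a\<^sub>0 + cosh a\<^sub>0 * sin a\<^sub>0 = 0" "\<beta>\<^sub>0 = - reH a\<^sub>0 / pi"
proof -
  define f where "f a = sinh a * cos a + cosh a * sin a" for a :: real
  have fd: "(f has_real_derivative 2 * cosh a * cos a) (at a)" for a
    using imH_reH_deriv(1) by (simp add: f_def[abs_def])
  have cs: "cos (3 * pi / 4) = - sqrt 2 / 2" "sin (3 * pi / 4) = sqrt 2 / 2"
  proof -
    have "3 * pi / 4 = pi - pi / 4" by simp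
    then show "cos (3 * pi / 4) = - sqrt 2 / 2" "sin (3 * pi / 4) = sqrt 2 / 2"
      by (simp_all only: cos_pi_minus sin_pi_minus cos_45 sin_45)
  qed
  have "f (3 * pi / 4) = sqrt 2 / 2 * (cosh (3 * pi / 4) - sinh (3 * pi / 4))"
    unfolding f_def cs by (simp only: algebra_simps)
  moreover have "0 < sqrt 2 / 2 * (cosh (3 * pi / 4) - sinh (3 * pi / 4))" by (simp add: cosh_minus_sinh)
  ultimately have f1: "0 < f (3 * pi / 4)" by (simp only:)
  have f2: "f pi < 0" by (simp add: f_def)
  have "\<exists>x. 3 * pi / 4 \<le> x \<and> x \<le> pi \<and> f x = 0"
  proof (rule IVT2')
    show "continuous_on {3 * pi / 4..pi} f"
      by (rule DERIV_continuous_on, rule has_field_derivative_at_within, rule fd)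
  qed (use f1 f2 in simp_all)
  then obtain x where x: "3 * pi / 4 \<le> x" "x \<le> pi" "f x = 0" by blast
  moreover have "x \<noteq> 3 * pi / 4" "x \<noteq> pi" using x(3) f1 f2 by (metis less_irrefl)+
  ultimately obtain a0 where a0: "3 * pi / 4 < a0" "a0 < pi" "f a0 = 0"
    by force
  have pos: "0 < f a" if a: "0 < a" "a < a0" for a
  proof (cases "a \<le> pi / 2")
    case True
    then have "0 \<le> cos a" "0 < sin a" using a by (auto intro!: cos_ge_zero sin_gt_zero)
    then show ?thesis using a by (auto simp: f_def intro!: add_nonneg_pos mult_pos_pos)
  next
    case False
    have "f a0 < f a"
    proof (rule DERIV_neg_imp_decreasing[OF a(2)])
      fix x assume "a \<le> x" "x \<le> a0"
      then have "cos x < 0" using False a0 by (intro cos_neg_second_quadrant) auto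
      then show "\<exists>y. (f has_real_derivative y) (at x) \<and> y < 0"
        by (intro exI[of _ "2 * cosh x * cos x"] conjI fd) (auto simp: mult_pos_neg)
    qed
    then show ?thesis using a0 by simp
  qed
  have iH: "imH a = a * f a" for a by (simp add: imH_def f_def)
  define w where "w = 2 * (a0 / pi)\<^sup>2"
  have a0p: "0 < a0" using a0(1) pi_gt_zero by linarith
  then have w: "0 < w" by (simp add: w_def)
  have wa: "pi * sqrt (w / 2) = a0" using a0p by (simp add: w_def)
  have s0: "0 < sin a0" using a0 a0p by (intro sin_gt_zero)
  have "sinh a0 * cos a0 = - (cosh a0 * sin a0)" using a0(3) by (simp add: f_def)
  then have r: "reH a0 = - (2 * a0 * cosh a0 * sin a0)" by (simp add: reH_def)
  then have rneg: "reH a0 < 0" using a0p s0 by simp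
  have cw: "char_fun w = of_real (- reH a0 / pi)"
    unfolding char_fun_eq[OF w] wa by (simp add: complex_eq_iff iH a0)
  have "\<omega>\<^sub>0 = w"
    unfolding \<omega>\<^sub>0_def
  proof (rule Least_equality)
    show "0 < w \<and> char_fun w \<in> of_real ` {0<..}"
      using w rneg unfolding cw by (intro conjI imageI) (auto simp: divide_neg_pos)
  next
    fix y assume y: "0 < y \<and> char_fun y \<in> of_real ` {0<..}"
    let ?a = "pi * sqrt (y / 2)"
    have ap: "0 < ?a" using y by simp
    have "Im (char_fun y) = 0" using y by auto
    then have "imH ?a = 0" using y by (simp add: char_fun_eq)
    then have "f ?a = 0" using y by (simp add: iH) 
    then have "a0 \<le> ?a" using pos[OF ap] by force
    then have "a0 / pi \<le> sqrt (y / 2)" by (simp add: field_simps)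
    then have "(a0 / pi)\<^sup>2 \<le> (sqrt (y / 2))\<^sup>2" using a0p by (intro power_mono) auto
    then show "w \<le> y" using y by (simp add: w_def)
  qed
  then have "char_fun \<omega>\<^sub>0 = of_real (- reH a0 / pi)" using cw by (rule ssubst)
  then have "\<beta>\<^sub>0 = - reH a0 / pi" unfolding \<beta>\<^sub>0_def by (simp only: Re_complex_of_real)
  with a0 show ?thesis using that by (auto simp: f_def)
qed

lemma sums_ge_term:
  fixes f :: "nat \<Rightarrow> real"
  assumes "f sums s" "\<And>m. 0 \<le> f m" shows "f m \<le> s"
  using sum_le_suminf[of f "{m}"] assms by (simp add: sums_iff)

text \<open>One term of the series of \<open>\<bar>symH \<omega>\<bar>\<^sup>2\<close>, all of whose terms are nonnegative. This controls the second order error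
  when the multiplier \<open>i \<omega>\<close> is replaced by a difference quotient.\<close>

lemma symH_lower_bound:
  assumes \<omega>: "0 < \<omega>"
  shows "\<omega>\<^sup>2 \<le> cmod (symH \<omega>)"
proof -
  let ?a = "pi * sqrt (\<omega> / 2)"
  define w where "w = 2 * ?a\<^sup>2"
  have w: "w = pi\<^sup>2 * \<omega>" using \<omega> by (simp add: w_def power_mult_distrib)
  have w0: "0 \<le> w" by (simp add: w_def)
  have "(\<lambda>m. w * (2 * w) ^ (2 * m + 1) / fact (4 * m + 2)) sums ((reH ?a)\<^sup>2 + (imH ?a)\<^sup>2)"
    using absH_series[of ?a] unfolding w_def .
  then have "w * (2 * w) ^ (2 * 1 + 1) / fact (4 * 1 + 2) \<le> (reH ?a)\<^sup>2 + (imH ?a)\<^sup>2"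
    by (rule sums_ge_term) (use w0 in auto)
  then have 1: "w ^ 4 / 90 \<le> (reH ?a)\<^sup>2 + (imH ?a)\<^sup>2"
    by (simp add: fact_numeral power_mult_distrib eval_nat_numeral)
  have "pi\<^sup>2 * (cmod (symH \<omega>))\<^sup>2 = (reH ?a)\<^sup>2 + (imH ?a)\<^sup>2"
    unfolding symH_eq by (simp add: norm_divide power_divide cmod_power2)
  with 1 have 2: "pi ^ 8 * \<omega> ^ 4 / 90 \<le> pi\<^sup>2 * (cmod (symH \<omega>))\<^sup>2"
    unfolding w by (simp add: power_mult_distrib flip: power_mult)
  have "90 * pi\<^sup>2 * \<omega> ^ 4 \<le> pi ^ 8 * \<omega> ^ 4"
  proof (rule mult_right_mono)
    have "(90::real) \<le> 3 ^ 6" by simp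
    also have "\<dots> \<le> pi ^ 6" using pi_gt3 by (intro power_mono) auto
    finally have "90 * pi\<^sup>2 \<le> pi ^ 6 * pi\<^sup>2" by (rule mult_right_mono) simp
    then show "90 * pi\<^sup>2 \<le> pi ^ 8" by (simp flip: power_add)
  qed (use \<omega> in simp)
  with 2 have "pi\<^sup>2 * \<omega> ^ 4 \<le> pi\<^sup>2 * (cmod (symH \<omega>))\<^sup>2" by linarith
  then have "(\<omega>\<^sup>2)\<^sup>2 \<le> (cmod (symH \<omega>))\<^sup>2" by (simp flip: power_mult)
  then show ?thesis by (rule power2_le_imp_le) simp
qed

lemma power_tangent:
  fixes v v0 :: real
  assumes "0 \<le> v" "0 \<le> v0"
  shows "v0 ^ m + real m * v0 ^ (m - 1) * (v - v0) \<le> v ^ m"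
proof (induction m)
  case (Suc m)
  have "v * (v0 ^ m + real m * v0 ^ (m - 1) * (v - v0)) \<le> v * v ^ m"
    using Suc assms by (intro mult_left_mono)
  moreover have "v * (v0 ^ m + real m * v0 ^ (m - 1) * (v - v0)) - (v0 ^ Suc m + real (Suc m) * v0 ^ (Suc m - 1) * (v - v0))
     = real m * v0 ^ (m - 1) * (v - v0)\<^sup>2"
    by (cases m) (simp_all add: power2_eq_square algebra_simps)
  moreover have "0 \<le> real m * v0 ^ (m - 1) * (v - v0)\<^sup>2" using assms by simp
  ultimately show ?case by simp
qed simp

text \<open>With nonnegative coefficients from degree two on, the series is convex on the positive axis, so its graph
  lies above the tangent at \<open>v0\<close>, which is the axis itself.\<close>

lemma power_series_double_zero_nonneg:
  fixes c :: "nat \<Rightarrow> real"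
  assumes summ: "\<And>v. summable (\<lambda>m. c m * v ^ m)"
    and c: "\<And>m. 2 \<le> m \<Longrightarrow> 0 \<le> c m" and v0: "0 \<le> v0"
    and G0: "(\<Sum>m. c m * v0 ^ m) = 0" and G1: "((\<lambda>v. \<Sum>m. c m * v ^ m) has_real_derivative 0) (at v0)"
    and v: "0 \<le> v"
  shows "0 \<le> (\<Sum>m. c m * v ^ m)"
proof -
  have "((\<lambda>v. \<Sum>m. c m * v ^ m) has_real_derivative (\<Sum>m. diffs c m * v0 ^ m)) (at v0)"
    by (rule termdiffs_strong_converges_everywhere[OF summ])
  then have D: "(\<Sum>m. diffs c m * v0 ^ m) = 0" using G1 by (rule DERIV_unique)
  have "summable (\<lambda>m. diffs c m * v0 ^ m)"
    by (rule termdiff_converges_all[OF summ])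
  from diffs_equiv[OF this] have "(\<lambda>m. real m * c m * v0 ^ (m - Suc 0)) sums 0" by (simp add: D)
  from sums_mult2[OF this, of "v - v0"]
  have ss: "(\<lambda>m. c m * v ^ m - c m * v0 ^ m - real m * c m * v0 ^ (m - Suc 0) * (v - v0)) sums ((\<Sum>m. c m * v ^ m) - 0 - 0)"
    using summable_sums[OF summ, of v0] unfolding G0
    by (intro sums_diff summable_sums summ) simp_all
  have nn: "0 \<le> c m * v ^ m - c m * v0 ^ m - real m * c m * v0 ^ (m - Suc 0) * (v - v0)" for m
  proof (cases "2 \<le> m")
    case True
    from mult_left_mono[OF power_tangent[OF v v0, of m] c[OF True]] show ?thesis by (simp add: algebra_simps)
  next
    case False
    then have "m = 0 \<or> m = 1" by auto
    then show ?thesis by (auto simp: algebra_simps)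
  qed
  have "0 \<le> (\<Sum>m. c m * v ^ m) - 0 - 0" by (rule sums_le[OF _ sums_zero ss]) (rule nn)
  then show ?thesis by simp
qed

section \<open>The Popov frequency inequality\<close>

lemma summable_if_sums_nonneg_arguments:
  fixes c :: "nat \<Rightarrow> real"
  assumes "\<And>v. 0 \<le> v \<Longrightarrow> summable (\<lambda>m. c m * v ^ m)"
  shows "summable (\<lambda>m. c m * v ^ m)"
  by (rule powser_inside[OF assms[of "\<bar>v\<bar> + 1"]]) auto

text \<open>For odd m only the middle term is negative, and the last one, which grows like \<open>4\<^sup>m\<close>, dominates it as
  soon as \<open>m \<ge> 3\<close>, provided that \<open>q b\<close> is at most \<open>9 \<pi>\<close>. For even m only the first term is negative, and for \<open>b \<le> 20\<close> the
  last one dominates it.\<close>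

lemma popov_coefficient_sign:
  fixes q b :: real
  assumes b: "0 < b" "b \<le> 20" and q: "0 < q" and qb: "q * b \<le> 9 * pi" and m: "2 \<le> m"
  shows "0 \<le> pi * (-1) ^ (m + 1) / fact (4 * m + 3) + (q / pi) * (-1) ^ m / fact (4 * m + 1)
     + 2 ^ (2 * m + 1) / (b * fact (4 * m + 2))"
proof -
  define N where "N = pi * (-1) ^ (m + 1) + (q / pi) * (-1) ^ m * (real (4 * m + 3) * real (4 * m + 2)) + 2 ^ (2 * m + 1) / b * real (4 * m + 3)"
  have f2: "fact (4 * m + 3) = real (4 * m + 3) * fact (4 * m + 2)" 
    using fact_Suc[of "4 * m + 2", where 'a = real] by (simp add: numeral_3_eq_3 del: fact_Suc)
  have f1: "fact (4 * m + 2) = real (4 * m + 2) * fact (4 * m + 1)"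
    using fact_Suc[of "4 * m + 1", where 'a = real] by (simp add: add.commute del: fact_Suc)
  have "pi * (-1) ^ (m + 1) / fact (4 * m + 3) + (q / pi) * (-1) ^ m / fact (4 * m + 1)
     + 2 ^ (2 * m + 1) / (b * fact (4 * m + 2)) = N / fact (4 * m + 3)"
  proof -
    have x: "(q / pi) * (-1) ^ m / fact (4 * m + 1) = (q / pi) * (-1) ^ m * (real (4 * m + 3) * real (4 * m + 2)) / fact (4 * m + 3)"
      unfolding f2 f1 by (simp del: fact_Suc of_nat_add of_nat_mult)
    have y: "2 ^ (2 * m + 1) / (b * fact (4 * m + 2)) = 2 ^ (2 * m + 1) / b * real (4 * m + 3) / fact (4 * m + 3)"
      unfolding f2 by (simp del: fact_Suc of_nat_add of_nat_mult)
    show ?thesis by (simp only: x y N_def add_divide_distrib)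
  qed
  moreover have "0 \<le> N"
  proof (cases "even m")
    case True
    have "32 * 11 / 20 \<le> 2 ^ (2 * m + 1) / b * real (4 * m + 3)"
    proof -
      have "(2::real) ^ 5 \<le> 2 ^ (2 * m + 1)" using m by (intro power_increasing) auto
      then have "32 / 20 \<le> 2 ^ (2 * m + 1) / b" using b by (intro frac_le) auto
      then have "32 / 20 * 11 \<le> 2 ^ (2 * m + 1) / b * real (4 * m + 3)"
        using m by (intro mult_mono) auto
      then show ?thesis by simp
    qed
    moreover have "0 \<le> (q / pi) * (real (4 * m + 3) * real (4 * m + 2))" using q by simp
    ultimately show ?thesis using True pi_less_4 by (simp add: N_def)
  next
    case False
    then obtain k where k: "m = 2 * k + 1" by (auto elim: oddE)
    with m have k1: "1 \<le> k" by simp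
    have "9 * (4 * real m + 2) \<le> 2 ^ (2 * m + 1)"
    proof -
      have "9 * (8 * real k + 6) \<le> 8 * 16 ^ k"
        using k1
      proof (induction k rule: dec_induct)
        case (step n)
        have "(16::real) * 1 \<le> 16 * 16 ^ n" by (intro mult_left_mono) auto
        with step show ?case by simp
      qed simp
      moreover have "(2::real) ^ (2 * m + 1) = 8 * 16 ^ k"
      proof -
        have "2 * m + 1 = 3 + 4 * k" by (simp add: k)
        then show ?thesis by (simp add: power_add power_mult)
      qed
      ultimately show ?thesis by (simp add: k)
    qed
    moreover have "(q / pi) * b \<le> 9" using qb pi_gt_zero by (simp add: field_simps)
    ultimately have "(q / pi) * b * (4 * real m + 2) \<le> 2 ^ (2 * m + 1)"
      using mult_right_mono[of "(q / pi) * b" 9 "4 * real m + 2"] by linarith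
    then have "(q / pi) * (4 * real m + 2) \<le> 2 ^ (2 * m + 1) / b"
      using b by (simp add: field_simps)
    then have "(q / pi) * (4 * real m + 2) * (4 * real m + 3) \<le> 2 ^ (2 * m + 1) / b * (4 * real m + 3)"
      by (rule mult_right_mono) simp
    moreover have "N = pi - (q / pi) * (4 * real m + 2) * (4 * real m + 3) + 2 ^ (2 * m + 1) / b * (4 * real m + 3)"
      using False by (simp add: N_def mult.commute)
    ultimately show ?thesis using pi_gt_zero by linarith
  qed
  ultimately show ?thesis by simp
qed

text \<open>The left-hand side is \<open>\<pi>\<^sup>2\<close> times the Popov expression \<open>Re H + q \<omega> Im H + \<bar>H\<bar>\<^sup>2 / b\<close> for \<open>H = symH \<omega>\<close> and
  \<open>a = \<pi> \<surd>(\<omega> / 2)\<close>; as a series in a it contains only powers of \<open>a\<^sup>4\<close>.\<close>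

lemma popov_series:
  fixes q b :: real
  assumes b: "b \<noteq> 0"
  defines "c \<equiv> \<lambda>m. pi * (-1) ^ (m + 1) / fact (4 * m + 3) + (q / pi) * (-1) ^ m / fact (4 * m + 1)
     + 2 ^ (2 * m + 1) / (b * fact (4 * m + 2))"
  shows "summable (\<lambda>m. c m * v ^ m)"
    and "pi * reH a + (q / pi) * (2 * a\<^sup>2) * imH a + ((reH a)\<^sup>2 + (imH a)\<^sup>2) / b = 4 * a ^ 4 * (\<Sum>m. c m * (4 * a ^ 4) ^ m)"
proof -
  have s: "(\<lambda>m. 4 * a ^ 4 * (c m * (4 * a ^ 4) ^ m)) sums (pi * reH a + (q / pi) * (2 * a\<^sup>2) * imH a + ((reH a)\<^sup>2 + (imH a)\<^sup>2) / b)" for a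
  proof -
    define w where "w = 2 * a\<^sup>2"
    have v: "4 * a ^ 4 = w\<^sup>2" by (simp add: w_def power_mult_distrib flip: power_mult)
    have "(\<lambda>m. pi * ((-1) ^ (m + 1) * w ^ (2 * m + 2) / fact (4 * m + 3))
        + (q / pi) * w * ((-1) ^ m * w ^ (2 * m + 1) / fact (4 * m + 1))
        + (w * (2 * w) ^ (2 * m + 1) / fact (4 * m + 2)) / b) sums (pi * reH a + (q / pi) * w * imH a + ((reH a)\<^sup>2 + (imH a)\<^sup>2) / b)"
      unfolding w_def by (intro sums_add sums_mult sums_divide reH_series imH_series absH_series)
    moreover have "pi * ((-1) ^ (m + 1) * w ^ (2 * m + 2) / fact (4 * m + 3))
        + (q / pi) * w * ((-1) ^ m * w ^ (2 * m + 1) / fact (4 * m + 1))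
        + (w * (2 * w) ^ (2 * m + 1) / fact (4 * m + 2)) / b = w\<^sup>2 * (c m * (w\<^sup>2) ^ m)" for m
    proof -
      have p: "w ^ (2 * m + 2) = w\<^sup>2 * (w\<^sup>2) ^ m" "w * w ^ (2 * m + 1) = w\<^sup>2 * (w\<^sup>2) ^ m"
        "w * (2 * w) ^ (2 * m + 1) = 2 ^ (2 * m + 1) * (w\<^sup>2 * (w\<^sup>2) ^ m)"
        by (simp_all add: power_mult power_mult_distrib power2_eq_square)
      have "(q / pi) * w * ((-1) ^ m * w ^ (2 * m + 1) / fact (4 * m + 1)) = (q / pi) * ((-1) ^ m * (w * w ^ (2 * m + 1)) / fact (4 * m + 1))"
        by (simp del: fact_Suc)
      then show ?thesis unfolding p c_def
        by (simp add: distrib_left distrib_right mult_ac del: fact_Suc power_Suc)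
    qed
    ultimately show ?thesis unfolding v w_def[symmetric] by simp
  qed
  have sv: "summable (\<lambda>m. c m * v ^ m)" if "0 \<le> v" for v
  proof (cases "v = 0")
    case True
    then show ?thesis using summable_finite[of "{0}" "\<lambda>m. c m * v ^ m"] by (auto simp: power_0_left)
  next
    case False
    \<comment> \<open>every nonnegative v is of the form \<open>4 a\<^sup>4\<close>\<close>
    define a where "a = sqrt (sqrt (v / 4))"
    have "a ^ 4 = (a\<^sup>2)\<^sup>2" by (simp flip: power_mult)
    then have a: "4 * a ^ 4 = v" using that by (simp add: a_def)
    have "summable (\<lambda>m. v * (c m * v ^ m))" using s[of a] by (simp only: a sums_iff)
    then show ?thesis using False by (simp add: summable_cmult_iff)
  qed
  show "summable (\<lambda>m. c m * v ^ m)" for v by (rule summable_if_sums_nonneg_arguments[OF sv])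
  have "summable (\<lambda>m. c m * (4 * a ^ 4) ^ m)" by (rule sv) simp
  from sums_unique2[OF s[of a] sums_mult[OF summable_sums[OF this], of "4 * a ^ 4"]]
  show "pi * reH a + (q / pi) * (2 * a\<^sup>2) * imH a + ((reH a)\<^sup>2 + (imH a)\<^sup>2) / b = 4 * a ^ 4 * (\<Sum>m. c m * (4 * a ^ 4) ^ m)" .
qed

lemma cosh_bound:
  assumes "0 \<le> x" "x \<le> pi"
  shows "cosh (x::real) \<le> 25 / 2"
proof -
  have "pi \<le> 3 * 1 + 3 / 20" using pi_approx by simp
  then have "exp x \<le> exp (3 * 1 + 3 / 20)" using assms by (subst exp_le_cancel_iff) linarith
  also have "\<dots> = exp 1 ^ 3 * exp (3 / 20 :: real)"
    by (simp only: exp_add) (simp add: eval_nat_numeral flip: exp_add)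
  also have "\<dots> \<le> (272 / 100) ^ 3 * (1 + 3 / 20 + (3 / 20)\<^sup>2)"
    using e_less_272 by (intro mult_mono power_mono exp_bound) auto
  also have "\<dots> \<le> 24" by (simp add: power3_eq_cube power2_eq_square)
  finally have "exp x \<le> 24" .
  moreover have "exp (- x) \<le> 1" using assms by simp
  ultimately have "(exp x + exp (- x)) / 2 \<le> (24 + 1) / 2" by (intro divide_right_mono add_mono) auto
  then show ?thesis by (simp add: cosh_def)
qed

text \<open>At \<open>\<omega>\<^sub>0\<close> the imaginary part of \<open>H = symH \<omega>\<close> vanishes and the real part is \<open>- \<beta>\<^sub>0\<close>, so the Popov expression
  \<open>Re H + q \<omega> Im H + \<bar>H\<bar>\<^sup>2 / \<beta>\<^sub>0\<close> has a zero there for every q. The choice of q makes its derivative vanish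
  as well, and the convexity criterion applies. The inequality with \<open>\<pi> / 6\<close> is the limit at frequency 0.\<close>

lemma popov_frequency_inequality:
  obtains q where "0 < q" "pi / 6 - q / pi \<le> 1 / \<beta>\<^sub>0" "0 < \<beta>\<^sub>0"
    "\<forall>\<omega>>0. - Re (1 / symH \<omega>) - q * Re (\<i> * of_real \<omega> / symH \<omega>) \<le> 1 / \<beta>\<^sub>0"
proof -
  obtain a where a: "3 * pi / 4 < a" "a < pi" "sinh a * cos a + cosh a * sin a = 0" "\<beta>\<^sub>0 = - reH a / pi"
    by (rule first_crossing)
  define b where "b = \<beta>\<^sub>0"
  \<comment> \<open>rough enclosures of a, b and q are enough for the coefficient signs\<close>
  have "314 / 100 \<le> pi" using pi_approx by simp
  then have a235: "47 / 20 \<le> a" using a(1) by linarith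
  have s0: "0 < sin a" using a a235 by (intro sin_gt_zero) auto
  have c0: "cos a < 0" using a pi_gt_zero by (intro cos_neg_second_quadrant) linarith+
  have sc: "sinh a * cos a = - (cosh a * sin a)" using a(3) by simp
  have sh: "0 < sinh a" "sinh a < cosh a" "0 < cosh a" using a235 by (auto simp: sinh_less_cosh_real)
  have "cosh a * sin a = sinh a * (- cos a)" using sc by simp
  also have "\<dots> \<le> cosh a * (- cos a)" using sh c0 by (intro mult_right_mono) auto
  finally have s_le: "sin a \<le> - cos a" by (rule mult_left_le_imp_le[OF _ sh(3)])
  have s2: "sin a \<le> 71 / 100"
  proof (rule power2_le_imp_le)
    have "(sin a)\<^sup>2 \<le> (- cos a)\<^sup>2" using s_le s0 by (intro power_mono) auto
    then have "2 * (sin a)\<^sup>2 \<le> 1" unfolding power2_minus using sin_cos_squared_add[of a] by linarith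
    then show "(sin a)\<^sup>2 \<le> (71 / 100)\<^sup>2" by (simp add: power2_eq_square)
  qed simp
  have rH: "reH a = - (2 * a * cosh a * sin a)" using sc by (simp add: reH_def)
  have iH: "imH a = 0" using a(3) by (simp add: imH_def)
  have b: "b = 2 * a * cosh a * sin a / pi" using a(4) rH by (simp add: b_def)
  have bp: "0 < b" using a235 sh s0 by (simp add: b)
  have ch: "cosh a \<le> 25 / 2" using a a235 by (intro cosh_bound) auto
  have chs: "cosh a * sin a \<le> 25 / 2 * (71 / 100)" using ch s2 sh s0 by (intro mult_mono) auto
  have b20: "b \<le> 20"
  proof -
    have "b = (2 * a / pi) * (cosh a * sin a)" by (simp add: b)
    also have "\<dots> \<le> 2 * (25 / 2 * (71 / 100))" by (rule mult_mono[OF _ chs]) (use a a235 sh s0 in \<open>auto simp: divide_le_eq\<close>)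
    finally show ?thesis by simp
  qed
  \<comment> \<open>solves \<open>- x' + (2 q / \<pi>\<^sup>2) a\<^sup>2 y' = 0\<close> for the derivatives x' and y' of \<open>reH\<close> and \<open>imH\<close> at a\<close>
  define q where "q = pi\<^sup>2 * (cosh a * sin a + a * sinh a * sin a) / (2 * a ^ 3 * cosh a * (- cos a))"
  have qp: "0 < q" unfolding q_def using a235 sh s0 c0 by (intro divide_pos_pos mult_pos_pos add_pos_pos) auto
  have qb: "q * b \<le> 9 * pi"
  proof -
    have e1: "q * b = pi * (cosh a + a * sinh a) * sin a / a\<^sup>2 * (sin a / (- cos a))"
      using a235 sh s0 c0 unfolding q_def b by (simp add: field_simps power2_eq_square power3_eq_cube)
    have r1: "sin a / (- cos a) \<le> 1" using c0 s_le by (subst pos_divide_le_eq) auto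
    have e2: "pi * (cosh a + a * sinh a) * sin a / a\<^sup>2 * (sin a / (- cos a)) \<le> pi * (cosh a + a * cosh a) * sin a / a\<^sup>2 * 1"
      using a235 sh s0 c0 s_le
      by (intro mult_mono divide_right_mono add_mono mult_left_mono mult_right_mono mult_nonneg_nonneg divide_nonneg_nonneg add_nonneg_nonneg r1) auto
    note e1
    also note e2
    also have "\<dots> = pi * ((1 + a) / a\<^sup>2) * (cosh a * sin a)" by (simp add: field_simps)
    also have "\<dots> \<le> pi * 1 * (25 / 2 * (71 / 100))"
    proof (rule mult_mono[OF mult_mono[OF order_refl] chs])
      have "a * (47 / 20) \<le> a * a" using a235 by (intro mult_left_mono) auto
      then have "1 + a \<le> a\<^sup>2" unfolding power2_eq_square using a235 by linarith
      then show "(1 + a) / a\<^sup>2 \<le> 1" using a235 by (subst pos_divide_le_eq) auto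
    qed (use a235 sh s0 in auto)
    also have "\<dots> \<le> 9 * pi" by simp
    finally show ?thesis .
  qed
  define c where "c m = pi * (-1) ^ (m + 1) / fact (4 * m + 3) + (q / pi) * (-1) ^ m / fact (4 * m + 1)
     + 2 ^ (2 * m + 1) / (b * fact (4 * m + 2))" for m :: nat
  define G where "G v = (\<Sum>m. c m * v ^ m)" for v
  have summ: "summable (\<lambda>m. c m * v ^ m)" for v
    unfolding c_def by (rule popov_series(1)) (use bp in simp)
  define P where "P a = pi * reH a + (q / pi) * (2 * a\<^sup>2) * imH a + ((reH a)\<^sup>2 + (imH a)\<^sup>2) / b" for a
  have PG: "P a = 4 * a ^ 4 * G (4 * a ^ 4)" for a
    unfolding P_def G_def c_def by (rule popov_series(2)) (use bp in simp)
  have rb: "reH a = - pi * b" using a(4) by (simp add: b_def field_simps)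
  have P0: "P a = 0" using bp by (simp add: P_def iH rb power2_eq_square)
  have G0: "G (4 * a ^ 4) = 0" using P0 PG[of a] a235 by simp
  define D where "D = (\<Sum>m. diffs c m * (4 * a ^ 4) ^ m)"
  have GD: "(G has_real_derivative D) (at (4 * a ^ 4))"
    unfolding G_def[abs_def] D_def by (rule termdiffs_strong_converges_everywhere[OF summ])
  have gd: "((\<lambda>a. 4 * a ^ 4) has_real_derivative 16 * a ^ 3) (at a)"
    by (auto intro!: derivative_eq_intros)
  have "((\<lambda>a. 4 * a ^ 4 * G (4 * a ^ 4)) has_real_derivative 4 * a ^ 4 * (D * (16 * a ^ 3))) (at a)"
    using DERIV_mult[OF gd DERIV_chain2[where f = G and g = "\<lambda>a. 4 * a ^ 4", OF GD gd]]
    by (simp add: G0 mult_ac)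
  moreover have "(P has_real_derivative 0) (at a)"
  proof -
    define x' where "x' = (sinh a * cos a - cosh a * sin a) - a * (2 * sinh a * sin a)"
    define y' where "y' = (sinh a * cos a + cosh a * sin a) + a * (2 * cosh a * cos a)"
    note xd = imH_reH_deriv(3)[of a, folded x'_def] and yd = imH_reH_deriv(2)[of a, folded y'_def]
    have "(P has_real_derivative pi * x' + (q / pi) * (2 * a\<^sup>2 * y') + 2 * reH a * x' / b) (at a)"
      unfolding P_def[abs_def]
      using bp by (auto intro!: derivative_eq_intros xd yd simp: iH field_simps power2_eq_square)
    moreover have "pi * x' + (q / pi) * (2 * a\<^sup>2 * y') + 2 * reH a * x' / b = 0"
    proof -
      have x: "x' = - 2 * (cosh a * sin a + a * sinh a * sin a)" unfolding x'_def sc by (simp add: algebra_simps)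
      have y: "y' = 2 * a * cosh a * cos a" unfolding y'_def sc by simp
      have q: "(q / pi) * (2 * a\<^sup>2 * (2 * a * cosh a * cos a)) = - 2 * pi * (cosh a * sin a + a * sinh a * sin a)"
        using a235 sh c0 unfolding q_def by (simp add: field_simps power2_eq_square power3_eq_cube)
      have "pi * x' + (q / pi) * (2 * a\<^sup>2 * y') + 2 * reH a * x' / b = - pi * x' + (q / pi) * (2 * a\<^sup>2 * y')"
        using bp by (simp add: rb)
      also have "\<dots> = 0" unfolding y q unfolding x by (simp add: algebra_simps)
      finally show ?thesis .
    qed
    ultimately show ?thesis by simp
  qed
  moreover have "P = (\<lambda>a. 4 * a ^ 4 * G (4 * a ^ 4))" using PG by blast
  ultimately have "4 * a ^ 4 * (D * (16 * a ^ 3)) = 0" using DERIV_unique by blast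
  then have "D = 0" using a235 by simp
  then have G1: "(G has_real_derivative 0) (at (4 * a ^ 4))" using GD by simp
  have cnn: "0 \<le> c m" if "2 \<le> m" for m
    unfolding c_def by (rule popov_coefficient_sign[OF bp b20 qp qb that])
  have Gnn: "0 \<le> G v" if "0 \<le> v" for v
    unfolding G_def
    by (rule power_series_double_zero_nonneg[OF summ cnn _ G0[unfolded G_def] G1[unfolded G_def[abs_def]] that]) simp_all
  have "G 0 = c 0" by (simp add: G_def powser_zero)
  with Gnn[of 0] have "0 \<le> - pi / 6 + q / pi + 1 / b"
    using bp by (simp add: c_def fact_numeral eval_nat_numeral)
  then have g0: "pi / 6 - q / pi \<le> 1 / b" by simp
  have "- Re (1 / symH \<omega>) - q * Re (\<i> * of_real \<omega> / symH \<omega>) \<le> 1 / b" if \<omega>: "0 < \<omega>" for \<omega>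
  proof -
    let ?a = "pi * sqrt (\<omega> / 2)"
    have "0 \<le> P ?a" unfolding PG by (intro mult_nonneg_nonneg Gnn) auto
    moreover have "2 * ?a\<^sup>2 = pi\<^sup>2 * \<omega>" using \<omega> by (simp add: power_mult_distrib)
    ultimately have P: "0 \<le> pi * reH ?a + q * pi * \<omega> * imH ?a + ((reH ?a)\<^sup>2 + (imH ?a)\<^sup>2) / b"
      by (simp add: P_def power2_eq_square mult_ac)
    define N where "N = (reH ?a)\<^sup>2 + (imH ?a)\<^sup>2"
    have H: "symH \<omega> = Complex (reH ?a / pi) (imH ?a / pi)" by (simp add: symH_eq complex_eq_iff)
    have "N \<noteq> 0" using symH_nonzero[OF \<omega>] by (auto simp: N_def H complex_eq_iff)
    moreover have "0 \<le> N" by (simp add: N_def)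
    ultimately have N: "0 < N" by simp
    have nrm: "(reH ?a)\<^sup>2 / pi\<^sup>2 + (imH ?a)\<^sup>2 / pi\<^sup>2 = N / pi\<^sup>2" by (simp add: N_def add_divide_distrib)
    have 1: "Re (1 / symH \<omega>) = pi * reH ?a / N"
      unfolding H by (simp add: Re_divide power_divide nrm) (simp add: power2_eq_square)
    have 2: "Re (\<i> * of_real \<omega> / symH \<omega>) = pi * \<omega> * imH ?a / N"
      unfolding H by (simp add: Re_divide power_divide nrm) (simp add: power2_eq_square)
    have "- (pi * reH ?a) - q * (pi * \<omega> * imH ?a) \<le> N / b" using P by (simp add: N_def mult_ac)
    then have "(- (pi * reH ?a) - q * (pi * \<omega> * imH ?a)) / N \<le> N / b / N" using N by (intro divide_right_mono) auto
    then show ?thesis unfolding 1 2 using N by (simp add: diff_divide_distrib)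
  qed
  with qp g0 bp show ?thesis using that unfolding b_def by blast
qed

section \<open>The multiplier with a backward difference\<close>

text \<open>Defined by the series and not as \<open>1 / symH \<omega>\<close>, so as to cover negative frequencies, where it is the complex
  conjugate.\<close>

definition transfer_fun :: "real \<Rightarrow> complex" where
  "transfer_fun \<omega> = (\<Sum>n. of_real (wt n * (-1) ^ n) / (of_real ((real n)\<^sup>2) + \<i> * of_real \<omega>))"

lemma transfer_fun_sums:
  assumes "\<omega> \<noteq> 0"
  shows "(\<lambda>n. of_real (wt n * (-1) ^ n) / (of_real ((real n)\<^sup>2) + \<i> * of_real \<omega>)) sums transfer_fun \<omega>"
    and transfer_fun_uminus: "transfer_fun (- \<omega>) = cnj (transfer_fun \<omega>)"
proof -
  let ?k = "\<lambda>\<omega> n. of_real (wt n * (-1) ^ n) / (of_real ((real n)\<^sup>2) + \<i> * of_real \<omega>) :: complex"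
  have c: "cnj (?k \<omega> n) = ?k (- \<omega>) n" for \<omega> n by simp
  have pos: "?k \<omega> sums transfer_fun \<omega>" if "0 < \<omega>" for \<omega>
    unfolding transfer_fun_def by (rule summable_sums[OF sums_summable[OF kernel_expansion(2)[OF that]]])
  have neg: "?k (- \<omega>) sums cnj (transfer_fun \<omega>)" if "0 < \<omega>" for \<omega>
    using pos[OF that] unfolding c[symmetric] sums_cnj .
  show "?k \<omega> sums transfer_fun \<omega>"
  proof (cases "0 < \<omega>")
    case False
    then have "?k \<omega> sums cnj (transfer_fun (- \<omega>))" using neg[of "- \<omega>"] assms by simp
    then show ?thesis unfolding transfer_fun_def by (rule summable_sums[OF sums_summable])
  qed (rule pos)
  then have "?k (- \<omega>) sums cnj (transfer_fun \<omega>)" unfolding c[symmetric] sums_cnj .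
  then show "transfer_fun (- \<omega>) = cnj (transfer_fun \<omega>)" unfolding transfer_fun_def by (rule sums_unique[symmetric])
qed

lemma transfer_fun_eq: "0 < \<omega> \<Longrightarrow> transfer_fun \<omega> = 1 / symH \<omega>"
  using sums_unique2[OF transfer_fun_sums(1) kernel_expansion(2)] by simp

lemma exp_linear_bound: "cmod (1 - exp (- (\<i> * of_real x)) - \<i> * of_real x) \<le> x\<^sup>2"
proof -
  have "cmod (exp (- (\<i> * of_real x)) - (\<Sum>k\<le>1. (- (\<i> * of_real x)) ^ k / fact k)) \<le> exp \<bar>Re (- (\<i> * of_real x))\<bar> * (cmod (- (\<i> * of_real x))) ^ Suc 1 / fact 1"
    by (rule Taylor_exp)
  also have "\<dots> = x\<^sup>2" by (simp add: norm_mult power2_eq_square)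
  also have "exp (- (\<i> * of_real x)) - (\<Sum>k\<le>1. (- (\<i> * of_real x)) ^ k / fact k) = - (1 - exp (- (\<i> * of_real x)) - \<i> * of_real x)"
    by simp
  finally show ?thesis by (simp only: norm_minus_cancel)
qed

text \<open>Passing from \<open>i \<omega>\<close> to \<open>(1 - exp (- i \<omega> h)) / h\<close> costs at most \<open>h \<omega>\<^sup>2\<close>, and \<open>\<omega>\<^sup>2\<close> times the transfer
  function is bounded by 1. The loss \<open>q h\<close> therefore does not depend on the frequency.\<close>

lemma difference_multiplier_bound:
  assumes q: "0 < q" and h: "0 < h"
    and pop: "\<And>\<omega>. 0 < \<omega> \<Longrightarrow> - Re (1 / symH \<omega>) - q * Re (\<i> * of_real \<omega> / symH \<omega>) \<le> b"
    and \<omega>: "\<omega> \<noteq> 0"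
  shows "Re (- transfer_fun \<omega> - of_real (q / h) * ((1 - exp (- (\<i> * of_real (\<omega> * h)))) * transfer_fun \<omega>)) \<le> b + q * h"
proof -
  let ?m = "\<lambda>\<omega>. - transfer_fun \<omega> - of_real (q / h) * ((1 - exp (- (\<i> * of_real (\<omega> * h)))) * transfer_fun \<omega>)"
  have pos: "Re (?m \<omega>) \<le> b + q * h" if \<omega>: "0 < \<omega>" for \<omega>
  proof -
    let ?K = "transfer_fun \<omega>"
    define E where "E = 1 - exp (- (\<i> * of_real (\<omega> * h))) - \<i> * of_real (\<omega> * h)"
    have E: "cmod E \<le> (\<omega> * h)\<^sup>2" unfolding E_def by (rule exp_linear_bound)
    have "\<omega>\<^sup>2 * cmod ?K \<le> 1"
    proof -
      have "0 < cmod (symH \<omega>)" using symH_nonzero[OF \<omega>] by simp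
      then show ?thesis using symH_lower_bound[OF \<omega>] by (simp add: transfer_fun_eq[OF \<omega>] norm_divide divide_le_eq)
    qed
    then have "h\<^sup>2 * (\<omega>\<^sup>2 * cmod ?K) \<le> h\<^sup>2 * 1" by (intro mult_left_mono) auto
    moreover have "cmod (E * ?K) \<le> (\<omega> * h)\<^sup>2 * cmod ?K" unfolding norm_mult by (intro mult_right_mono E) auto
    ultimately have EK: "cmod (E * ?K) \<le> h\<^sup>2" by (simp add: power_mult_distrib mult_ac)
    have "?m \<omega> = - ?K - of_real (q / h) * (\<i> * of_real (\<omega> * h) * ?K) - of_real (q / h) * (E * ?K)"
      by (simp add: E_def algebra_simps)
    moreover have "of_real (q / h) * (\<i> * of_real (\<omega> * h) * ?K) = of_real q * (\<i> * of_real \<omega> * ?K)"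
      using h by simp
    moreover have r: "Re (of_real r * c) = r * Re c" for r and c :: complex by simp
    ultimately have e: "Re (?m \<omega>) = - Re ?K - q * Re (\<i> * of_real \<omega> * ?K) - (q / h) * Re (E * ?K)"
      by (simp only: minus_complex.simps uminus_complex.simps)
    note e
    also have "\<dots> \<le> b + (q / h) * h\<^sup>2"
    proof -
      have "- Re ?K - q * Re (\<i> * of_real \<omega> * ?K) \<le> b" using pop[OF \<omega>] by (simp add: transfer_fun_eq[OF \<omega>])
      moreover have "- Re (E * ?K) \<le> h\<^sup>2" using EK abs_Re_le_cmod[of "E * ?K"] by linarith
      then have "(q / h) * (- Re (E * ?K)) \<le> (q / h) * h\<^sup>2" using q h by (intro mult_left_mono) auto
      ultimately show ?thesis by linarith
    qed
    also have "(q / h) * h\<^sup>2 = q * h" using h by (simp add: power2_eq_square)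
    finally show ?thesis .
  qed
  show ?thesis
  proof (cases "0 < \<omega>")
    case False
    then have n: "0 < - \<omega>" using \<omega> by simp
    have "?m \<omega> = cnj (?m (- \<omega>))"
      using transfer_fun_uminus[of "- \<omega>"] n by (simp add: exp_cnj)
    then show ?thesis using pos[OF n] by simp
  qed (rule pos)
qed

section \<open>The system of modes\<close>

lemma squares_all: "(\<lambda>n. 1 / (real n)\<^sup>2) sums (pi\<^sup>2 / 6)"
  using inverse_squares_sums sums_iff_shift[of "\<lambda>n. 1 / (real n)\<^sup>2" 1 "pi\<^sup>2 / 6"] by (simp add: add.commute)

lemma squares_even: "(\<lambda>n. if even n then 1 / (real n)\<^sup>2 else 0) sums (pi\<^sup>2 / 24)"
proof -
  have "(\<lambda>k. 1 / 4 * (1 / (real k)\<^sup>2)) sums (1 / 4 * (pi\<^sup>2 / 6))" by (intro sums_mult squares_all)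
  then have "(\<lambda>k. if even (2 * k) then 1 / (real (2 * k))\<^sup>2 else 0) sums (pi\<^sup>2 / 24)"
    by (simp add: power_mult_distrib)
  then show ?thesis
    by (subst (asm) sums_mono_reindex[of "\<lambda>k. 2 * k"]) (auto simp: strict_mono_def elim!: evenE)
qed

lemma squares_odd: "(\<lambda>n. if odd n then 1 / (real n)\<^sup>2 else 0) sums (pi\<^sup>2 / 8)"
proof -
  have "(\<lambda>n. 1 / (real n)\<^sup>2 - (if even n then 1 / (real n)\<^sup>2 else 0)) sums (pi\<^sup>2 / 6 - pi\<^sup>2 / 24)"
    by (intro sums_diff squares_all squares_even)
  moreover have "(\<lambda>n. 1 / (real n)\<^sup>2 - (if even n then 1 / (real n)\<^sup>2 else 0)) = (\<lambda>n. if odd n then 1 / (real n)\<^sup>2 else 0)"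
    by (simp add: fun_eq_iff)
  ultimately show ?thesis by simp
qed

lemma squares_alternating: "(\<lambda>n. (-1) ^ n / (real n)\<^sup>2) sums (- (pi\<^sup>2 / 12))"
proof -
  have "(\<lambda>n. (if even n then 1 / (real n)\<^sup>2 else 0) - (if odd n then 1 / (real n)\<^sup>2 else 0)) sums (pi\<^sup>2 / 24 - pi\<^sup>2 / 8)"
    by (intro sums_diff squares_odd squares_even)
  moreover have "(\<lambda>n. (if even n then 1 / (real n)\<^sup>2 else 0) - (if odd n then 1 / (real n)\<^sup>2 else 0)) = (\<lambda>n. (-1) ^ n / (real n)\<^sup>2)"
    by (simp add: fun_eq_iff)
  ultimately show ?thesis by simp
qed

lemma abs_tanh_le: "\<bar>tanh x\<bar> \<le> \<bar>x::real\<bar>"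
proof -
  have *: "tanh x \<le> x" if "0 \<le> x" for x :: real
  proof -
    have "0 - tanh 0 \<le> x - tanh x"
    proof (rule DERIV_nonneg_imp_nondecreasing[OF that])
      fix z :: real
      show "\<exists>d. ((\<lambda>z. z - tanh z) has_real_derivative d) (at z) \<and> 0 \<le> d"
        by (intro exI[of _ "(tanh z)\<^sup>2"] conjI) (auto intro!: derivative_eq_intros)
    qed
    then show ?thesis by simp
  qed
  show ?thesis using *[of "\<bar>x\<bar>"] by (simp add: tanh_real_abs)
qed

text \<open>A dominated series of nonnegative terms is small as soon as its first few terms are. The factor
  \<open>1 + n\<^sup>2\<close> does no harm there, and it admits series like that of \<open>n\<^sup>2 a\<^sub>n\<^sup>2\<close>.\<close>

lemma small_series:
  assumes K: "0 \<le> K" and \<eta>: "0 < \<eta>"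
  shows "\<exists>\<delta>>0. \<forall>f. (\<forall>n. 0 \<le> f n \<and> f n \<le> \<delta> * (1 + (real n)\<^sup>2) \<and> (1 \<le> n \<longrightarrow> f n \<le> K / (real n)\<^sup>2))
      \<longrightarrow> summable f \<and> suminf f \<le> \<eta>"
proof -
  have sK: "summable (\<lambda>n. K / (real n)\<^sup>2)"
    using summable_mult[OF sums_summable[OF squares_all], of K] by simp
  obtain N where N: "\<And>n. N \<le> n \<Longrightarrow> norm (\<Sum>i. K / (real (i + n))\<^sup>2) < \<eta> / 2"
    using suminf_exist_split[OF _ sK, of "\<eta> / 2"] \<eta> by auto
  define M where "M = max N 1"
  define S where "S = (\<Sum>n<M. 1 + (real n)\<^sup>2)"
  have S: "0 \<le> S" unfolding S_def by (intro sum_nonneg) simp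
  define \<delta> where "\<delta> = \<eta> / (2 * (1 + S))"
  have \<delta>: "0 < \<delta>" using \<eta> S by (simp add: \<delta>_def)
  show ?thesis
  proof (intro exI[of _ \<delta>] conjI \<delta> allI impI)
    fix f :: "nat \<Rightarrow> real"
    assume "\<forall>n. 0 \<le> f n \<and> f n \<le> \<delta> * (1 + (real n)\<^sup>2) \<and> (1 \<le> n \<longrightarrow> f n \<le> K / (real n)\<^sup>2)"
    then have f: "\<And>n. 0 \<le> f n" "\<And>n. f n \<le> \<delta> * (1 + (real n)\<^sup>2)" "\<And>n. 1 \<le> n \<Longrightarrow> f n \<le> K / (real n)\<^sup>2" by auto
    show sf: "summable f" by (rule summable_comparison_test'[OF sK, of 1]) (use f in auto)
    have "(\<Sum>n. f (n + M)) \<le> (\<Sum>n. K / (real (n + M))\<^sup>2)"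
    proof (rule suminf_le)
      show "f (n + M) \<le> K / (real (n + M))\<^sup>2" for n by (rule f(3)) (simp add: M_def)
      show "summable (\<lambda>n. f (n + M))" by (rule summable_ignore_initial_segment[OF sf])
      show "summable (\<lambda>n. K / (real (n + M))\<^sup>2)" by (rule summable_ignore_initial_segment[OF sK])
    qed
    also have "\<dots> < \<eta> / 2" using N[of M] by (simp add: M_def)
    finally have 1: "(\<Sum>n. f (n + M)) \<le> \<eta> / 2" by simp
    have "(\<Sum>n<M. f n) \<le> (\<Sum>n<M. \<delta> * (1 + (real n)\<^sup>2))" by (intro sum_mono f)
    also have "\<dots> = \<delta> * S" by (simp add: S_def sum_distrib_left)
    also have "\<dots> \<le> \<eta> / 2" using \<eta> S by (simp add: \<delta>_def field_simps)
    finally show "suminf f \<le> \<eta>"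
      using 1 suminf_split_initial_segment[OF sf, of M] by simp
  qed
qed

lemma linear_ode_variation:
  fixes k :: real
  assumes "s \<le> t" and "\<And>r. r \<in> {s..t} \<Longrightarrow> (a has_real_derivative - k * a r - g r) (at r within {s..t})"
  shows "((\<lambda>r. exp (- k * (t - r)) * g r) has_integral (exp (- k * (t - s)) * a s - a t)) {s..t}"
proof -
  define F where "F r = - exp (- k * (t - r)) * a r" for r
  have "((\<lambda>r. exp (- k * (t - r)) * g r) has_integral (F t - F s)) {s..t}"
  proof (rule fundamental_theorem_of_calculus[OF assms(1)])
    fix r assume "r \<in> {s..t}"
    from assms(2)[OF this]
    have "(F has_real_derivative exp (- k * (t - r)) * g r) (at r within {s..t})"
      unfolding F_def by (auto intro!: derivative_eq_intros simp: algebra_simps)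
    then show "(F has_vector_derivative exp (- k * (t - r)) * g r) (at r within {s..t})"
      by (simp add: has_real_derivative_iff_has_vector_derivative)
  qed
  then show ?thesis by (simp add: F_def)
qed

lemma exp_integral:
  fixes k :: real
  assumes "0 < k" "s \<le> t"
  shows "((\<lambda>r. exp (- k * (t - r))) has_integral (1 - exp (- k * (t - s))) / k) {s..t}"
proof -
  have "((\<lambda>r. exp (- k * (t - r))) has_integral (exp (- k * (t - t)) / k - exp (- k * (t - s)) / k)) {s..t}"
  proof (rule fundamental_theorem_of_calculus[OF assms(2)])
    fix r
    have "((\<lambda>r. exp (- k * (t - r)) / k) has_real_derivative exp (- k * (t - r))) (at r within {s..t})"
      using assms by (auto intro!: derivative_eq_intros)
    then show "((\<lambda>r. exp (- k * (t - r)) / k) has_vector_derivative exp (- k * (t - r))) (at r within {s..t})"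
      by (simp add: has_real_derivative_iff_has_vector_derivative)
  qed
  then show ?thesis by (simp add: diff_divide_distrib)
qed

lemma linear_ode_bound:
  fixes k :: real
  assumes k: "0 < k" and st: "s \<le> t" and a: "\<And>r. r \<in> {s..t} \<Longrightarrow> (a has_real_derivative - k * a r - g r) (at r within {s..t})"
    and g: "\<And>r. \<bar>g r\<bar> \<le> 1"
  shows "\<bar>a t\<bar> \<le> exp (- k * (t - s)) * \<bar>a s\<bar> + 1 / k"
proof -
  note v = linear_ode_variation[OF st a] and x = exp_integral[OF k st]
  have "norm (integral {s..t} (\<lambda>r. exp (- k * (t - r)) * g r)) \<le> integral {s..t} (\<lambda>r. exp (- k * (t - r)))"
    by (rule integral_norm_bound_integral)
       (use v x g in \<open>auto simp: abs_mult has_integral_iff mult_left_le\<close>)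
  then have "\<bar>exp (- k * (t - s)) * a s - a t\<bar> \<le> (1 - exp (- k * (t - s))) / k"
    using v x by (simp add: has_integral_iff)
  also have "\<dots> \<le> 1 / k" using k by (intro divide_right_mono) auto
  finally have "\<bar>exp (- k * (t - s)) * a s - a t\<bar> \<le> 1 / k" .
  moreover have "\<bar>exp (- k * (t - s)) * a s\<bar> = exp (- k * (t - s)) * \<bar>a s\<bar>" by (simp add: abs_mult)
  ultimately show ?thesis by linarith
qed

text \<open>The dynamics of the cosine coefficients, detached from the function space. The bound \<open>C / n\<^sup>2\<close> on the initial
  values holds for every solution after a positive time; all later estimates depend on the trajectory
  through C only, which is what makes them uniform on bounded sets.\<close>

locale thermostat_modes =
  fixes \<beta> C :: real and a :: "nat \<Rightarrow> real \<Rightarrow> real" and y :: "real \<Rightarrow> real"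
  assumes beta: "0 < \<beta>" and C: "0 \<le> C"
    and ode: "0 \<le> t \<Longrightarrow> (a n has_real_derivative - (real n)\<^sup>2 * a n t - tanh (\<beta> * y t)) (at t within {0..})"
    and y_cont: "continuous_on {0..} y"
    and y_sum: "0 \<le> t \<Longrightarrow> (\<lambda>n. wt n * (-1) ^ n * a n t) sums y t"
    and init0: "\<bar>a 0 0\<bar> \<le> C" and init: "1 \<le> n \<Longrightarrow> \<bar>a n 0\<bar> \<le> C / (real n)\<^sup>2"
begin

definition g :: "real \<Rightarrow> real" where "g t = tanh (\<beta> * y t)"

lemma g_bound: "\<bar>g t\<bar> \<le> 1" "(g t)\<^sup>2 \<le> 1"
proof -
  show "\<bar>g t\<bar> \<le> 1" using tanh_real_bounds[of "\<beta> * y t"] by (auto simp: g_def abs_le_iff)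
  then show "(g t)\<^sup>2 \<le> 1" by (simp add: abs_square_le_1)
qed

lemma g_cont: "0 \<le> s \<Longrightarrow> continuous_on {s..t} g"
  unfolding g_def[abs_def]
  by (intro continuous_intros continuous_on_subset[OF y_cont]) (auto simp: cosh_real_nonzero)

lemma a_cont: "0 \<le> s \<Longrightarrow> continuous_on {s..t} (a n)"
  by (rule continuous_on_subset[OF DERIV_continuous_on[OF ode]]) auto

lemma a_deriv: "0 \<le> s \<Longrightarrow> r \<in> {s..t} \<Longrightarrow> (a n has_real_derivative - (real n)\<^sup>2 * a n r - g r) (at r within {s..t})"
  unfolding g_def by (rule DERIV_subset[OF ode]) auto

lemma variation_of_constants:
  assumes "0 \<le> s" "s \<le> t"
  shows "((\<lambda>r. exp (- (real n)\<^sup>2 * (t - r)) * g r) has_integral (exp (- (real n)\<^sup>2 * (t - s)) * a n s - a n t)) {s..t}"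
  using linear_ode_variation[OF assms(2), of "a n" "(real n)\<^sup>2" g] a_deriv[OF assms(1)] by simp

lemma a_bound:
  assumes "1 \<le> n" "0 \<le> t"
  shows "\<bar>a n t\<bar> \<le> (C + 1) / (real n)\<^sup>2"
proof -
  have "\<bar>a n t\<bar> \<le> exp (- (real n)\<^sup>2 * (t - 0)) * \<bar>a n 0\<bar> + 1 / (real n)\<^sup>2"
    by (rule linear_ode_bound[OF _ assms(2) a_deriv g_bound(1)]) (use assms in auto)
  also have "exp (- (real n)\<^sup>2 * (t - 0)) * \<bar>a n 0\<bar> \<le> 1 * (C / (real n)\<^sup>2)"
    using assms by (intro mult_mono init) auto
  finally show ?thesis by (simp add: add_divide_distrib)
qed

lemma abs_g_le: "0 < \<mu> \<Longrightarrow> \<bar>g t\<bar> \<le> \<mu> + (g t)\<^sup>2 / \<mu>"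
proof -
  assume \<mu>: "0 < \<mu>"
  have "0 \<le> (\<mu> - \<bar>g t\<bar>)\<^sup>2" by simp
  then have "2 * (\<bar>g t\<bar> * \<mu>) \<le> \<mu> * \<mu> + (g t)\<^sup>2"
    by (simp add: power2_eq_square algebra_simps)
  moreover have "0 \<le> \<bar>g t\<bar> * \<mu>" using \<mu> by simp
  ultimately have "\<bar>g t\<bar> * \<mu> \<le> \<mu> * \<mu> + (g t)\<^sup>2" by linarith
  then show ?thesis using \<mu> by (simp add: field_simps power2_eq_square)
qed

lemma gsq_integrable: "0 \<le> s \<Longrightarrow> (\<lambda>r. (g r)\<^sup>2) integrable_on {s..t}"
  by (intro integrable_continuous_real continuous_intros g_cont)

text \<open>Young's inequality for \<open>\<bar>g\<bar>\<close>; the parameter \<open>\<mu>\<close> will be small compared with the target, but not below the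
  root of the integral.\<close>

lemma a_bound_L2:
  assumes "1 \<le> n" "0 \<le> s" "s \<le> t" and \<mu>: "0 < \<mu>"
  shows "\<bar>a n t\<bar> \<le> exp (- (t - s)) * (C + 1) + \<mu> + integral {s..t} (\<lambda>r. (g r)\<^sup>2) / \<mu>"
proof -
  define k where "k = (real n)\<^sup>2"
  have k: "1 \<le> k" using assms(1) by (simp add: k_def)
  note v = variation_of_constants[OF assms(2,3), of n, folded k_def] and x = exp_integral[OF less_le_trans[OF zero_less_one k] assms(3)]
  have "norm (integral {s..t} (\<lambda>r. exp (- k * (t - r)) * g r)) \<le> integral {s..t} (\<lambda>r. \<mu> * exp (- k * (t - r)) + (g r)\<^sup>2 / \<mu>)"
  proof (rule integral_norm_bound_integral)
    fix r assume r: "r \<in> {s..t}"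
    let ?e = "exp (- k * (t - r))"
    have e: "0 \<le> ?e" "?e \<le> 1" using r k by auto
    have "?e * \<bar>g r\<bar> \<le> ?e * (\<mu> + (g r)\<^sup>2 / \<mu>)" by (intro mult_left_mono abs_g_le \<mu>) auto
    also have "\<dots> \<le> \<mu> * ?e + (g r)\<^sup>2 / \<mu>"
      using mult_right_mono[OF e(2), of "(g r)\<^sup>2 / \<mu>"] \<mu> by (simp add: algebra_simps)
    finally show "norm (?e * g r) \<le> \<mu> * ?e + (g r)\<^sup>2 / \<mu>" by (simp add: abs_mult)
  qed (use v x gsq_integrable[OF assms(2)] in \<open>auto simp: has_integral_iff intro!: integrable_add integrable_on_mult_right integrable_on_divide\<close>)
  also have "\<dots> = \<mu> * ((1 - exp (- k * (t - s))) / k) + integral {s..t} (\<lambda>r. (g r)\<^sup>2) / \<mu>"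
    using x gsq_integrable[OF assms(2), of t]
    by (subst integral_add) (auto simp: has_integral_iff intro!: integrable_on_mult_right integrable_on_divide)
  also have "\<mu> * ((1 - exp (- k * (t - s))) / k) \<le> \<mu> * 1"
    using k \<mu> assms by (intro mult_left_mono) (auto simp: divide_le_eq intro: order_trans[of _ 1])
  finally have "\<bar>exp (- k * (t - s)) * a n s - a n t\<bar> \<le> \<mu> + integral {s..t} (\<lambda>r. (g r)\<^sup>2) / \<mu>"
    using v by (simp add: has_integral_iff)
  moreover have "\<bar>exp (- k * (t - s)) * a n s\<bar> \<le> exp (- (t - s)) * (C + 1)"
  proof -
    have "exp (- k * (t - s)) \<le> exp (- (t - s))" using k assms mult_right_mono[of 1 k "t - s"] by simp
    moreover have "\<bar>a n s\<bar> \<le> C + 1"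
    proof -
      have "(C + 1) / k \<le> (C + 1) / 1" using k C by (intro divide_left_mono) auto
      then show ?thesis using a_bound[OF assms(1,2)] by (simp add: k_def)
    qed
    ultimately show ?thesis by (simp add: abs_mult mult_mono)
  qed
  ultimately show ?thesis by linarith
qed

text \<open>The graph of tanh lies in the sector between the axis and the line of slope 1.\<close>

lemma sector: "(g r)\<^sup>2 / \<beta> \<le> g r * y r"
proof -
  have "\<bar>g r\<bar> \<le> \<beta> * \<bar>y r\<bar>" using abs_tanh_le[of "\<beta> * y r"] beta by (simp add: g_def abs_mult)
  then have "\<bar>g r\<bar> * \<bar>g r\<bar> \<le> \<beta> * \<bar>y r\<bar> * \<bar>g r\<bar>" by (intro mult_right_mono) auto
  moreover have "\<bar>y r\<bar> * \<bar>g r\<bar> = g r * y r"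
    using beta by (cases "0 \<le> y r") (auto simp: g_def abs_mult[symmetric] abs_if mult_less_0_iff zero_less_mult_iff not_le)
  ultimately show ?thesis using beta by (simp add: power2_eq_square divide_le_eq mult_ac)
qed

lemma y_minus_mean:
  assumes t: "0 \<le> t" and s: "summable (\<lambda>n. if n = 0 then 0 else \<bar>a n t\<bar>)"
  shows "\<bar>y t - a 0 t / pi\<bar> \<le> (\<Sum>n. if n = 0 then 0 else \<bar>a n t\<bar>)"
proof -
  define f where "f n = (if n = 0 then 0 else \<bar>a n t\<bar>)" for n
  have "(\<lambda>n. wt n * (-1) ^ n * a n t - (if n = 0 then a 0 t / pi else 0)) sums (y t - a 0 t / pi)"
    by (intro sums_diff y_sum t sums_single)
  moreover have b: "\<bar>wt n * (-1) ^ n * a n t - (if n = 0 then a 0 t / pi else 0)\<bar> \<le> f n" for n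
    using mult_right_mono[OF wt_le[of n], of "\<bar>a n t\<bar>"] wt_nonneg[of n]
    by (auto simp: f_def abs_mult power_abs wt_def)
  ultimately have "\<bar>y t - a 0 t / pi\<bar> \<le> (\<Sum>n. f n)"
    using s unfolding f_def[symmetric]
    by (metis (no_types, lifting) norm_suminf_le real_norm_def sums_unique)
  then show ?thesis by (simp add: f_def)
qed

end

section \<open>Small input and the decay of the L2 norm\<close>

text \<open>The modes \<open>n \<ge> 1\<close> forget their past exponentially, so they are small on the last unit of the window.
  Somewhere in that unit g is small pointwise, hence y is small, and hence so is the mean \<open>a 0 / \<pi>\<close>, which is
  y minus the other modes. From there to the end of the window the mean moves only by \<open>\<integral> \<bar>g\<bar>\<close>.\<close>

lemma small_input_small_modes:
  assumes \<beta>: "0 < \<beta>" and C: "0 \<le> C" and \<eta>: "0 < \<eta>"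
  obtains L \<kappa> where "1 \<le> L" "0 < \<kappa>"
    "\<And>a y t n. thermostat_modes \<beta> C a y \<Longrightarrow> L \<le> t \<Longrightarrow>
       integral {t - L..t} (\<lambda>r. (tanh (\<beta> * y r))\<^sup>2) \<le> \<kappa> \<Longrightarrow> \<bar>a n t\<bar> \<le> \<eta>"
proof -
  \<comment> \<open>bounding y and the sum over \<open>n \<ge> 1\<close> of all \<open>\<bar>a n\<bar>\<close> by \<open>\<eta>1\<close> gives \<open>\<bar>a 0\<bar> \<le> 2 \<pi> \<eta>1 \<le> \<eta> / 2\<close>\<close>
  define \<eta>1 where "\<eta>1 = \<eta> / 16"
  have \<eta>1: "0 < \<eta>1" using \<eta> by (simp add: \<eta>1_def)
  have C1: "0 \<le> C + 1" using C by simp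
  obtain \<delta>0 where \<delta>0: "0 < \<delta>0" and small_sum:
    "\<forall>f. (\<forall>n. 0 \<le> f n \<and> f n \<le> \<delta>0 * (1 + (real n)\<^sup>2) \<and> (1 \<le> n \<longrightarrow> f n \<le> (C + 1) / (real n)\<^sup>2))
      \<longrightarrow> summable f \<and> suminf f \<le> \<eta>1"
    using small_series[OF C1 \<eta>1] by blast
  define \<delta> where "\<delta> = min \<delta>0 (\<eta> / 2)"
  have \<delta>: "0 < \<delta>" "\<delta> \<le> \<delta>0" "\<delta> \<le> \<eta> / 2" using \<delta>0 \<eta> by (auto simp: \<delta>_def)
  define \<mu> where "\<mu> = \<delta> / 3"
  have \<mu>: "0 < \<mu>" using \<delta> by (simp add: \<mu>_def)
  define \<tau> where "\<tau> = tanh (\<beta> * \<eta>1)"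
  have \<tau>: "0 < \<tau>" using \<beta> \<eta>1 by (simp add: \<tau>_def)
  define \<kappa> where "\<kappa> = min (\<mu> * \<mu>) (\<tau>\<^sup>2 / 2)"
  have \<kappa>: "0 < \<kappa>" "\<kappa> \<le> \<mu> * \<mu>" "2 * \<kappa> \<le> \<tau>\<^sup>2" using \<mu> \<tau> by (auto simp: \<kappa>_def)
  have \<kappa>\<mu>: "\<kappa> / \<mu> \<le> \<mu>" using \<kappa> \<mu> by (simp add: divide_le_eq)
  define M where "M = (C + 1) / \<mu>"
  have M: "0 < M" using C \<mu> by (simp add: M_def)
  show ?thesis
  proof (rule that[of "1 + M" \<kappa>])
    fix a y t n
    assume m: "thermostat_modes \<beta> C a y" and t: "1 + M \<le> t"
      and I: "integral {t - (1 + M)..t} (\<lambda>r. (tanh (\<beta> * y r))\<^sup>2) \<le> \<kappa>"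
    interpret thermostat_modes \<beta> C a y by (rule m)
    have I: "integral {t - (1 + M)..t} (\<lambda>r. (g r)\<^sup>2) \<le> \<kappa>" using I by (simp add: g_def)
    have sub: "integral {r..s} (\<lambda>r. (g r)\<^sup>2) \<le> \<kappa>" if "t - (1 + M) \<le> r" "s \<le> t" for r s
    proof -
      have "integral {r..s} (\<lambda>r. (g r)\<^sup>2) \<le> integral {t - (1 + M)..t} (\<lambda>r. (g r)\<^sup>2)"
        using that t by (intro integral_subset_le gsq_integrable) auto
      then show ?thesis using I by linarith
    qed
    have small: "\<bar>a n s\<bar> \<le> \<delta>" if n: "1 \<le> n" and s: "t - 1 \<le> s" "s \<le> t" for n s
    proof -
      define r where "r = t - (1 + M)"
      have r: "0 \<le> r" "r \<le> s" "M \<le> s - r" using t s M by (auto simp: r_def)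
      have "\<bar>a n s\<bar> \<le> exp (- (s - r)) * (C + 1) + \<mu> + integral {r..s} (\<lambda>r. (g r)\<^sup>2) / \<mu>"
        by (rule a_bound_L2[OF n r(1,2) \<mu>])
      moreover have "integral {r..s} (\<lambda>r. (g r)\<^sup>2) / \<mu> \<le> \<kappa> / \<mu>"
        using sub[of r s] s \<mu> by (intro divide_right_mono) (auto simp: r_def)
      moreover have "exp (- (s - r)) * (C + 1) \<le> \<mu>"
      proof -
        have "M \<le> exp (s - r)" using exp_ge_add_one_self[of "s - r"] r(3) by linarith
        then have "exp (- (s - r)) \<le> 1 / M"
          using le_imp_inverse_le[OF _ M] unfolding exp_minus by (simp add: divide_inverse)
        then have "exp (- (s - r)) * (C + 1) \<le> 1 / M * (C + 1)" using C by (intro mult_right_mono) auto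
        also have "\<dots> = \<mu>" using C \<mu> by (simp add: M_def)
        finally show ?thesis .
      qed
      ultimately show ?thesis using \<kappa>\<mu> by (simp add: \<mu>_def)
    qed
    have "\<exists>s\<in>{t - 1..t}. (g s)\<^sup>2 \<le> 2 * \<kappa>"
    proof (rule ccontr)
      assume "\<not> ?thesis"
      then have "2 * \<kappa> \<le> (g r)\<^sup>2" if "r \<in> {t - 1..t}" for r using that by force
      then have "integral {t - 1..t} (\<lambda>r. 2 * \<kappa>) \<le> integral {t - 1..t} (\<lambda>r. (g r)\<^sup>2)"
        using t M by (intro integral_le gsq_integrable) auto
      then show False using sub[of "t - 1" t] M \<kappa> by simp
    qed
    then obtain s where s: "t - 1 \<le> s" "s \<le> t" "(g s)\<^sup>2 \<le> 2 * \<kappa>" by auto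
    have s0: "0 \<le> s" using s t M by linarith
    have "\<bar>y s\<bar> \<le> \<eta>1"
    proof -
      have "\<bar>g s\<bar>\<^sup>2 \<le> \<tau>\<^sup>2" using s(3) \<kappa>(3) by simp
      then have "\<bar>g s\<bar> \<le> \<tau>" using \<tau> by (rule power2_le_imp_le[OF _ less_imp_le])
      then have "tanh \<bar>\<beta> * y s\<bar> \<le> tanh (\<beta> * \<eta>1)" by (simp add: g_def \<tau>_def tanh_real_abs)
      then show ?thesis using \<beta> by (simp add: tanh_real_le_iff abs_mult)
    qed
    moreover have "\<bar>y s - a 0 s / pi\<bar> \<le> \<eta>1"
    proof -
      define f where "f n = (if n = 0 then 0 else \<bar>a n s\<bar>)" for n
      have "summable f \<and> suminf f \<le> \<eta>1"
      proof (rule small_sum[rule_format], intro conjI impI)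
        fix n :: nat
        show "0 \<le> f n" by (simp add: f_def)
        have "\<delta> * 1 \<le> \<delta>0 * (1 + (real n)\<^sup>2)" using \<delta> by (intro mult_mono) auto
        then show "f n \<le> \<delta>0 * (1 + (real n)\<^sup>2)" using small[of n s] s \<delta>0 by (auto simp: f_def)
        show "f n \<le> (C + 1) / (real n)\<^sup>2" if "1 \<le> n" using a_bound[OF that s0] that by (simp add: f_def)
      qed
      then show ?thesis using y_minus_mean[OF s0] unfolding f_def[abs_def] by linarith
    qed
    ultimately have "\<bar>a 0 s / pi\<bar> \<le> 2 * \<eta>1" by linarith
    then have "\<bar>a 0 s\<bar> \<le> 2 * \<eta>1 * pi" by (simp add: divide_le_eq)
    also have "\<dots> \<le> 2 * \<eta>1 * 4" using pi_less_4 \<eta>1 by (intro mult_left_mono) auto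
    finally have 1: "\<bar>a 0 s\<bar> \<le> \<eta> / 2" by (simp add: \<eta>1_def)
    have 2: "\<bar>a 0 t - a 0 s\<bar> \<le> \<delta>"
    proof -
      have v: "(g has_integral (a 0 s - a 0 t)) {s..t}"
        using variation_of_constants[OF s0 s(2), of 0] by simp
      have "norm (integral {s..t} g) \<le> integral {s..t} (\<lambda>r. \<mu> + (g r)\<^sup>2 / \<mu>)"
        by (rule integral_norm_bound_integral)
           (use v abs_g_le[OF \<mu>] gsq_integrable[OF s0] in \<open>auto simp: has_integral_iff intro!: integrable_add integrable_on_divide\<close>)
      also have "\<dots> = integral {s..t} (\<lambda>r. \<mu>) + integral {s..t} (\<lambda>r. (g r)\<^sup>2 / \<mu>)"
        by (rule integral_add) (auto intro!: integrable_on_divide gsq_integrable[OF s0])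
      also have "\<dots> = \<mu> * (t - s) + integral {s..t} (\<lambda>r. (g r)\<^sup>2) / \<mu>" using s by simp
      also have "\<dots> \<le> \<mu> * 1 + \<kappa> / \<mu>"
        using s \<mu> M sub[of s t] by (intro add_mono mult_left_mono divide_right_mono) auto
      also have "\<dots> \<le> \<delta>" using \<kappa>\<mu> \<delta> by (simp add: \<mu>_def)
      finally show ?thesis using v by (simp add: has_integral_iff)
    qed
    show "\<bar>a n t\<bar> \<le> \<eta>"
    proof (cases "n = 0")
      case True
      show ?thesis unfolding True using 1 2 \<delta> by linarith
    next
      case False
      then show ?thesis using small[of n t] \<delta> \<eta> by simp
    qed
  qed (use M \<kappa> in auto)
qed

context thermostat_modes begin

lemma a_summable: "0 \<le> t \<Longrightarrow> summable (\<lambda>n. \<bar>a n t\<bar>)"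
proof (rule summable_comparison_test'[of "\<lambda>n. (C + 1) * (1 / (real n)\<^sup>2)" 1])
  show "summable (\<lambda>n. (C + 1) * (1 / (real n)\<^sup>2))" by (rule summable_mult[OF sums_summable[OF squares_all]])
qed (use a_bound in auto)

text \<open>By Parseval's identity this is the squared L2 norm.\<close>

definition V :: "real \<Rightarrow> real" where "V t = (\<Sum>n. wt n * (a n t)\<^sup>2)"

lemma V_summable:
  assumes "0 \<le> t" shows "summable (\<lambda>n. wt n * (a n t)\<^sup>2)"
proof (rule summable_comparison_test'[of "\<lambda>n. (C + 1) * \<bar>a n t\<bar>" 1])
  show "summable (\<lambda>n. (C + 1) * \<bar>a n t\<bar>)" by (rule summable_mult[OF a_summable[OF assms]])
  fix n :: nat assume n: "1 \<le> n"
  have "(C + 1) / (real n)\<^sup>2 \<le> (C + 1) / 1" using n C by (intro divide_left_mono) auto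
  then have "\<bar>a n t\<bar> \<le> C + 1" using a_bound[OF n assms] by simp
  then have "\<bar>a n t\<bar> * \<bar>a n t\<bar> \<le> (C + 1) * \<bar>a n t\<bar>" by (intro mult_right_mono) auto
  then have "wt n * (\<bar>a n t\<bar> * \<bar>a n t\<bar>) \<le> 1 * ((C + 1) * \<bar>a n t\<bar>)" using wt_le[of n] wt_nonneg[of n] C by (intro mult_mono[OF wt_le]) auto
  then show "norm (wt n * (a n t)\<^sup>2) \<le> (C + 1) * \<bar>a n t\<bar>"
    using wt_nonneg[of n] by (simp add: power2_eq_square)
qed

text \<open>For odd n the difference \<open>u(\<pi>) - u(0)\<close> contributes \<open>- 2 w\<^sub>n a\<^sub>n\<close>. Its product with g is absorbed mode by mode into the
  dissipation \<open>n\<^sup>2 a\<^sub>n\<^sup>2\<close>, leaving \<open>g\<^sup>2 / n\<^sup>2\<close>, and \<open>\<Sum> 1 / n\<^sup>2 = \<pi>\<^sup>2 / 8\<close> over odd n gives the constant \<open>\<pi> / 4\<close>.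
  The estimate is made for finitely many modes, which may be differentiated term by term.\<close>

lemma V_decreasing:
  assumes s: "0 \<le> s" "s \<le> t"
  shows "V t + 2 * (1 / \<beta> - pi / 4) * integral {s..t} (\<lambda>r. (g r)\<^sup>2) \<le> V s"
proof -
  define \<epsilon> where "\<epsilon> = 1 / \<beta> - pi / 4"
  define W where "W N r = (\<Sum>n<N. wt n * (a n r)\<^sup>2)" for N r
  define W' where "W' N r = (\<Sum>n<N. wt n * (2 * a n r * (- (real n)\<^sup>2 * a n r - g r)))" for N r
  define \<rho> where "\<rho> N = (\<Sum>n. (C + 1) * (1 / (real (n + N))\<^sup>2))" for N
  have sC: "summable (\<lambda>n. (C + 1) * (1 / (real n)\<^sup>2))" by (rule summable_mult[OF sums_summable[OF squares_all]])
  have \<rho>0: "\<rho> \<longlonglongrightarrow> 0" unfolding \<rho>_def[abs_def] by (rule suminf_exist_split2[OF sC])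
  have W'_le: "W' N r \<le> - 2 * \<epsilon> * (g r)\<^sup>2 + 2 * \<rho> N" if N: "1 \<le> N" and r: "0 \<le> r" for N r
  proof -
    define yN where "yN = (\<Sum>n<N. wt n * (-1) ^ n * a n r)"
    have yN: "\<bar>y r - yN\<bar> \<le> \<rho> N"
    proof -
      have "y r - yN = (\<Sum>n. wt (n + N) * (-1) ^ (n + N) * a (n + N) r)"
        using suminf_split_initial_segment[OF sums_summable[OF y_sum[OF r]], of N] sums_unique[OF y_sum[OF r]]
        by (simp add: yN_def)
      moreover have "norm (\<Sum>n. wt (n + N) * (-1) ^ (n + N) * a (n + N) r) \<le> (\<Sum>n. (C + 1) * (1 / (real (n + N))\<^sup>2))"
      proof (rule norm_suminf_le)
        fix n
        have "\<bar>wt (n + N) * (-1) ^ (n + N) * a (n + N) r\<bar> = wt (n + N) * \<bar>a (n + N) r\<bar>"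
          using wt_nonneg[of "n + N"] by (simp add: abs_mult power_abs)
        also have "\<dots> \<le> 1 * ((C + 1) / (real (n + N))\<^sup>2)"
          using N C by (intro mult_mono wt_le a_bound[OF _ r]) auto
        finally show "norm (wt (n + N) * (-1) ^ (n + N) * a (n + N) r) \<le> (C + 1) * (1 / (real (n + N))\<^sup>2)" by simp
        show "summable (\<lambda>n. (C + 1) * (1 / (real (n + N))\<^sup>2))" by (rule summable_ignore_initial_segment[OF sC])
      qed
      ultimately show ?thesis by (simp add: \<rho>_def)
    qed
    have modewise: "- wt n * a n r * g r + wt n * (-1) ^ n * a n r * g r \<le> wt n * (real n)\<^sup>2 * (a n r)\<^sup>2 + (2 / pi) * (if odd n then 1 / (real n)\<^sup>2 else 0) * (g r)\<^sup>2" for n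
    proof (cases "odd n")
      case False
      then show ?thesis using wt_nonneg[of n] by simp
    next
      case True
      then have n: "0 < real n" by (auto elim: oddE)
      have w: "wt n = 2 / pi" using n by (simp add: wt_def)
      have "0 \<le> (real n * a n r + g r / real n)\<^sup>2" by simp
      also have "\<dots> = (real n)\<^sup>2 * (a n r)\<^sup>2 + (g r)\<^sup>2 / (real n)\<^sup>2 + 2 * a n r * g r"
        using n by (simp add: power2_sum power_mult_distrib power_divide)
      finally have "wt n * 0 \<le> wt n * ((real n)\<^sup>2 * (a n r)\<^sup>2 + (g r)\<^sup>2 / (real n)\<^sup>2 + 2 * a n r * g r)"
        using wt_nonneg[of n] by (intro mult_left_mono) auto
      then show ?thesis using True unfolding w by (simp add: algebra_simps)
    qed
    have "(\<Sum>n<N. - wt n * a n r * g r + wt n * (-1) ^ n * a n r * g r)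
        \<le> (\<Sum>n<N. wt n * (real n)\<^sup>2 * (a n r)\<^sup>2 + (2 / pi) * (if odd n then 1 / (real n)\<^sup>2 else 0) * (g r)\<^sup>2)"
      by (rule sum_mono[OF modewise])
    also have "\<dots> = (\<Sum>n<N. wt n * (real n)\<^sup>2 * (a n r)\<^sup>2) + (2 / pi) * (\<Sum>n<N. if odd n then 1 / (real n)\<^sup>2 else 0) * (g r)\<^sup>2"
      by (simp add: sum.distrib sum_distrib_left sum_distrib_right)
    finally have 0: "(\<Sum>n<N. - wt n * a n r * g r + wt n * (-1) ^ n * a n r * g r)
        \<le> (\<Sum>n<N. wt n * (real n)\<^sup>2 * (a n r)\<^sup>2) + (2 / pi) * (\<Sum>n<N. if odd n then 1 / (real n)\<^sup>2 else 0) * (g r)\<^sup>2" .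
    have "(\<Sum>n<N. if odd n then 1 / (real n)\<^sup>2 else 0) \<le> pi\<^sup>2 / 8"
      using sum_le_suminf[OF sums_summable[OF squares_odd], of "{..<N}"] sums_unique[OF squares_odd] by simp
    then have "(2 / pi) * (\<Sum>n<N. if odd n then 1 / (real n)\<^sup>2 else 0) * (g r)\<^sup>2 \<le> (2 / pi) * (pi\<^sup>2 / 8) * (g r)\<^sup>2"
      by (intro mult_right_mono mult_left_mono) auto
    also have "\<dots> = pi / 4 * (g r)\<^sup>2" by (simp add: power2_eq_square)
    finally have 1: "(\<Sum>n<N. - wt n * a n r * g r + wt n * (-1) ^ n * a n r * g r) \<le> (\<Sum>n<N. wt n * (real n)\<^sup>2 * (a n r)\<^sup>2) + pi / 4 * (g r)\<^sup>2"
      using 0 by linarith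
    have 2: "W' N r = 2 * ((\<Sum>n<N. - wt n * a n r * g r + wt n * (-1) ^ n * a n r * g r) - (\<Sum>n<N. wt n * (real n)\<^sup>2 * (a n r)\<^sup>2) - yN * g r)"
      unfolding W'_def yN_def
      by (simp add: sum.distrib sum_distrib_left sum_distrib_right sum_subtractf[symmetric])
         (rule sum.cong; simp add: algebra_simps power2_eq_square)
    have "yN * g r \<ge> y r * g r - \<rho> N"
    proof -
      have "\<bar>(y r - yN) * g r\<bar> \<le> \<rho> N * 1" unfolding abs_mult using yN g_bound(1) by (intro mult_mono) auto
      then show ?thesis by (simp add: left_diff_distrib)
    qed
    moreover have "(g r)\<^sup>2 / \<beta> \<le> y r * g r" using sector[of r] by (simp add: mult.commute)
    ultimately have "W' N r \<le> 2 * (pi / 4 * (g r)\<^sup>2 - ((g r)\<^sup>2 / \<beta> - \<rho> N))" using 1 2 by argo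
    then show ?thesis by (simp add: \<epsilon>_def algebra_simps)
  qed
  have W'i: "(W' N has_integral (W N t - W N s)) {s..t}" for N
  proof (rule fundamental_theorem_of_calculus[OF s(2)])
    fix r assume r: "r \<in> {s..t}"
    have "(W N has_real_derivative W' N r) (at r within {s..t})"
      unfolding W_def[abs_def] W'_def
      by (auto intro!: derivative_eq_intros a_deriv[OF s(1) r] sum.cong)
    then show "(W N has_vector_derivative W' N r) (at r within {s..t})"
      by (simp add: has_real_derivative_iff_has_vector_derivative)
  qed
  have fin: "W N t - W N s \<le> - 2 * \<epsilon> * integral {s..t} (\<lambda>r. (g r)\<^sup>2) + 2 * \<rho> N * (t - s)" if N: "1 \<le> N" for N
  proof -
    have "((\<lambda>r. - 2 * \<epsilon> * (g r)\<^sup>2 + 2 * \<rho> N) has_integral (- 2 * \<epsilon> * integral {s..t} (\<lambda>r. (g r)\<^sup>2) + 2 * \<rho> N * (t - s))) {s..t}"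
      using has_integral_const_real[of "2 * \<rho> N" s t] s
      by (intro has_integral_add has_integral_mult_right integrable_integral gsq_integrable) (auto simp: mult_ac)
    from has_integral_le[OF W'i this] W'_le[OF N] s show ?thesis by auto
  qed
  have lim: "(\<lambda>N. W N r) \<longlonglongrightarrow> V r" if "0 \<le> r" for r
    unfolding W_def V_def by (rule summable_LIMSEQ[OF V_summable[OF that]])
  have "V t - V s \<le> - 2 * \<epsilon> * integral {s..t} (\<lambda>r. (g r)\<^sup>2) + 2 * 0 * (t - s)"
  proof (rule LIMSEQ_le)
    show "(\<lambda>N. W N t - W N s) \<longlonglongrightarrow> V t - V s" using s by (intro tendsto_diff lim) auto
    show "(\<lambda>N. - 2 * \<epsilon> * integral {s..t} (\<lambda>r. (g r)\<^sup>2) + 2 * \<rho> N * (t - s)) \<longlonglongrightarrow> - 2 * \<epsilon> * integral {s..t} (\<lambda>r. (g r)\<^sup>2) + 2 * 0 * (t - s)"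
      by (intro tendsto_intros \<rho>0)
    show "\<exists>N. \<forall>n\<ge>N. W n t - W n s \<le> - 2 * \<epsilon> * integral {s..t} (\<lambda>r. (g r)\<^sup>2) + 2 * \<rho> n * (t - s)"
      using fin by blast
  qed
  then show ?thesis by (simp add: \<epsilon>_def algebra_simps)
qed

lemma V_nonneg: "0 \<le> t \<Longrightarrow> 0 \<le> V t"
  unfolding V_def by (intro suminf_nonneg V_summable) (simp_all add: wt_nonneg)

lemma a_square_le_V: "0 \<le> t \<Longrightarrow> (a n t)\<^sup>2 \<le> 4 * V t"
proof -
  assume t: "0 \<le> t"
  have "wt n * (a n t)\<^sup>2 \<le> V t"
    using sum_le_suminf[OF V_summable[OF t], of "{n}"] by (simp add: V_def wt_nonneg)
  moreover have "1 / 4 * (a n t)\<^sup>2 \<le> wt n * (a n t)\<^sup>2"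
    using pi_less_4 pi_gt_zero by (intro mult_right_mono) (auto simp: wt_def field_simps)
  ultimately show ?thesis by linarith
qed

lemma V_le_suminf:
  assumes t: "0 \<le> t" and s: "summable (\<lambda>n. (a n t)\<^sup>2)"
  shows "V t \<le> (\<Sum>n. (a n t)\<^sup>2)"
  unfolding V_def
proof (rule suminf_le[OF _ V_summable[OF t] s])
  show "wt n * (a n t)\<^sup>2 \<le> (a n t)\<^sup>2" for n
    using mult_right_mono[OF wt_le[of n], of "(a n t)\<^sup>2"] by simp
qed

lemma a_square_le: "1 \<le> n \<Longrightarrow> 0 \<le> t \<Longrightarrow> (a n t)\<^sup>2 \<le> (C + 1)\<^sup>2 / (real n)\<^sup>2"
proof -
  assume n: "1 \<le> n" and t: "0 \<le> t"
  have "\<bar>a n t\<bar>\<^sup>2 \<le> ((C + 1) / (real n)\<^sup>2)\<^sup>2"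
    by (intro power_mono a_bound n t) simp
  also have "\<dots> = (C + 1)\<^sup>2 / ((real n)\<^sup>2 * (real n)\<^sup>2)" by (simp add: power_divide power2_eq_square)
  also have "\<dots> \<le> (C + 1)\<^sup>2 / ((real n)\<^sup>2 * 1)"
    using n by (intro divide_left_mono mult_left_mono) auto
  finally show ?thesis by simp
qed

lemma V0_le: "V 0 \<le> C\<^sup>2 + (C + 1)\<^sup>2 * (pi\<^sup>2 / 6)"
proof -
  define f where "f n = (if n = 0 then C\<^sup>2 else 0) + (C + 1)\<^sup>2 * (1 / (real n)\<^sup>2)" for n :: nat
  have f: "f sums (C\<^sup>2 + (C + 1)\<^sup>2 * (pi\<^sup>2 / 6))"
    unfolding f_def[abs_def] by (intro sums_add sums_single sums_mult squares_all)
  have b: "(a n 0)\<^sup>2 \<le> f n" for n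
  proof (cases "n = 0")
    case True
    then show ?thesis using power_mono[OF init0, of 2] by (simp add: f_def)
  next
    case False
    then show ?thesis using a_square_le[of n 0] by (simp add: f_def)
  qed
  have s: "summable (\<lambda>n. (a n 0)\<^sup>2)"
    by (rule summable_comparison_test'[OF sums_summable[OF f]]) (use b in auto)
  have "V 0 \<le> (\<Sum>n. (a n 0)\<^sup>2)" by (rule V_le_suminf[OF _ s]) simp
  also have "\<dots> \<le> suminf f" by (rule suminf_le[OF b s sums_summable[OF f]])
  finally show ?thesis using sums_unique[OF f] by simp
qed

end

text \<open>Pigeonhole: the total input is bounded, so one among boundedly many windows has little input. At its end
  all modes are small, hence so is V, which is monotone and keeps them small.\<close>

lemma uniform_decay:
  assumes \<beta>: "0 < \<beta>" "\<beta> < 4 / pi" and C: "0 \<le> C" and \<eta>: "0 < \<eta>"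
  shows "\<exists>T\<ge>0. \<forall>a y t n. thermostat_modes \<beta> C a y \<longrightarrow> T \<le> t \<longrightarrow> \<bar>a n t\<bar> \<le> \<eta>"
proof -
  define \<epsilon> where "\<epsilon> = 2 * (1 / \<beta> - pi / 4)"
  have \<epsilon>: "0 < \<epsilon>" using \<beta> by (simp add: \<epsilon>_def field_simps)
  have \<eta>4: "0 < \<eta>\<^sup>2 / 4" using \<eta> by simp
  obtain \<delta> where \<delta>: "0 < \<delta>" and small_sum:
    "\<forall>f. (\<forall>n. 0 \<le> f n \<and> f n \<le> \<delta> * (1 + (real n)\<^sup>2) \<and> (1 \<le> n \<longrightarrow> f n \<le> (C + 1)\<^sup>2 / (real n)\<^sup>2))
      \<longrightarrow> summable f \<and> suminf f \<le> \<eta>\<^sup>2 / 4"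
    using small_series[OF _ \<eta>4, of "(C + 1)\<^sup>2"] by auto
  define \<eta>' where "\<eta>' = min 1 \<delta>"
  have \<eta>': "0 < \<eta>'" "\<eta>' \<le> 1" "\<eta>' \<le> \<delta>" using \<delta> by (auto simp: \<eta>'_def)
  obtain L \<kappa> where L: "1 \<le> L" and \<kappa>: "0 < \<kappa>" and window:
    "\<And>a y t n. thermostat_modes \<beta> C a y \<Longrightarrow> L \<le> t \<Longrightarrow>
       integral {t - L..t} (\<lambda>r. (tanh (\<beta> * y r))\<^sup>2) \<le> \<kappa> \<Longrightarrow> \<bar>a n t\<bar> \<le> \<eta>'"
    using small_input_small_modes[OF \<beta>(1) C \<eta>'(1)] by metis
  define V0 where "V0 = C\<^sup>2 + (C + 1)\<^sup>2 * (pi\<^sup>2 / 6)"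
  obtain k :: nat where k: "V0 / (\<epsilon> * \<kappa>) < real k" using reals_Archimedean2 by blast
  have "\<bar>a n t\<bar> \<le> \<eta>" if m: "thermostat_modes \<beta> C a y" and t: "real k * L \<le> t" for a y t n
  proof -
    interpret thermostat_modes \<beta> C a y by (rule m)
    have "\<exists>i<k. integral {real i * L..real (Suc i) * L} (\<lambda>r. (g r)\<^sup>2) \<le> \<kappa>"
    proof (rule ccontr)
      assume neg: "\<not> ?thesis"
      have "real j * \<kappa> \<le> integral {0..real j * L} (\<lambda>r. (g r)\<^sup>2)" if "j \<le> k" for j
        using that
      proof (induction j)
        case (Suc j)
        then have "\<kappa> \<le> integral {real j * L..real (Suc j) * L} (\<lambda>r. (g r)\<^sup>2)" using neg by (metis Suc_le_lessD linear)
        moreover have "integral {0..real j * L} (\<lambda>r. (g r)\<^sup>2) + integral {real j * L..real (Suc j) * L} (\<lambda>r. (g r)\<^sup>2)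
           = integral {0..real (Suc j) * L} (\<lambda>r. (g r)\<^sup>2)"
          using L by (intro Henstock_Kurzweil_Integration.integral_combine gsq_integrable) (auto simp: mult_right_mono)
        ultimately show ?case using Suc by (simp add: algebra_simps)
      qed simp
      then have "real k * \<kappa> \<le> integral {0..real k * L} (\<lambda>r. (g r)\<^sup>2)" by blast
      moreover have "\<epsilon> * integral {0..real k * L} (\<lambda>r. (g r)\<^sup>2) \<le> V0"
        using V_decreasing[of 0 "real k * L"] V0_le V_nonneg[of "real k * L"] L by (simp add: \<epsilon>_def V0_def)
      ultimately have "\<epsilon> * (real k * \<kappa>) \<le> V0" using \<epsilon> by (meson mult_left_mono less_imp_le order_trans)
      then show False using k \<epsilon> \<kappa> by (simp add: field_simps)
    qed
    then obtain i where i: "i < k" "integral {real i * L..real (Suc i) * L} (\<lambda>r. (g r)\<^sup>2) \<le> \<kappa>" by blast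
    define t0 where "t0 = real (Suc i) * L"
    have t0: "L \<le> t0" "t0 \<le> t"
    proof -
      show "L \<le> t0" using L by (simp add: t0_def)
      have "real (Suc i) * L \<le> real k * L" using i L by (intro mult_right_mono) auto
      then show "t0 \<le> t" using t by (simp add: t0_def)
    qed
    have "t0 - L = real i * L" by (simp add: t0_def algebra_simps)
    then have sm: "\<bar>a n t0\<bar> \<le> \<eta>'" for n
      using window[OF m t0(1)] i(2) by (simp add: t0_def g_def)
    have "summable (\<lambda>n. (a n t0)\<^sup>2) \<and> (\<Sum>n. (a n t0)\<^sup>2) \<le> \<eta>\<^sup>2 / 4"
    proof (rule small_sum[rule_format], intro conjI impI)
      fix n :: nat
      show "0 \<le> (a n t0)\<^sup>2" by simp
      have "\<bar>a n t0\<bar>\<^sup>2 \<le> \<eta>'\<^sup>2" by (intro power_mono sm) simp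
      also have "\<dots> \<le> \<eta>' * 1" unfolding power2_eq_square using \<eta>' by (intro mult_left_mono) auto
      also have "\<dots> \<le> \<delta> * (1 + (real n)\<^sup>2)" using \<eta>' \<delta> by (intro mult_mono) auto
      finally show "(a n t0)\<^sup>2 \<le> \<delta> * (1 + (real n)\<^sup>2)" by simp
      show "(a n t0)\<^sup>2 \<le> (C + 1)\<^sup>2 / (real n)\<^sup>2" if "1 \<le> n" by (rule a_square_le[OF that]) (use t0 L in simp)
    qed
    then have "V t0 \<le> \<eta>\<^sup>2 / 4" using V_le_suminf[of t0] t0 L by force
    moreover have "V t \<le> V t0"
    proof -
      have "0 \<le> integral {t0..t} (\<lambda>r. (g r)\<^sup>2)" using t0 L by (intro integral_nonneg gsq_integrable) auto
      then have "0 \<le> \<epsilon> * integral {t0..t} (\<lambda>r. (g r)\<^sup>2)" using \<epsilon> by simp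
      then show ?thesis using V_decreasing[of t0 t] t0 L by (simp add: \<epsilon>_def)
    qed
    ultimately have "(a n t)\<^sup>2 \<le> \<eta>\<^sup>2" using a_square_le_V[of t n] t0 L by simp
    then show ?thesis using \<eta> by (simp add: abs_le_square_iff[symmetric])
  qed
  moreover have "0 \<le> real k * L" using L by simp
  ultimately show ?thesis by blast
qed

section \<open>Periodic decomposition of the modes\<close>

text \<open>A convex primitive of \<open>tanh (\<beta> z)\<close>.\<close>

definition Psi :: "real \<Rightarrow> real \<Rightarrow> real" where "Psi \<beta> z = ln (cosh (\<beta> * z)) / \<beta>"

lemma Psi_deriv: "\<beta> \<noteq> 0 \<Longrightarrow> (Psi \<beta> has_real_derivative tanh (\<beta> * z)) (at z)"
  unfolding Psi_def[abs_def]
  by (auto intro!: derivative_eq_intros simp: cosh_real_pos cosh_real_nonzero tanh_def field_simps)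

lemma Psi_nonneg: "0 < \<beta> \<Longrightarrow> 0 \<le> Psi \<beta> z"
  unfolding Psi_def by (intro divide_nonneg_pos ln_ge_zero cosh_real_ge_1)

lemma continuous_on_Psi: "\<beta> \<noteq> 0 \<Longrightarrow> continuous_on S (Psi \<beta>)"
  by (rule DERIV_continuous_on, rule has_field_derivative_at_within, rule Psi_deriv)

lemma Psi_tangent:
  assumes \<beta>: "0 < \<beta>"
  shows "Psi \<beta> u - Psi \<beta> v \<le> tanh (\<beta> * u) * (u - v)"
proof -
  define f where "f z = Psi \<beta> z - tanh (\<beta> * u) * z" for z
  have d: "(f has_real_derivative tanh (\<beta> * z) - tanh (\<beta> * u)) (at z)" for z
    unfolding f_def[abs_def] using \<beta> by (auto intro!: derivative_eq_intros Psi_deriv)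
  have "f u \<le> f v"
  proof (cases "v \<le> u")
    case True
    then show ?thesis
    proof (rule DERIV_nonpos_imp_nonincreasing)
      fix z assume "v \<le> z" "z \<le> u"
      then show "\<exists>y. (f has_real_derivative y) (at z) \<and> y \<le> 0"
        using \<beta> by (intro exI[of _ "tanh (\<beta> * z) - tanh (\<beta> * u)"] conjI d) simp
    qed
  next
    case False
    then have "u \<le> v" by simp
    then show ?thesis
    proof (rule DERIV_nonneg_imp_nondecreasing)
      fix z assume "u \<le> z" "z \<le> v"
      then show "\<exists>y. (f has_real_derivative y) (at z) \<and> 0 \<le> y"
        using \<beta> by (intro exI[of _ "tanh (\<beta> * z) - tanh (\<beta> * u)"] conjI d) simp
    qed
  qed
  then show ?thesis by (simp add: f_def algebra_simps)
qed

lemma has_integral_exp_decay: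
  "a \<le> b \<Longrightarrow> ((\<lambda>t::real. exp (- (t - c))) has_integral (exp (- (a - c)) - exp (- (b - c)))) {a..b}"
proof -
  assume ab: "a \<le> b"
  have "((\<lambda>t::real. exp (- (t - c))) has_integral (- exp (- (b - c)) - - exp (- (a - c)))) {a..b}"
  proof (rule fundamental_theorem_of_calculus[OF ab])
    fix t
    have "((\<lambda>t. - exp (- (t - c))) has_real_derivative exp (- (t - c))) (at t within {a..b})"
      by (auto intro!: derivative_eq_intros)
    then show "((\<lambda>t. - exp (- (t - c))) has_vector_derivative exp (- (t - c))) (at t within {a..b})"
      by (simp add: has_real_derivative_iff_has_vector_derivative)
  qed
  then show ?thesis by simp
qed

context thermostat_modes begin

lemma y_cont': "0 \<le> s \<Longrightarrow> continuous_on {s..t} y"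
  by (rule continuous_on_subset[OF y_cont]) auto

text \<open>The discrete substitute for \<open>\<integral> tanh (\<beta> y) y' = Psi (y T) - Psi (y 0)\<close>: by convexity the integrand is at least
  the increment of \<open>Psi (y)\<close> over the delay h, whose integral telescopes.\<close>

lemma delayed_increment:
  assumes h: "0 < h" "h \<le> T"
  shows "- integral {0..h} (\<lambda>t. Psi \<beta> (y t)) \<le> integral {h..T} (\<lambda>t. g t * (y t - y (t - h)))"
proof -
  define \<psi> where "\<psi> t = Psi \<beta> (y t)" for t
  have \<psi>c: "continuous_on {s..t} \<psi>" if "0 \<le> s" for s t
    unfolding \<psi>_def[abs_def] using beta
    by (intro continuous_on_compose2[OF continuous_on_Psi y_cont'[OF that]]) auto
  note \<psi>i = integrable_continuous_real[OF \<psi>c]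
  have yh: "continuous_on {h..T} (\<lambda>t. y (t - h))"
    by (intro continuous_on_compose2[OF y_cont] continuous_intros) auto
  have \<psi>h: "continuous_on {h..T} (\<lambda>t. \<psi> (t - h))"
    by (intro continuous_on_compose2[OF \<psi>c[of 0 T]] continuous_intros) (use h in auto)
  have "integral {h..T} (\<lambda>t. \<psi> (t - h)) = integral {h..T} (\<psi> \<circ> (+) (- h))" by (simp add: o_def)
  also have "\<dots> = integral {0..T - h} \<psi>" by (subst integral_shift_Icc_real) simp
  also have "\<dots> \<le> integral {0..T} \<psi>"
    using h Psi_nonneg[OF beta] by (intro integral_subset_le \<psi>i) (auto simp: \<psi>_def)
  also have "\<dots> = integral {0..h} \<psi> + integral {h..T} \<psi>"
    using h by (intro Henstock_Kurzweil_Integration.integral_combine[symmetric] \<psi>i) auto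
  finally have "- integral {0..h} \<psi> \<le> integral {h..T} \<psi> - integral {h..T} (\<lambda>t. \<psi> (t - h))" by simp
  also have "\<dots> = integral {h..T} (\<lambda>t. \<psi> t - \<psi> (t - h))"
    using h by (intro integral_diff[symmetric] \<psi>i integrable_continuous_real[OF \<psi>h]) auto
  also have "\<dots> \<le> integral {h..T} (\<lambda>t. g t * (y t - y (t - h)))"
  proof (rule integral_le)
    show "(\<lambda>t. \<psi> t - \<psi> (t - h)) integrable_on {h..T}"
      using h by (intro integrable_diff \<psi>i integrable_continuous_real[OF \<psi>h]) auto
    show "(\<lambda>t. g t * (y t - y (t - h))) integrable_on {h..T}"
      using h by (intro integrable_continuous_real continuous_intros g_cont y_cont' yh) auto
    fix t show "\<psi> t - \<psi> (t - h) \<le> g t * (y t - y (t - h))"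
      unfolding \<psi>_def g_def by (rule Psi_tangent[OF beta])
  qed
  finally show ?thesis by (simp add: \<psi>_def[abs_def])
qed

lemma a0_increment: "0 \<le> s \<Longrightarrow> s \<le> t \<Longrightarrow> (g has_integral (a 0 s - a 0 t)) {s..t}"
  using variation_of_constants[of s t 0] by simp

lemma a0_lipschitz: "0 \<le> s \<Longrightarrow> s \<le> t \<Longrightarrow> \<bar>a 0 t - a 0 s\<bar> \<le> t - s"
proof -
  assume st: "0 \<le> s" "s \<le> t"
  have "norm (integral {s..t} g) \<le> integral {s..t} (\<lambda>t. 1)"
    by (rule integral_norm_bound_integral) (use a0_increment[OF st] g_bound in \<open>auto simp: has_integral_iff\<close>)
  then show ?thesis using a0_increment[OF st] st by (simp add: has_integral_iff)
qed

lemma g_a0_integral: "0 \<le> T \<Longrightarrow> ((\<lambda>t. g t * a 0 t) has_integral ((a 0 0)\<^sup>2 - (a 0 T)\<^sup>2) / 2) {0..T}"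
proof -
  assume T: "0 \<le> T"
  have "((\<lambda>t. g t * a 0 t) has_integral (- (a 0 T)\<^sup>2 / 2 - - (a 0 0)\<^sup>2 / 2)) {0..T}"
  proof (rule fundamental_theorem_of_calculus[OF T])
    fix t assume t: "t \<in> {0..T}"
    have "((\<lambda>t. - (a 0 t)\<^sup>2 / 2) has_real_derivative g t * a 0 t) (at t within {0..T})"
      using a_deriv[OF order_refl t, of 0] by (auto intro!: derivative_eq_intros)
    then show "((\<lambda>t. - (a 0 t)\<^sup>2 / 2) has_vector_derivative g t * a 0 t) (at t within {0..T})"
      by (simp add: has_real_derivative_iff_has_vector_derivative)
  qed
  then show ?thesis by (simp add: diff_divide_distrib)
qed

text \<open>The coefficient for which \<open>a n - d T n * exp (- n\<^sup>2 t)\<close> has equal values at 0 and T.\<close>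

definition d :: "real \<Rightarrow> nat \<Rightarrow> real" where
  "d T n = (a n 0 - a n T) / (1 - exp (- (real n)\<^sup>2 * T))"

text \<open>The T-periodic solution of the n-th mode equation with the given input.\<close>

definition p :: "real \<Rightarrow> nat \<Rightarrow> real \<Rightarrow> real" where
  "p T n t = a n t - d T n * exp (- (real n)\<^sup>2 * t)"

lemma d_bound:
  assumes n: "1 \<le> n" and T: "1 \<le> T"
  shows "\<bar>d T n\<bar> \<le> 4 * (C + 1) / (real n)\<^sup>2" "1 - exp (- (real n)\<^sup>2 * T) \<noteq> 0"
proof -
  define e where "e = exp (- (real n)\<^sup>2 * T)"
  \<comment> \<open>for \<open>T \<ge> 1\<close> the denominator is at least \<open>1 - exp (- 1) \<ge> 1 / 2\<close>\<close>
  have "1 * 1 \<le> (real n)\<^sup>2 * T" using n T by (intro mult_mono) auto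
  then have "e \<le> exp (- 1)" by (simp add: e_def)
  moreover have "exp (- 1 :: real) \<le> 1 / 2" using exp_ge_add_one_self[of "1::real"] by (simp add: exp_minus field_simps)
  ultimately have e: "1 / 2 \<le> 1 - e" by simp
  then have "1 - e \<noteq> 0" by linarith
  then show "1 - exp (- (real n)\<^sup>2 * T) \<noteq> 0" unfolding e_def .
  have "\<bar>a n 0 - a n T\<bar> \<le> 2 * ((C + 1) / (real n)\<^sup>2)" using a_bound[OF n, of 0] a_bound[OF n, of T] T by linarith
  then have "\<bar>a n 0 - a n T\<bar> / \<bar>1 - e\<bar> \<le> 2 * ((C + 1) / (real n)\<^sup>2) / (1 / 2)" using e C by (intro frac_le) auto
  then show "\<bar>d T n\<bar> \<le> 4 * (C + 1) / (real n)\<^sup>2" unfolding d_def e_def[symmetric] abs_divide by simp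
qed

lemma p_bound:
  assumes n: "1 \<le> n" and T: "1 \<le> T" and t: "0 \<le> t"
  shows "\<bar>p T n t\<bar> \<le> 5 * (C + 1) / (real n)\<^sup>2"
proof -
  have "\<bar>d T n * exp (- (real n)\<^sup>2 * t)\<bar> \<le> 4 * (C + 1) / (real n)\<^sup>2 * 1"
    unfolding abs_mult using t C by (intro mult_mono d_bound n T) auto
  then show ?thesis using a_bound[OF n t] by (simp add: p_def add_divide_distrib)
qed

lemma p_periodic: "1 \<le> n \<Longrightarrow> 1 \<le> T \<Longrightarrow> p T n T = p T n 0"
  using d_bound(2)[of n T] by (simp add: p_def d_def field_simps)

lemma p_deriv: "t \<in> {0..T} \<Longrightarrow> (p T n has_real_derivative - (real n)\<^sup>2 * p T n t - g t) (at t within {0..T})"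
  unfolding p_def[abs_def] using a_deriv[of 0 t T n]
  by (auto intro!: derivative_eq_intros simp: algebra_simps)

lemma p_cont: "continuous_on {0..T} (p T n)"
  by (rule DERIV_continuous_on[OF p_deriv])

text \<open>The part of the output y that comes from the periodic solutions of the modes \<open>n \<ge> 1\<close>.\<close>

definition Y :: "real \<Rightarrow> real \<Rightarrow> real" where
  "Y T t = (\<Sum>n. if n = 0 then 0 else wt n * (-1) ^ n * p T n t)"

lemma Y_term_bound:
  "1 \<le> T \<Longrightarrow> 0 \<le> t \<Longrightarrow> \<bar>if n = 0 then 0 else wt n * (-1) ^ n * p T n t\<bar> \<le> 5 * (C + 1) * (1 / (real n)\<^sup>2)"
  using mult_mono[OF wt_le[of n] p_bound[of n T t]] wt_nonneg[of n] by (auto simp: abs_mult power_abs)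

lemma Y_bound_summable: "summable (\<lambda>n. K * (1 / (real n)\<^sup>2))" for K :: real
  by (rule summable_mult[OF sums_summable[OF squares_all]])

lemma Y_term_cont: "continuous_on {0..T} (\<lambda>t. if n = 0 then 0 else wt n * (-1) ^ n * p T n t)"
  by (cases "n = 0") (auto intro!: continuous_intros p_cont)

lemma Y_cont: "1 \<le> T \<Longrightarrow> continuous_on {0..T} (Y T)"
  unfolding Y_def[abs_def]
  by (rule fcoef_series(2)[OF Y_term_cont _ Y_bound_summable[of "5 * (C + 1)"]]) (use Y_term_bound in auto)

lemma Y_bound: "1 \<le> T \<Longrightarrow> 0 \<le> t \<Longrightarrow> \<bar>Y T t\<bar> \<le> 5 * (C + 1) * (pi\<^sup>2 / 6)"
proof -
  assume T: "1 \<le> T" and t: "0 \<le> t"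
  have "norm (Y T t) \<le> (\<Sum>n. 5 * (C + 1) * (1 / (real n)\<^sup>2))"
    unfolding Y_def by (rule norm_suminf_le) (use Y_term_bound[OF T t] Y_bound_summable in auto)
  also have "\<dots> = 5 * (C + 1) * (pi\<^sup>2 / 6)"
    by (rule sums_unique[symmetric, OF sums_mult[OF squares_all]])
  finally show ?thesis by simp
qed

lemma Y_periodic: "1 \<le> T \<Longrightarrow> Y T T = Y T 0"
  unfolding Y_def by (rule suminf_cong) (simp add: p_periodic)

text \<open>What is left of y after removing the mean and the periodic part consists of the homogeneous solutions, and
  these decay at least like \<open>exp (- t)\<close>, uniformly in T.\<close>

lemma remainder_bound:
  assumes T: "1 \<le> T" and t: "t \<in> {0..T}"
  shows "\<bar>y t - a 0 t / pi - Y T t\<bar> \<le> 4 * (C + 1) * (pi\<^sup>2 / 6) * exp (- t)"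
proof -
  have t0: "0 \<le> t" using t by simp
  define r where "r n = (if n = 0 then 0 else wt n * (-1) ^ n * (d T n * exp (- (real n)\<^sup>2 * t)))" for n
  have sY: "(\<lambda>n. if n = 0 then 0 else wt n * (-1) ^ n * p T n t) sums Y T t"
    unfolding Y_def
    by (rule summable_sums, rule summable_comparison_test'[OF Y_bound_summable[of "5 * (C + 1)"], of 0])
       (use Y_term_bound[OF T t0] in auto)
  have "(\<lambda>n. wt n * (-1) ^ n * a n t - (if n = 0 then a 0 t / pi else 0) - (if n = 0 then 0 else wt n * (-1) ^ n * p T n t)) sums (y t - a 0 t / pi - Y T t)"
    by (intro sums_diff y_sum t0 sums_single sY)
  moreover have "(\<lambda>n. wt n * (-1) ^ n * a n t - (if n = 0 then a 0 t / pi else 0) - (if n = 0 then 0 else wt n * (-1) ^ n * p T n t)) = r"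
    by (auto simp: r_def p_def wt_def fun_eq_iff algebra_simps)
  ultimately have s: "r sums (y t - a 0 t / pi - Y T t)" by simp
  have b: "norm (r n) \<le> 4 * (C + 1) * exp (- t) * (1 / (real n)\<^sup>2)" for n
  proof (cases "n = 0")
    case False
    then have n: "1 \<le> n" by simp
    have "1 * t \<le> (real n)\<^sup>2 * t" using n t0 by (intro mult_right_mono) auto
    then have "exp (- (real n)\<^sup>2 * t) \<le> exp (- t)" by simp
    then have "wt n * (\<bar>d T n\<bar> * exp (- (real n)\<^sup>2 * t)) \<le> 1 * (4 * (C + 1) / (real n)\<^sup>2 * exp (- t))"
      using C wt_nonneg[of n] by (intro mult_mono wt_le d_bound n T) auto
    then show ?thesis using False wt_nonneg[of n] by (simp add: r_def abs_mult power_abs)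
  qed (simp add: r_def)
  have "norm (suminf r) \<le> (\<Sum>n. 4 * (C + 1) * exp (- t) * (1 / (real n)\<^sup>2))"
    by (rule norm_suminf_le[OF b Y_bound_summable])
  also have "\<dots> = 4 * (C + 1) * exp (- t) * (pi\<^sup>2 / 6)"
    by (rule sums_unique[symmetric, OF sums_mult[OF squares_all]])
  finally show ?thesis using sums_unique[OF s] by (simp add: mult_ac)
qed

end

section \<open>The Popov multiplier on a period\<close>

context thermostat_modes begin

definition gbar :: "real \<Rightarrow> real" where "gbar T = integral {0..T} g / T"

text \<open>The mean mode has no periodic solution unless the input has mean 0; subtracting the mean \<open>gbar T\<close> of the input
  restores periodicity.\<close>

definition p0 :: "real \<Rightarrow> real \<Rightarrow> real" where "p0 T t = a 0 t + gbar T * t"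

definition Z :: "real \<Rightarrow> real \<Rightarrow> real" where "Z T t = p0 T t / pi + Y T t"

text \<open>The periodic signal to which the Fourier multiplier estimate is applied. For \<open>t \<ge> h\<close> it is \<open>Y + (q / h)\<close> times the
  increment of y over the delay h, up to homogeneous solutions; the last term undoes the correction of the
  mean in \<open>p0\<close>.\<close>

definition X :: "real \<Rightarrow> real \<Rightarrow> real \<Rightarrow> real \<Rightarrow> real" where
  "X q h T t = Y T t + (q / h) * (Z T t - pshift T h (Z T) t) - (q / pi) * gbar T"

lemma gbar_bound: "0 < T \<Longrightarrow> \<bar>gbar T\<bar> \<le> 1"
proof -
  assume T: "0 < T"
  have "norm (integral {0..T} g) \<le> integral {0..T} (\<lambda>t. 1)"
    by (rule integral_norm_bound_integral) (use g_bound in \<open>auto intro: integrable_continuous_real g_cont\<close>)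
  then show ?thesis using T by (simp add: gbar_def abs_divide divide_le_eq)
qed

lemma p0_deriv: "t \<in> {0..T} \<Longrightarrow> (p0 T has_real_derivative - 0 * p0 T t - (g t - gbar T)) (at t within {0..T})"
  unfolding p0_def[abs_def] using a_deriv[of 0 t T 0] by (auto intro!: derivative_eq_intros)

lemma p0_periodic: "0 < T \<Longrightarrow> p0 T T = p0 T 0"
  using integral_unique[OF a0_increment[of 0 T]] by (simp add: p0_def gbar_def)

lemma Z_cont: "1 \<le> T \<Longrightarrow> continuous_on {0..T} (Z T)"
  unfolding Z_def[abs_def]
  by (intro continuous_intros Y_cont DERIV_continuous_on[OF p0_deriv]) auto

lemma Z_periodic: "1 \<le> T \<Longrightarrow> Z T T = Z T 0"
  by (simp add: Z_def p0_periodic Y_periodic)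

lemma fcoef_p:
  "0 < T \<Longrightarrow> 1 \<le> n \<Longrightarrow> 1 \<le> T \<Longrightarrow> (of_real ((real n)\<^sup>2) + \<i> * of_real (freq T j)) * fcoef T (p T n) j = - fcoef T g j"
  by (rule fcoef_periodic_ode[OF _ p_deriv p_periodic g_cont]) auto

lemma fcoef_p0:
  assumes T: "0 < T" and j: "j \<noteq> 0"
  shows "\<i> * of_real (freq T j) * fcoef T (p0 T) j = - fcoef T g j"
proof -
  have "(of_real 0 + \<i> * of_real (freq T j)) * fcoef T (p0 T) j = - fcoef T (\<lambda>t. g t - gbar T) j"
    by (rule fcoef_periodic_ode[OF T p0_deriv p0_periodic[OF T]]) (auto intro!: continuous_intros g_cont)
  also have "fcoef T (\<lambda>t. g t - gbar T) j = fcoef T g j"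
    using j T by (subst fcoef_diff) (auto intro!: g_cont simp: fcoef_const)
  finally show ?thesis by simp
qed

lemma fcoef_Y:
  assumes T: "1 \<le> T"
  shows "(\<lambda>n. if n = 0 then 0 else of_real (wt n * (-1) ^ n) * fcoef T (p T n) j) sums fcoef T (Y T) j"
proof -
  have "(\<lambda>n. fcoef T (\<lambda>t. if n = 0 then 0 else wt n * (-1) ^ n * p T n t) j) sums fcoef T (Y T) j"
    unfolding Y_def[abs_def]
    by (rule fcoef_series(1)[OF Y_term_cont _ Y_bound_summable[of "5 * (C + 1)"]]) (use Y_term_bound[OF T] in auto)
  moreover have "fcoef T (\<lambda>t. if n = 0 then 0 else wt n * (-1) ^ n * p T n t) j = (if n = 0 then 0 else of_real (wt n * (-1) ^ n) * fcoef T (p T n) j)" for n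
  proof (cases "n = 0")
    case True
    then show ?thesis by (simp add: fcoef_def)
  next
    case False
    then show ?thesis by (simp add: fcoef_scale del: of_real_mult of_real_power)
  qed
  ultimately show ?thesis by simp
qed

text \<open>At frequency 0 the multiplier is \<open>- \<Sum> w\<^sub>n (-1)\<^sup>n / n\<^sup>2\<close> over \<open>n \<ge> 1\<close>, an alternating series with sum \<open>\<pi> / 6\<close>.\<close>

lemma fcoef_Y_0: "1 \<le> T \<Longrightarrow> fcoef T (Y T) 0 = of_real (pi / 6) * fcoef T g 0"
proof -
  assume T: "1 \<le> T"
  have "(\<lambda>n. of_real (- (2 / pi) * ((-1) ^ n / (real n)\<^sup>2)) * fcoef T g 0) sums (of_real (- (2 / pi) * (- (pi\<^sup>2 / 12))) * fcoef T g 0)"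
    by (intro sums_mult2 sums_of_real sums_mult squares_alternating)
  moreover have "(\<lambda>n. of_real (- (2 / pi) * ((-1) ^ n / (real n)\<^sup>2)) * fcoef T g 0)
     = (\<lambda>n. if n = 0 then 0 else of_real (wt n * (-1) ^ n) * fcoef T (p T n) 0)"
  proof
    fix n
    show "of_real (- (2 / pi) * ((-1) ^ n / (real n)\<^sup>2)) * fcoef T g 0 = (if n = 0 then 0 else of_real (wt n * (-1) ^ n) * fcoef T (p T n) 0)"
    proof (cases "n = 0")
      case False
      then have "of_real ((real n)\<^sup>2) * fcoef T (p T n) 0 = - fcoef T g 0"
        using fcoef_p[of T n 0] T by (simp add: freq_def)
      moreover have "(of_real ((real n)\<^sup>2) :: complex) \<noteq> 0" using False by simp
      ultimately have "fcoef T (p T n) 0 = - fcoef T g 0 / of_real ((real n)\<^sup>2)" by (metis nonzero_mult_div_cancel_left)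
      then show ?thesis using False by (simp add: wt_def)
    qed simp
  qed
  ultimately have "(\<lambda>n. if n = 0 then 0 else of_real (wt n * (-1) ^ n) * fcoef T (p T n) 0) sums (of_real (- (2 / pi) * (- (pi\<^sup>2 / 12))) * fcoef T g 0)"
    by simp
  from sums_unique2[OF fcoef_Y[OF T] this] show ?thesis by (simp add: power2_eq_square)
qed

text \<open>The coefficients of all modes add up to the transfer function; in Y the term \<open>n = 0\<close> is absent. That
  term is imaginary, so both multipliers have the same real part.\<close>

lemma fcoef_Z:
  assumes T: "1 \<le> T" and j: "j \<noteq> 0"
  shows "fcoef T (Z T) j = - transfer_fun (freq T j) * fcoef T g j"
    and "fcoef T (Y T) j = - (transfer_fun (freq T j) - 1 / (\<i> * of_real (pi * freq T j))) * fcoef T g j"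
proof -
  let ?w = "freq T j"
  have w: "?w \<noteq> 0" using T j by (simp add: freq_def)
  let ?k = "\<lambda>n. of_real (wt n * (-1) ^ n) / (of_real ((real n)\<^sup>2) + \<i> * of_real ?w) :: complex"
  have "(\<lambda>n. (?k n - (if n = 0 then 1 / (\<i> * of_real (pi * ?w)) else 0)) * (- fcoef T g j))
     sums ((transfer_fun ?w - 1 / (\<i> * of_real (pi * ?w))) * (- fcoef T g j))"
    by (intro sums_mult2 sums_diff transfer_fun_sums(1) w sums_single)
  moreover have "(\<lambda>n. (?k n - (if n = 0 then 1 / (\<i> * of_real (pi * ?w)) else 0)) * (- fcoef T g j))
     = (\<lambda>n. if n = 0 then 0 else of_real (wt n * (-1) ^ n) * fcoef T (p T n) j)"
  proof
    fix n
    show "(?k n - (if n = 0 then 1 / (\<i> * of_real (pi * ?w)) else 0)) * (- fcoef T g j) = (if n = 0 then 0 else of_real (wt n * (-1) ^ n) * fcoef T (p T n) j)"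
    proof (cases "n = 0")
      case True
      then show ?thesis using w by (simp add: wt_def field_simps)
    next
      case False
      let ?s = "of_real ((real n)\<^sup>2) + \<i> * of_real ?w :: complex"
      have "?s * fcoef T (p T n) j = - fcoef T g j" using fcoef_p[of T n j] T False by simp
      moreover have "?s \<noteq> 0" using w by (simp add: complex_eq_iff)
      ultimately have "fcoef T (p T n) j = - fcoef T g j / ?s" by (metis nonzero_mult_div_cancel_left)
      then show ?thesis using False by simp
    qed
  qed
  ultimately have "(\<lambda>n. if n = 0 then 0 else of_real (wt n * (-1) ^ n) * fcoef T (p T n) j) sums ((transfer_fun ?w - 1 / (\<i> * of_real (pi * ?w))) * (- fcoef T g j))"
    by simp
  from sums_unique2[OF fcoef_Y[OF T] this]
  show Y: "fcoef T (Y T) j = - (transfer_fun ?w - 1 / (\<i> * of_real (pi * ?w))) * fcoef T g j" by (simp only: minus_mult_commute)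
  have iw: "\<i> * complex_of_real ?w \<noteq> 0" using w by simp
  have "\<i> * of_real ?w * fcoef T (p0 T) j = - fcoef T g j" using fcoef_p0[OF _ j] T by simp
  then have p0: "fcoef T (p0 T) j = - fcoef T g j / (\<i> * of_real ?w)" using iw by (metis nonzero_mult_div_cancel_left)
  have "fcoef T (Z T) j = fcoef T (\<lambda>t. (1 / pi) * p0 T t) j + fcoef T (Y T) j"
    unfolding Z_def[abs_def] divide_inverse
    by (subst fcoef_add[symmetric]) (auto intro!: continuous_intros Y_cont T DERIV_continuous_on[OF p0_deriv] simp: mult.commute)
  also have "fcoef T (\<lambda>t. (1 / pi) * p0 T t) j = of_real (1 / pi) * fcoef T (p0 T) j" by (rule fcoef_scale)
  finally show "fcoef T (Z T) j = - transfer_fun ?w * fcoef T g j"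
    unfolding Y p0 using w by (simp add: field_simps)
qed

definition mult_X :: "real \<Rightarrow> real \<Rightarrow> real \<Rightarrow> int \<Rightarrow> complex" where
  "mult_X q h T j = (if j = 0 then of_real (pi / 6 - q / pi) else
     - (transfer_fun (freq T j) - 1 / (\<i> * of_real (pi * freq T j)))
     - of_real (q / h) * ((1 - exp (- (\<i> * of_real (freq T j * h)))) * transfer_fun (freq T j)))"

lemma fcoef_X:
  assumes T: "1 \<le> T" and h: "0 < h" "h < T"
  shows "fcoef T (X q h T) j = mult_X q h T j * fcoef T g j"
proof -
  have cs: "continuous_on {0..T} (pshift T h (Z T))" by (intro continuous_on_pshift h Z_cont Z_periodic T)
  have "fcoef T (X q h T) j = fcoef T (\<lambda>t. Y T t + (q / h) * (Z T t - pshift T h (Z T) t)) j - fcoef T (\<lambda>t. (q / pi) * gbar T) j"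
    unfolding X_def[abs_def] by (intro fcoef_diff continuous_intros Y_cont Z_cont cs T)
  also have "fcoef T (\<lambda>t. Y T t + (q / h) * (Z T t - pshift T h (Z T) t)) j = fcoef T (Y T) j + fcoef T (\<lambda>t. (q / h) * (Z T t - pshift T h (Z T) t)) j"
    by (intro fcoef_add continuous_intros Y_cont Z_cont cs T)
  also have "fcoef T (\<lambda>t. (q / h) * (Z T t - pshift T h (Z T) t)) j = of_real (q / h) * (fcoef T (Z T) j - fcoef T (pshift T h (Z T)) j)"
    unfolding fcoef_scale by (subst fcoef_diff) (intro Z_cont cs T refl)+
  also have "fcoef T (pshift T h (Z T)) j = circ T (- j) h * fcoef T (Z T) j"
    by (intro fcoef_pshift h Z_cont Z_periodic T)
  finally have e: "fcoef T (X q h T) j = fcoef T (Y T) j + of_real (q / h) * (fcoef T (Z T) j - circ T (- j) h * fcoef T (Z T) j) - fcoef T (\<lambda>t. (q / pi) * gbar T) j" .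
  show ?thesis
  proof (cases "j = 0")
    case True
    have "circ T 0 h = 1" by (simp add: circ_def)
    moreover have "fcoef T (\<lambda>t. (q / pi) * gbar T) 0 = of_real (q / pi) * fcoef T g 0"
      using T by (simp add: fcoef_const fcoef_zero g_cont gbar_def)
    ultimately show ?thesis using True T unfolding e by (simp add: fcoef_Y_0 mult_X_def left_diff_distrib)
  next
    case False
    have "circ T (- j) h = exp (- (\<i> * of_real (freq T j * h)))"
      by (simp add: circ_freq freq_def)
    moreover have "fcoef T (\<lambda>t. (q / pi) * gbar T) j = 0" using False T by (simp add: fcoef_const)
    ultimately show ?thesis using False T unfolding e fcoef_Z[OF T False] by (simp add: mult_X_def algebra_simps)
  qed
qed

lemma multiplier_estimate:
  assumes T: "1 \<le> T" and h: "0 < h" "h < 1" and q: "0 < q" and \<kappa>: "0 \<le> \<kappa>"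
    and pop: "\<And>\<omega>. 0 < \<omega> \<Longrightarrow> - Re (1 / symH \<omega>) - q * Re (\<i> * of_real \<omega> / symH \<omega>) \<le> b"
    and zero: "pi / 6 - q / pi \<le> b" and b: "b + q * h \<le> \<kappa>"
  shows "integral {0..T} (\<lambda>t. g t * X q h T t) \<le> \<kappa> * integral {0..T} (\<lambda>t. (g t)\<^sup>2)"
proof (rule multiplier_bound[where \<mu> = "mult_X q h T"])
  have hT: "h < T" using h T by simp
  have cs: "continuous_on {0..T} (pshift T h (Z T))" by (intro continuous_on_pshift h(1) hT Z_cont Z_periodic T)
  show "continuous_on {0..T} (X q h T)"
    unfolding X_def[abs_def] by (intro continuous_intros Y_cont Z_cont cs T)
  have "pshift T h (Z T) 0 = pshift T h (Z T) T" using h hT by (simp add: pshift_def)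
  then show "X q h T 0 = X q h T T" by (simp add: X_def Y_periodic Z_periodic T)
  show "fcoef T (X q h T) j = mult_X q h T j * fcoef T g j" for j by (rule fcoef_X[OF T h(1) hT])
  show "Re (mult_X q h T j) \<le> \<kappa>" for j
  proof (cases "j = 0")
    case True
    have "0 < q * h" using q h by simp
    then show ?thesis using True zero b by (simp add: mult_X_def)
  next
    case False
    let ?w = "freq T j"
    have w: "?w \<noteq> 0" using T False by (simp add: freq_def)
    have "mult_X q h T j = (- transfer_fun ?w - of_real (q / h) * ((1 - exp (- (\<i> * of_real (?w * h)))) * transfer_fun ?w)) + 1 / (\<i> * of_real (pi * ?w))"
      using False by (simp add: mult_X_def)
    moreover have "Re (1 / (\<i> * of_real (pi * ?w))) = 0" by (simp add: Re_divide)
    ultimately have "Re (mult_X q h T j) = Re (- transfer_fun ?w - of_real (q / h) * ((1 - exp (- (\<i> * of_real (?w * h)))) * transfer_fun ?w))"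
      by (simp only: plus_complex.simps add_0_right)
    also have "\<dots> \<le> b + q * h" by (rule difference_multiplier_bound[OF q h(1) pop w])
    finally show ?thesis using b by simp
  qed
qed (use T \<kappa> in \<open>auto intro: g_cont\<close>)

end

section \<open>Finite total input below the first crossing\<close>

context thermostat_modes begin

lemma Z_delay_bound:
  assumes T: "1 \<le> T" and h: "0 < h" "h < 1" and t: "t \<in> {0..h}"
  shows "\<bar>Z T t - pshift T h (Z T) t\<bar> \<le> 2 * h + 10 * (C + 1) * (pi\<^sup>2 / 6)"
proof -
  define u where "u = t - h + T"
  have u: "0 \<le> u" "u \<le> T" using t h T by (auto simp: u_def)
  have lip: "\<bar>p0 T r - p0 T s\<bar> \<le> 2 * (r - s)" if "0 \<le> s" "s \<le> r" for r s
  proof -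
    have "p0 T r - p0 T s = (a 0 r - a 0 s) + gbar T * (r - s)" by (simp add: p0_def algebra_simps)
    moreover have "\<bar>gbar T * (r - s)\<bar> \<le> 1 * (r - s)"
      unfolding abs_mult using that gbar_bound[of T] T by (intro mult_mono) auto
    then have "\<bar>a 0 r - a 0 s\<bar> + \<bar>gbar T * (r - s)\<bar> \<le> (r - s) + 1 * (r - s)"
      by (intro add_mono a0_lipschitz[OF that])
    ultimately show ?thesis by (intro order_trans[OF eq_refl[OF arg_cong[of _ _ abs]] order_trans[OF abs_triangle_ineq]]) simp_all
  qed
  have "\<bar>p0 T t - p0 T u\<bar> \<le> 2 * h"
  proof -
    have "\<bar>p0 T t - p0 T 0\<bar> \<le> 2 * (t - 0)" "\<bar>p0 T T - p0 T u\<bar> \<le> 2 * (T - u)"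
      using lip[of 0 t] lip[of u T] t u by simp_all
    then show ?thesis using p0_periodic[of T] T by (simp add: u_def)
  qed
  then have "\<bar>(p0 T t - p0 T u) / pi\<bar> \<le> 2 * h / 1"
    unfolding abs_divide using pi_gt3 by (intro frac_le) auto
  moreover have "Z T t - pshift T h (Z T) t = (p0 T t - p0 T u) / pi + Y T t - Y T u"
    using t by (simp add: Z_def pshift_def u_def diff_divide_distrib)
  moreover have "\<bar>Y T t\<bar> \<le> 5 * (C + 1) * (pi\<^sup>2 / 6)" "\<bar>Y T u\<bar> \<le> 5 * (C + 1) * (pi\<^sup>2 / 6)"
    using Y_bound[OF T, of t] Y_bound[OF T, of u] t u by simp_all
  ultimately show ?thesis by linarith
qed

text \<open>The sector bound and the delayed increments give
  \<open>\<integral> g\<^sup>2 / \<beta> \<le> \<integral> g y + (q / h) (\<integral> g (y - y(\<cdot> - h)) + const)\<close>. On the right the mean mode integrates exactly, since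
  \<open>g a\<^sub>0\<close> is a derivative, and the periodic part is \<open>\<integral> g X \<le> \<kappa> \<integral> g\<^sup>2\<close>. Everything else is bounded independently of T: the
  homogeneous solutions decay exponentially, and the first h units of time, on which the shift wraps
  around, contribute a constant.\<close>

lemma popov_bounded_energy:
  assumes h: "0 < h" "h < 1" and q: "0 < q" and \<kappa>: "0 \<le> \<kappa>"
    and pop: "\<And>\<omega>. 0 < \<omega> \<Longrightarrow> - Re (1 / symH \<omega>) - q * Re (\<i> * of_real \<omega> / symH \<omega>) \<le> b"
    and zero: "pi / 6 - q / pi \<le> b" and b: "b + q * h \<le> \<kappa>"
  shows "\<exists>M. \<forall>T\<ge>1. (1 / \<beta> - \<kappa>) * integral {0..T} (\<lambda>t. (g t)\<^sup>2) \<le> M"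
proof -
  define D where "D = 4 * (C + 1) * (pi\<^sup>2 / 6)"
  have D0: "0 \<le> D" using C by (simp add: D_def)
  define B where "B = (q / h) * (2 * h + 10 * (C + 1) * (pi\<^sup>2 / 6)) + q"
  have B0: "0 \<le> B" using q h C by (simp add: B_def)
  define P where "P = integral {0..h} (\<lambda>t. Psi \<beta> (y t))"
  define M where "M = C\<^sup>2 / 2 + B + D + (q / h) * (2 * D + P)"
  have "(1 / \<beta> - \<kappa>) * integral {0..T} (\<lambda>t. (g t)\<^sup>2) \<le> M" if T: "1 \<le> T" for T
  proof -
    have hT: "h < T" and T0: "0 \<le> T" using h T by auto
    have cs: "continuous_on {0..T} (pshift T h (Z T))" by (intro continuous_on_pshift h(1) hT Z_cont Z_periodic T)
    have Xc: "continuous_on {0..T} (X q h T)"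
      unfolding X_def[abs_def] by (intro continuous_intros Y_cont Z_cont cs T)
    define R where "R t = y t - a 0 t / pi - Y T t" for t
    have Rb: "\<bar>R t\<bar> \<le> D * exp (- t)" if "t \<in> {0..T}" for t
      unfolding R_def D_def by (rule remainder_bound[OF T that])
    have Rc: "continuous_on {0..T} R" unfolding R_def[abs_def]
      by (intro continuous_intros y_cont' a_cont Y_cont T) auto
    have Rhc: "continuous_on {h..T} (\<lambda>t. R (t - h))"
      by (intro continuous_on_compose2[OF Rc] continuous_intros) (use h in auto)
    note gc = g_cont[OF order_refl, of T]
    have sub: "continuous_on {s..t} f" if "continuous_on {0..T} f" "0 \<le> s" "t \<le> T" for s t and f :: "real \<Rightarrow> real"
      by (rule continuous_on_subset[OF that(1)]) (use that in auto)
    note ic = integrable_continuous_real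
    have "integral {0..T} (\<lambda>t. (g t)\<^sup>2 / \<beta>) \<le> integral {0..T} (\<lambda>t. g t * y t)"
      using sector beta by (intro integral_le ic continuous_intros gc y_cont') auto
    then have 1: "(1 / \<beta>) * integral {0..T} (\<lambda>t. (g t)\<^sup>2) \<le> integral {0..T} (\<lambda>t. g t * y t)" by simp
    have 2: "- P \<le> integral {h..T} (\<lambda>t. g t * (y t - y (t - h)))"
      unfolding P_def by (rule delayed_increment) (use h hT in auto)
    have 3: "integral {0..T} (\<lambda>t. g t * y t) = ((a 0 0)\<^sup>2 - (a 0 T)\<^sup>2) / 2 / pi + integral {0..T} (\<lambda>t. g t * Y T t) + integral {0..T} (\<lambda>t. g t * R t)"
    proof -
      have "integral {0..T} (\<lambda>t. g t * y t) = integral {0..T} (\<lambda>t. (g t * a 0 t / pi + g t * Y T t) + g t * R t)"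
        by (intro integral_cong) (simp add: R_def algebra_simps)
      also have "\<dots> = (integral {0..T} (\<lambda>t. g t * a 0 t / pi) + integral {0..T} (\<lambda>t. g t * Y T t)) + integral {0..T} (\<lambda>t. g t * R t)"
      proof -
        have i: "(\<lambda>t. g t * a 0 t / pi) integrable_on {0..T}" "(\<lambda>t. g t * Y T t) integrable_on {0..T}" "(\<lambda>t. g t * R t) integrable_on {0..T}"
          by (intro ic continuous_intros gc a_cont Y_cont T Rc; simp)+
        show ?thesis by (simp only: integral_add[OF integrable_add[OF i(1,2)] i(3)] integral_add[OF i(1,2)])
      qed
      also have "integral {0..T} (\<lambda>t. g t * a 0 t / pi) = ((a 0 0)\<^sup>2 - (a 0 T)\<^sup>2) / 2 / pi"
        by (simp only: integral_divide integral_unique[OF g_a0_integral[OF T0]])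
      finally show ?thesis .
    qed
    have gR: "integral {0..T} (\<lambda>t. g t * R t) \<le> D"
    proof -
      have "((\<lambda>t. D * exp (- (t - 0))) has_integral D * (exp (- (0 - 0)) - exp (- (T - 0)))) {0..T}"
        by (intro has_integral_mult_right has_integral_exp_decay T0)
      note e = this
      have "norm (integral {0..T} (\<lambda>t. g t * R t)) \<le> integral {0..T} (\<lambda>t. D * exp (- (t - 0)))"
      proof (rule integral_norm_bound_integral)
        show "(\<lambda>t. g t * R t) integrable_on {0..T}" by (intro ic continuous_intros gc Rc)
        fix t assume "t \<in> {0..T}"
        then have "\<bar>g t\<bar> * \<bar>R t\<bar> \<le> 1 * (D * exp (- t))" using D0 by (intro mult_mono g_bound Rb) auto
        then show "norm (g t * R t) \<le> D * exp (- (t - 0))" by (simp add: abs_mult)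
      qed (use e in \<open>auto simp: has_integral_iff\<close>)
      also have "\<dots> = D * (1 - exp (- T))" using integral_unique[OF e] by simp
      also have "\<dots> \<le> D * 1" using D0 by (intro mult_left_mono) auto
      finally show ?thesis by simp
    qed
    have gRh: "integral {h..T} (\<lambda>t. g t * (R t - R (t - h))) \<le> 2 * D"
    proof -
      have "((\<lambda>t. 2 * D * exp (- (t - h))) has_integral 2 * D * (exp (- (h - h)) - exp (- (T - h)))) {h..T}"
        by (intro has_integral_mult_right has_integral_exp_decay) (use hT in simp)
      note e = this
      have "norm (integral {h..T} (\<lambda>t. g t * (R t - R (t - h)))) \<le> integral {h..T} (\<lambda>t. 2 * D * exp (- (t - h)))"
      proof (rule integral_norm_bound_integral)
        show "(\<lambda>t. g t * (R t - R (t - h))) integrable_on {h..T}"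
          using h by (intro ic continuous_intros g_cont sub[OF Rc] Rhc) auto
        fix t assume t: "t \<in> {h..T}"
        have "\<bar>R t\<bar> \<le> D * exp (- t)" "\<bar>R (t - h)\<bar> \<le> D * exp (- (t - h))" using Rb[of t] Rb[of "t - h"] t h by simp_all
        moreover have "D * exp (- t) \<le> D * exp (- (t - h))" using D0 h by (intro mult_left_mono) auto
        ultimately have "\<bar>R t - R (t - h)\<bar> \<le> 2 * D * exp (- (t - h))" by linarith
        then have "\<bar>g t\<bar> * \<bar>R t - R (t - h)\<bar> \<le> 1 * (2 * D * exp (- (t - h)))" by (intro mult_mono g_bound) auto
        then show "norm (g t * (R t - R (t - h))) \<le> 2 * D * exp (- (t - h))" by (simp add: abs_mult)
      qed (use e in \<open>auto simp: has_integral_iff\<close>)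
      also have "\<dots> = 2 * D * (1 - exp (- (T - h)))" using integral_unique[OF e] by simp
      also have "\<dots> \<le> 2 * D * 1" using D0 by (intro mult_left_mono) auto
      finally show ?thesis by simp
    qed
    have 4: "(q / h) * integral {h..T} (\<lambda>t. g t * (y t - y (t - h)))
        = integral {h..T} (\<lambda>t. g t * (X q h T t - Y T t)) + (q / h) * integral {h..T} (\<lambda>t. g t * (R t - R (t - h)))"
    proof -
      have "(q / h) * integral {h..T} (\<lambda>t. g t * (y t - y (t - h))) = integral {h..T} (\<lambda>t. g t * (X q h T t - Y T t) + (q / h) * (g t * (R t - R (t - h))))"
        unfolding integral_mult_right[symmetric]
      proof (rule integral_cong)
        fix t assume t: "t \<in> {h..T}"
        have ps: "pshift T h (Z T) t = Z T (t - h)" using t Z_periodic[OF T] by (auto simp: pshift_def)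
        have "X q h T t - Y T t = (q / h) * (Z T t - Z T (t - h)) - (q / h) * (h * gbar T / pi)"
          using h by (simp add: X_def ps)
        also have "\<dots> = (q / h) * ((Z T t - Z T (t - h)) - h * gbar T / pi)" by (simp add: right_diff_distrib)
        also have "(Z T t - Z T (t - h)) - h * gbar T / pi = (a 0 t - a 0 (t - h)) / pi + (Y T t - Y T (t - h))"
          by (simp add: Z_def p0_def field_simps)
        finally have "X q h T t - Y T t + (q / h) * (R t - R (t - h)) = (q / h) * (y t - y (t - h))"
          by (simp add: R_def algebra_simps diff_divide_distrib)
        then have "g t * (X q h T t - Y T t + (q / h) * (R t - R (t - h))) = g t * ((q / h) * (y t - y (t - h)))" by (rule arg_cong)
        then show "(q / h) * (g t * (y t - y (t - h))) = g t * (X q h T t - Y T t) + (q / h) * (g t * (R t - R (t - h)))"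
          by (simp add: algebra_simps)
      qed
      also have "\<dots> = integral {h..T} (\<lambda>t. g t * (X q h T t - Y T t)) + integral {h..T} (\<lambda>t. (q / h) * (g t * (R t - R (t - h))))"
        using h by (intro integral_add ic continuous_intros g_cont sub[OF Rc] sub[OF Xc] sub[OF Y_cont[OF T]] Rhc) auto
      finally show ?thesis by simp
    qed
    have 5: "integral {h..T} (\<lambda>t. g t * (X q h T t - Y T t)) \<le> integral {0..T} (\<lambda>t. g t * X q h T t) - integral {0..T} (\<lambda>t. g t * Y T t) + B"
    proof -
      have Fc: "continuous_on {0..T} (\<lambda>t. g t * (X q h T t - Y T t))" by (intro continuous_intros gc Xc Y_cont T)
      have "norm (integral {0..h} (\<lambda>t. g t * (X q h T t - Y T t))) \<le> integral {0..h} (\<lambda>t. B)"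
      proof (rule integral_norm_bound_integral)
        show "(\<lambda>t. g t * (X q h T t - Y T t)) integrable_on {0..h}" using hT by (intro ic sub[OF Fc]) auto
        fix t assume t: "t \<in> {0..h}"
        have e: "X q h T t - Y T t = (q / h) * (Z T t - pshift T h (Z T) t) - (q / pi) * gbar T" by (simp add: X_def)
        have "\<bar>(q / h) * (Z T t - pshift T h (Z T) t)\<bar> \<le> (q / h) * (2 * h + 10 * (C + 1) * (pi\<^sup>2 / 6))"
          unfolding abs_mult using q h by (intro mult_mono Z_delay_bound[OF T h t]) auto
        moreover have "\<bar>(q / pi) * gbar T\<bar> \<le> q * 1"
          unfolding abs_mult using q pi_gt3 gbar_bound[of T] T by (intro mult_mono) (auto simp: divide_le_eq)
        ultimately have "\<bar>X q h T t - Y T t\<bar> \<le> (q / h) * (2 * h + 10 * (C + 1) * (pi\<^sup>2 / 6)) + q * 1"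
          unfolding e by (intro order_trans[OF abs_triangle_ineq4] add_mono)
        then have "\<bar>X q h T t - Y T t\<bar> \<le> B" by (simp only: B_def mult_1_right)
        then have "\<bar>g t\<bar> * \<bar>X q h T t - Y T t\<bar> \<le> 1 * B" by (intro mult_mono g_bound) auto
        then show "norm (g t * (X q h T t - Y T t)) \<le> B" by (simp add: abs_mult)
      qed auto
      also have "\<dots> \<le> B" using h B0 by (simp add: mult_left_le_one_le)
      finally have "- B \<le> integral {0..h} (\<lambda>t. g t * (X q h T t - Y T t))" by simp
      moreover have "integral {0..h} (\<lambda>t. g t * (X q h T t - Y T t)) + integral {h..T} (\<lambda>t. g t * (X q h T t - Y T t)) = integral {0..T} (\<lambda>t. g t * (X q h T t - Y T t))"
        using h hT by (intro Henstock_Kurzweil_Integration.integral_combine ic Fc) auto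
      moreover have "integral {0..T} (\<lambda>t. g t * (X q h T t - Y T t)) = integral {0..T} (\<lambda>t. g t * X q h T t) - integral {0..T} (\<lambda>t. g t * Y T t)"
        unfolding right_diff_distrib by (intro integral_diff ic continuous_intros gc Xc Y_cont T)
      ultimately show ?thesis by linarith
    qed
    have 6: "integral {0..T} (\<lambda>t. g t * X q h T t) \<le> \<kappa> * integral {0..T} (\<lambda>t. (g t)\<^sup>2)"
      by (rule multiplier_estimate[OF T h q \<kappa> pop zero b])
    have 7: "((a 0 0)\<^sup>2 - (a 0 T)\<^sup>2) / 2 / pi \<le> C\<^sup>2 / 2"
    proof -
      have "(a 0 0)\<^sup>2 \<le> C\<^sup>2" using power_mono[OF init0, of 2] by simp
      then have "(a 0 0)\<^sup>2 - (a 0 T)\<^sup>2 \<le> C\<^sup>2" using zero_le_power2[of "a 0 T"] by linarith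
      then have "((a 0 0)\<^sup>2 - (a 0 T)\<^sup>2) / 2 / pi \<le> C\<^sup>2 / 2 / pi" by (intro divide_right_mono) auto
      also have "\<dots> \<le> C\<^sup>2 / 2 / 1" using pi_gt3 by (intro divide_left_mono) auto
      finally show ?thesis by simp
    qed
    have qh: "0 \<le> q / h" using q h by simp
    have "(q / h) * (- P) \<le> (q / h) * integral {h..T} (\<lambda>t. g t * (y t - y (t - h)))" by (rule mult_left_mono[OF 2 qh])
    moreover have "(q / h) * integral {h..T} (\<lambda>t. g t * (R t - R (t - h))) \<le> (q / h) * (2 * D)" by (rule mult_left_mono[OF gRh qh])
    ultimately have "(1 / \<beta>) * integral {0..T} (\<lambda>t. (g t)\<^sup>2) \<le> C\<^sup>2 / 2 + D + \<kappa> * integral {0..T} (\<lambda>t. (g t)\<^sup>2) + B + (q / h) * (2 * D) + (q / h) * P"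
      using 1 3 gR 4 5 6 7 by linarith
    then show ?thesis by (simp add: M_def left_diff_distrib distrib_left)
  qed
  then show ?thesis by blast
qed

end

text \<open>The increasing function \<open>I T = \<integral> g\<^sup>2\<close> over \<open>[0, T]\<close> is bounded, so its increments over windows of fixed length
  become small.\<close>

lemma modes_decay:
  assumes m: "thermostat_modes \<beta> C a y" and \<beta>: "\<beta> < \<beta>\<^sub>0" and \<eta>: "0 < \<eta>"
  shows "\<exists>T\<ge>0. \<forall>t n. T \<le> t \<longrightarrow> \<bar>a n t\<bar> \<le> \<eta>"
proof -
  interpret thermostat_modes \<beta> C a y by (rule m)
  obtain q where q: "0 < q" "pi / 6 - q / pi \<le> 1 / \<beta>\<^sub>0" "0 < \<beta>\<^sub>0"
    "\<forall>\<omega>>0. - Re (1 / symH \<omega>) - q * Re (\<i> * of_real \<omega> / symH \<omega>) \<le> 1 / \<beta>\<^sub>0"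
    by (rule popov_frequency_inequality)
  define \<epsilon> where "\<epsilon> = (1 / \<beta> - 1 / \<beta>\<^sub>0) / 2"
  have \<epsilon>: "0 < \<epsilon>" using \<beta> beta by (simp add: \<epsilon>_def frac_less2)
  \<comment> \<open>half of the gap \<open>1 / \<beta> - 1 / \<beta>\<^sub>0\<close> pays for the difference quotient, half is gained\<close>
  define h where "h = min (1 / 2) (\<epsilon> / q)"
  have h: "0 < h" "h < 1" using \<epsilon> q by (auto simp: h_def)
  have qh: "q * h \<le> \<epsilon>"
  proof -
    have "q * h \<le> q * (\<epsilon> / q)" using q by (intro mult_left_mono) (auto simp: h_def)
    then show ?thesis using q by simp
  qed
  define \<kappa> where "\<kappa> = 1 / \<beta> - \<epsilon>"
  have k: "1 / \<beta>\<^sub>0 + q * h \<le> \<kappa>" using qh by (simp add: \<kappa>_def \<epsilon>_def field_simps)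
  have "0 < q * h" using q h by simp
  moreover have "0 < 1 / \<beta>\<^sub>0" using q by simp
  ultimately have k0: "0 \<le> \<kappa>" using k by linarith
  obtain M where M: "\<And>T. 1 \<le> T \<Longrightarrow> (1 / \<beta> - \<kappa>) * integral {0..T} (\<lambda>t. (g t)\<^sup>2) \<le> M"
    using popov_bounded_energy[OF h q(1) k0 q(4)[rule_format] q(2) k] by blast
  define I where "I T = integral {0..T} (\<lambda>t. (g t)\<^sup>2)" for T
  have IM: "I T \<le> M / \<epsilon>" if "1 \<le> T" for T
    using M[OF that] \<epsilon> by (simp add: I_def \<kappa>_def field_simps)
  have mono: "I S \<le> I T" if "0 \<le> S" "S \<le> T" for S T
    unfolding I_def using that by (intro integral_subset_le gsq_integrable) auto
  obtain L \<kappa>' where L: "1 \<le> L" and \<kappa>': "0 < \<kappa>'" and window: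
    "\<And>a y t n. thermostat_modes \<beta> C a y \<Longrightarrow> L \<le> t \<Longrightarrow>
       integral {t - L..t} (\<lambda>r. (tanh (\<beta> * y r))\<^sup>2) \<le> \<kappa>' \<Longrightarrow> \<bar>a n t\<bar> \<le> \<eta>"
    using small_input_small_modes[OF beta C \<eta>] by metis
  define S where "S = (SUP T\<in>{1..}. I T)"
  have bdd: "bdd_above (I ` {1..})" using IM by (auto intro!: bdd_aboveI)
  have "\<exists>T\<in>{1..}. S - \<kappa>' < I T"
    unfolding S_def using \<kappa>' bdd by (subst less_cSUP_iff[symmetric]) auto
  then obtain T where T: "1 \<le> T" "S - \<kappa>' < I T" by auto
  show ?thesis
  proof (intro exI[of _ "T + L"] conjI allI impI)
    show "0 \<le> T + L" using T L by simp
    fix t n assume t: "T + L \<le> t"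
    have "I (t - L) + integral {t - L..t} (\<lambda>t. (g t)\<^sup>2) = I t"
      unfolding I_def using t T L by (intro Henstock_Kurzweil_Integration.integral_combine gsq_integrable) auto
    moreover have "I T \<le> I (t - L)" using t T by (intro mono) auto
    moreover have "I t \<le> S" unfolding S_def using t T L by (intro cSUP_upper bdd) auto
    ultimately have "integral {t - L..t} (\<lambda>t. (g t)\<^sup>2) \<le> \<kappa>'" using T by linarith
    then show "\<bar>a n t\<bar> \<le> \<eta>" using t T by (intro window[OF m]) (auto simp: g_def)
  qed
qed

section \<open>From modes to attractors\<close>

text \<open>The time shift by 1 lets the semigroup smooth the initial value: \<open>exp (- n\<^sup>2) \<le> 1 / n\<^sup>2\<close> turns the bounded initial
  coefficients into \<open>O (1 / n\<^sup>2)\<close>, with a constant that depends on the norm only.\<close>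

lemma solution_modes:
  assumes T: "neumann_heat_semigroup T" and \<beta>: "0 < \<beta>" and u: "mild_solution T \<beta> u0 u" and \<rho>: "norm u0 \<le> \<rho>"
  shows "thermostat_modes \<beta> ((\<rho>\<^sup>2 + pi) / 2 + 1) (\<lambda>n t. mode (u (t + 1)) n) (\<lambda>t. H1_fun (u (t + 1)) pi)"
proof -
  define y where "y t = H1_fun (u t) pi" for t
  have yc: "continuous_on {0..} y" and
    ode: "\<And>t n. 0 \<le> t \<Longrightarrow> ((\<lambda>t. mode (u t) n) has_real_derivative - (real n)\<^sup>2 * mode (u t) n - tanh (\<beta> * y t)) (at t within {0..})"
    and u0: "\<And>n. mode (u 0) n = mode u0 n"
    using mild_solution_modes[OF T u] unfolding y_def by blast+
  define A where "A = (\<rho>\<^sup>2 + pi) / 2"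
  have A: "\<bar>mode (u 0) n\<bar> \<le> A" for n
  proof -
    have "(norm u0)\<^sup>2 \<le> \<rho>\<^sup>2" using \<rho> by (intro power_mono) auto
    then show ?thesis using mode_bound[of u0 n] by (simp add: u0 A_def)
  qed
  have A0: "0 \<le> A" by (simp add: A_def)
  have tb: "\<bar>tanh x\<bar> \<le> 1" for x :: real using tanh_real_bounds[of x] by (auto simp: abs_le_iff)
  have ode1: "((\<lambda>t. mode (u t) n) has_real_derivative - (real n)\<^sup>2 * mode (u r) n - tanh (\<beta> * y r)) (at r within {0..1})" if "r \<in> {0..1}" for n r
    using that by (intro DERIV_subset[OF ode]) auto
  show ?thesis
    unfolding A_def[symmetric]
  proof
    fix n and t :: real assume t: "0 \<le> t"
    have "((\<lambda>t. mode (u t) n) has_real_derivative - (real n)\<^sup>2 * mode (u (t + 1)) n - tanh (\<beta> * y (t + 1))) (at (t + 1) within (\<lambda>t. t + 1) ` {0..})"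
      using t by (intro DERIV_subset[OF ode]) auto
    moreover have "((\<lambda>t. t + 1) has_real_derivative 1) (at t within {0..})" by (auto intro!: derivative_eq_intros)
    ultimately have "((\<lambda>t. mode (u t) n) \<circ> (\<lambda>t. t + 1) has_real_derivative (- (real n)\<^sup>2 * mode (u (t + 1)) n - tanh (\<beta> * y (t + 1))) * 1) (at t within {0..})"
      by (rule DERIV_image_chain)
    then
    show "((\<lambda>t. mode (u (t + 1)) n) has_real_derivative - (real n)\<^sup>2 * mode (u (t + 1)) n - tanh (\<beta> * H1_fun (u (t + 1)) pi)) (at t within {0..})"
      by (simp add: o_def y_def)
    show "(\<lambda>n. wt n * (- 1) ^ n * mode (u (t + 1)) n) sums H1_fun (u (t + 1)) pi"
      using H1_fun_cosine_sums[of pi "u (t + 1)"] by (simp add: cosn_def mult.commute mult.left_commute)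
  next
    have "continuous_on {0..} (\<lambda>t. y (t + 1))"
      by (intro continuous_on_compose2[OF yc] continuous_intros) auto
    then show "continuous_on {0..} (\<lambda>t. H1_fun (u (t + 1)) pi)" by (simp add: y_def)
  next
    have "norm (integral {0..1} (\<lambda>r. exp (- 0 * (1 - r)) * tanh (\<beta> * y r))) \<le> integral {0..1} (\<lambda>r::real. 1)"
      using linear_ode_variation[of 0 1 "\<lambda>t. mode (u t) 0" 0 "\<lambda>r. tanh (\<beta> * y r)"] ode1[of _ 0] tb
      by (intro integral_norm_bound_integral) (auto simp: has_integral_iff)
    then have "\<bar>mode (u 0) 0 - mode (u 1) 0\<bar> \<le> 1"
      using linear_ode_variation[of 0 1 "\<lambda>t. mode (u t) 0" 0 "\<lambda>r. tanh (\<beta> * y r)"] ode1[of _ 0]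
      by (simp add: has_integral_iff)
    then show "\<bar>mode (u (0 + 1)) 0\<bar> \<le> A + 1" using A[of 0] by simp
  next
    fix n :: nat assume n: "1 \<le> n"
    have "\<bar>mode (u 1) n\<bar> \<le> exp (- (real n)\<^sup>2 * (1 - 0)) * \<bar>mode (u 0) n\<bar> + 1 / (real n)\<^sup>2"
      by (rule linear_ode_bound[OF _ _ ode1 tb]) (use n in auto)
    also have "exp (- (real n)\<^sup>2 * (1 - 0)) * \<bar>mode (u 0) n\<bar> \<le> 1 / (real n)\<^sup>2 * A"
    proof (intro mult_mono A)
      have "(real n)\<^sup>2 \<le> exp ((real n)\<^sup>2)" using exp_ge_add_one_self[of "(real n)\<^sup>2"] by linarith
      then have "1 / exp ((real n)\<^sup>2) \<le> 1 / (real n)\<^sup>2" using n by (intro divide_left_mono) auto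
      then show "exp (- (real n)\<^sup>2 * (1 - 0)) \<le> 1 / (real n)\<^sup>2" by (simp add: exp_minus divide_inverse)
    qed auto
    finally show "\<bar>mode (u (0 + 1)) n\<bar> \<le> (A + 1) / (real n)\<^sup>2" by (simp add: add_divide_distrib)
  qed (use \<beta> A0 in auto)
qed

text \<open>The bound \<open>C / n\<^sup>2\<close> dominates the tails of both series in \<open>norm_H1_le_modes\<close>, so only finitely many
  coefficients matter.\<close>

lemma norm_small_of_modes:
  assumes C: "0 \<le> C" and \<eta>: "0 < \<eta>"
  shows "\<exists>\<delta>>0. \<forall>u. (\<forall>n. \<bar>mode u n\<bar> \<le> \<delta>) \<and> (\<forall>n\<ge>1. \<bar>mode u n\<bar> \<le> C / (real n)\<^sup>2) \<longrightarrow> norm u \<le> \<eta>"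
proof -
  have \<eta>1: "0 < \<eta> / 3" and \<eta>2: "0 < \<eta>\<^sup>2 / 2" using \<eta> by auto
  obtain \<delta>1 where \<delta>1: "0 < \<delta>1" and s1: "\<forall>f. (\<forall>n. 0 \<le> f n \<and> f n \<le> \<delta>1 * (1 + (real n)\<^sup>2) \<and> (1 \<le> n \<longrightarrow> f n \<le> C / (real n)\<^sup>2))
      \<longrightarrow> summable f \<and> suminf f \<le> \<eta> / 3"
    using small_series[OF C \<eta>1] by blast
  obtain \<delta>2 where \<delta>2: "0 < \<delta>2" and s2: "\<forall>f. (\<forall>n. 0 \<le> f n \<and> f n \<le> \<delta>2 * (1 + (real n)\<^sup>2) \<and> (1 \<le> n \<longrightarrow> f n \<le> C\<^sup>2 / (real n)\<^sup>2))
      \<longrightarrow> summable f \<and> suminf f \<le> \<eta>\<^sup>2 / 2"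
    using small_series[OF _ \<eta>2, of "C\<^sup>2"] by auto
  define \<delta> where "\<delta> = min \<delta>1 (min 1 \<delta>2)"
  have \<delta>: "0 < \<delta>" "\<delta> \<le> \<delta>1" "\<delta> \<le> 1" "\<delta> \<le> \<delta>2" using \<delta>1 \<delta>2 by (auto simp: \<delta>_def)
  have "norm u \<le> \<eta>" if u: "\<And>n. \<bar>mode u n\<bar> \<le> \<delta>" "\<And>n. 1 \<le> n \<Longrightarrow> \<bar>mode u n\<bar> \<le> C / (real n)\<^sup>2" for u
  proof -
    have "(\<Sum>n. \<bar>mode u n\<bar>) \<le> \<eta> / 3"
    proof (rule s1[rule_format, THEN conjunct2], intro conjI impI)
      fix n :: nat
      have "\<delta> * 1 \<le> \<delta>1 * (1 + (real n)\<^sup>2)" using \<delta> by (intro mult_mono) auto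
      then show "\<bar>mode u n\<bar> \<le> \<delta>1 * (1 + (real n)\<^sup>2)" using u(1)[of n] by simp
    qed (use u in auto)
    moreover have "0 \<le> (\<Sum>n. \<bar>mode u n\<bar>)" by (intro suminf_nonneg mode_summable) simp
    ultimately have "(\<Sum>n. \<bar>mode u n\<bar>)\<^sup>2 \<le> (\<eta> / 3)\<^sup>2" by (intro power_mono)
    then have "pi * (\<Sum>n. \<bar>mode u n\<bar>)\<^sup>2 \<le> 4 * (\<eta> / 3)\<^sup>2" using pi_less_4 by (intro mult_mono) auto
    also have "\<dots> \<le> \<eta>\<^sup>2 / 2" using \<eta> by (simp add: power_divide)
    finally have 1: "pi * (\<Sum>n. \<bar>mode u n\<bar>)\<^sup>2 \<le> \<eta>\<^sup>2 / 2" .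
    have 2: "(\<Sum>n. (real n * mode u n)\<^sup>2) \<le> \<eta>\<^sup>2 / 2"
    proof (rule s2[rule_format, THEN conjunct2], intro conjI impI)
      fix n :: nat
      show "0 \<le> (real n * mode u n)\<^sup>2" by simp
      have "\<bar>mode u n\<bar>\<^sup>2 \<le> \<delta>\<^sup>2" by (intro power_mono u) simp
      also have "\<dots> \<le> \<delta> * 1" unfolding power2_eq_square using \<delta> by (intro mult_left_mono) auto
      finally have "(mode u n)\<^sup>2 \<le> \<delta>2" using \<delta> by simp
      then have "(real n)\<^sup>2 * (mode u n)\<^sup>2 \<le> (1 + (real n)\<^sup>2) * \<delta>2" by (intro mult_mono) auto
      then show "(real n * mode u n)\<^sup>2 \<le> \<delta>2 * (1 + (real n)\<^sup>2)" by (simp add: power_mult_distrib mult.commute)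
      assume n: "1 \<le> n"
      have "\<bar>mode u n\<bar>\<^sup>2 \<le> (C / (real n)\<^sup>2)\<^sup>2" by (intro power_mono u n) simp
      then have "(real n)\<^sup>2 * (mode u n)\<^sup>2 \<le> (real n)\<^sup>2 * (C / (real n)\<^sup>2)\<^sup>2" by (intro mult_left_mono) auto
      also have "\<dots> = C\<^sup>2 / (real n)\<^sup>2" using n by (simp add: power_divide power2_eq_square)
      finally show "(real n * mode u n)\<^sup>2 \<le> C\<^sup>2 / (real n)\<^sup>2" by (simp add: power_mult_distrib)
    qed
    have "(norm u)\<^sup>2 \<le> \<eta>\<^sup>2" using norm_H1_le_modes[of u] 1 2 by linarith
    then show ?thesis by (rule power2_le_imp_le) (use \<eta> in simp)
  qed
  with \<delta>(1) show ?thesis by blast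
qed

lemma omega_limit_eq_zero:
  fixes F :: "real \<Rightarrow> 'a::real_normed_vector \<Rightarrow> 'a"
  assumes B: "B \<noteq> {}" and F: "\<And>\<eta>. 0 < \<eta> \<Longrightarrow> \<exists>T\<ge>0. \<forall>t\<ge>T. \<forall>u\<in>B. norm (F t u) \<le> \<eta>"
  shows "omega_limit F B = {0}"
proof
  show "omega_limit F B \<subseteq> {0}"
  proof
    fix x assume x: "x \<in> omega_limit F B"
    show "x \<in> {0}"
    proof (rule ccontr)
      assume "x \<notin> {0}"
      then have n: "0 < norm x / 2" by simp
      obtain T where T: "0 \<le> T" "\<And>t u. T \<le> t \<Longrightarrow> u \<in> B \<Longrightarrow> norm (F t u) \<le> norm x / 2" using F[OF n] by blast
      have "x \<in> closure (\<Union>t\<in>{T..}. F t ` B)" using x T(1) by (auto simp: omega_limit_def)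
      moreover have "closure (\<Union>t\<in>{T..}. F t ` B) \<subseteq> cball 0 (norm x / 2)"
        by (rule closure_minimal) (use T(2) in auto)
      ultimately have "norm x \<le> norm x / 2" by auto
      with n show False by simp
    qed
  qed
  have "0 \<in> closure (\<Union>t\<in>{s..}. F t ` B)" for s
    unfolding closure_approachable
  proof (intro allI impI)
    fix e :: real assume "0 < e"
    then obtain T where T: "\<And>t u. T \<le> t \<Longrightarrow> u \<in> B \<Longrightarrow> norm (F t u) \<le> e / 2" using F[of "e / 2"] by auto
    obtain u where "u \<in> B" using B by blast
    then show "\<exists>z\<in>(\<Union>t\<in>{s..}. F t ` B). dist z 0 < e"
      using T[of "max s T" u] \<open>0 < e\<close> by (intro bexI[of _ "F (max s T) u"]) auto
  qed
  then show "{0} \<subseteq> omega_limit F B" by (auto simp: omega_limit_def)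
qed

lemma global_attractor_eq_zero:
  fixes F :: "real \<Rightarrow> 'a::real_normed_vector \<Rightarrow> 'a"
  assumes "\<And>u \<eta>. 0 < \<eta> \<Longrightarrow> \<exists>T\<ge>0. \<forall>t\<ge>T. norm (F t u) \<le> \<eta>"
  shows "global_attractor F = {0}"
proof -
  have "omega_limit F {u} = {0}" for u by (rule omega_limit_eq_zero) (use assms in auto)
  then show ?thesis by (simp add: global_attractor_def)
qed

text \<open>The empty set is bounded and has an empty limit set, so the union is formed by the nonempty sets.\<close>

lemma global_B_attractor_eq_zero:
  fixes F :: "real \<Rightarrow> 'a::real_normed_vector \<Rightarrow> 'a"
  assumes F: "\<And>B \<eta>. bounded B \<Longrightarrow> 0 < \<eta> \<Longrightarrow> \<exists>T\<ge>0. \<forall>t\<ge>T. \<forall>u\<in>B. norm (F t u) \<le> \<eta>"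
  shows "global_B_attractor F = {0}"
proof -
  have "omega_limit F B = (if B = {} then {} else {0})" if "bounded B" for B
  proof (cases "B = {}")
    case True
    then show ?thesis by (auto simp: omega_limit_def)
  next
    case False
    then show ?thesis using omega_limit_eq_zero[OF False, of F] F[OF that] by simp
  qed
  note o = this
  have "omega_limit F {0} = {0}" using o[of "{0}"] by simp
  then have "0 \<in> global_B_attractor F" unfolding global_B_attractor_def by (intro UN_I[of "{0}"]) auto
  moreover have "x = 0" if "x \<in> global_B_attractor F" for x
    using that o by (auto simp: global_B_attractor_def split: if_splits)
  ultimately show ?thesis by blast
qed

lemma uniform_norm_decay:
  assumes C: "0 \<le> C" and \<eta>: "0 < \<eta>"
    and modes: "\<And>u. u \<in> B \<Longrightarrow> thermostat_modes \<beta> C (\<lambda>n t. mode (F (t + 1) u) n) (\<lambda>t. H1_fun (F (t + 1) u) pi)"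
    and decay: "\<And>\<eta>. 0 < \<eta> \<Longrightarrow> \<exists>T\<ge>0. \<forall>u\<in>B. \<forall>t n. T \<le> t \<longrightarrow> \<bar>mode (F (t + 1) u) n\<bar> \<le> \<eta>"
  shows "\<exists>T\<ge>0. \<forall>t\<ge>T. \<forall>u\<in>B. norm (F t u) \<le> \<eta>"
proof -
  have C1: "0 \<le> C + 1" using C by simp
  obtain \<delta> where \<delta>: "0 < \<delta>" and small: "\<And>u. (\<forall>n. \<bar>mode u n\<bar> \<le> \<delta>) \<and> (\<forall>n\<ge>1. \<bar>mode u n\<bar> \<le> (C + 1) / (real n)\<^sup>2) \<Longrightarrow> norm u \<le> \<eta>"
    using norm_small_of_modes[OF C1 \<eta>] by blast
  obtain T where T: "0 \<le> T" "\<And>u t n. u \<in> B \<Longrightarrow> T \<le> t \<Longrightarrow> \<bar>mode (F (t + 1) u) n\<bar> \<le> \<delta>" using decay[OF \<delta>] by blast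
  have "norm (F t u) \<le> \<eta>" if t: "T + 1 \<le> t" and u: "u \<in> B" for t u
  proof -
    interpret thermostat_modes \<beta> C "\<lambda>n t. mode (F (t + 1) u) n" "\<lambda>t. H1_fun (F (t + 1) u) pi" by (rule modes[OF u])
    show ?thesis using T(2)[OF u, of "t - 1"] a_bound[of _ "t - 1"] t T(1) by (intro small) auto
  qed
  then show ?thesis using T(1) by (intro exI[of _ "T + 1"]) auto
qed

theorem theorem5p1:
  fixes T :: "real \<Rightarrow> Hm1 \<Rightarrow>\<^sub>L Hm1" and \<Phi> :: "real \<Rightarrow> real \<Rightarrow> H1 \<Rightarrow> H1"
  assumes semigroup: "neumann_heat_semigroup T"
    and semiflow: "\<And>\<beta> u\<^sub>0. \<beta> > 0 \<Longrightarrow> mild_solution T \<beta> u\<^sub>0 (\<lambda>t. \<Phi> \<beta> t u\<^sub>0)"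
  shows "(\<forall>\<beta>. 0 < \<beta> \<and> \<beta> < \<beta>\<^sub>0 \<longrightarrow> global_attractor (\<Phi> \<beta>) = {0})
    \<and> (\<forall>\<beta>. 0 < \<beta> \<and> \<beta> < 4 / pi \<longrightarrow>
          global_B_attractor (\<Phi> \<beta>) = global_attractor (\<Phi> \<beta>) \<and> global_attractor (\<Phi> \<beta>) = {0})"
proof (intro conjI allI impI)
  define K where "K \<rho> = (\<rho>\<^sup>2 + pi) / 2 + 1" for \<rho> :: real
  have K: "0 \<le> K \<rho>" for \<rho> by (simp add: K_def)
  have modes: "thermostat_modes \<beta> (K \<rho>) (\<lambda>n t. mode (\<Phi> \<beta> (t + 1) u) n) (\<lambda>t. H1_fun (\<Phi> \<beta> (t + 1) u) pi)"
    if "0 < \<beta>" "norm u \<le> \<rho>" for \<beta> \<rho> u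
    unfolding K_def by (rule solution_modes[OF semigroup that(1) semiflow[OF that(1)] that(2)])
  fix \<beta>
  {
    assume \<beta>: "0 < \<beta> \<and> \<beta> < \<beta>\<^sub>0"
    show "global_attractor (\<Phi> \<beta>) = {0}"
    proof (rule global_attractor_eq_zero)
      fix u and \<eta> :: real assume \<eta>: "0 < \<eta>"
      note m = modes[of \<beta> u "norm u"]
      have "\<exists>T\<ge>0. \<forall>t\<ge>T. \<forall>v\<in>{u}. norm (\<Phi> \<beta> t v) \<le> \<eta>"
      proof (rule uniform_norm_decay[OF K \<eta>])
        show "thermostat_modes \<beta> (K (norm u)) (\<lambda>n t. mode (\<Phi> \<beta> (t + 1) v) n) (\<lambda>t. H1_fun (\<Phi> \<beta> (t + 1) v) pi)" if "v \<in> {u}" for v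
          using m \<beta> that by simp
        show "\<exists>T\<ge>0. \<forall>v\<in>{u}. \<forall>t n. T \<le> t \<longrightarrow> \<bar>mode (\<Phi> \<beta> (t + 1) v) n\<bar> \<le> \<eta>" if "0 < \<eta>" for \<eta>
          using modes_decay[OF m _ that] \<beta> by simp
      qed
      then show "\<exists>T\<ge>0. \<forall>t\<ge>T. norm (\<Phi> \<beta> t u) \<le> \<eta>" by simp
    qed
  next
    assume \<beta>: "0 < \<beta> \<and> \<beta> < 4 / pi"
    have dec: "\<exists>T\<ge>0. \<forall>t\<ge>T. \<forall>u\<in>B. norm (\<Phi> \<beta> t u) \<le> \<eta>" if B: "bounded B" and \<eta>: "0 < \<eta>" for B \<eta>
    proof -
      obtain \<rho> where \<rho>: "\<And>u. u \<in> B \<Longrightarrow> norm u \<le> \<rho>" using B by (auto simp: bounded_iff)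
      show ?thesis
      proof (rule uniform_norm_decay[OF K \<eta>])
        show m: "thermostat_modes \<beta> (K \<rho>) (\<lambda>n t. mode (\<Phi> \<beta> (t + 1) u) n) (\<lambda>t. H1_fun (\<Phi> \<beta> (t + 1) u) pi)" if "u \<in> B" for u
          using modes[OF _ \<rho>[OF that]] \<beta> by blast
        fix \<eta>' :: real assume \<eta>': "0 < \<eta>'"
        obtain T where T: "0 \<le> T" "\<forall>a y t n. thermostat_modes \<beta> (K \<rho>) a y \<longrightarrow> T \<le> t \<longrightarrow> \<bar>a n t\<bar> \<le> \<eta>'"
          using uniform_decay[OF _ _ K \<eta>'] \<beta> by blast
        have "\<bar>mode (\<Phi> \<beta> (t + 1) u) n\<bar> \<le> \<eta>'" if "u \<in> B" "T \<le> t" for u t n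
          using T(2)[rule_format, OF m[OF that(1)] that(2)] .
        then show "\<exists>T\<ge>0. \<forall>u\<in>B. \<forall>t n. T \<le> t \<longrightarrow> \<bar>mode (\<Phi> \<beta> (t + 1) u) n\<bar> \<le> \<eta>'" using T(1) by blast
      qed
    qed
    show A: "global_attractor (\<Phi> \<beta>) = {0}"
      by (rule global_attractor_eq_zero) (use dec[of "{_}"] in simp)
    then show "global_B_attractor (\<Phi> \<beta>) = global_attractor (\<Phi> \<beta>)"
      using global_B_attractor_eq_zero[OF dec] by simp
  }
qed

end
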